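(* Let $n\ge1$ and let $\mathbf{k}=(k_1,\dots,k_n)$ be a weak composition of $n$. The map $\tau$ is a bijection $\mathrm{Tour}(\mathbf{k})\to\mathrm{CPF}(\mathbf{k})$, and, with $i$ the index of the rightmost $0$ in $\mathbf{k}$ (and $i=c$ if $\mathbf{k}=(1,\dots,1)$), the square formed by the maps $$\tau:\mathrm{Tour}(\mathbf{k})\to\mathrm{CPF}(\mathbf{k}),\qquad \hat r:\mathrm{CPF}(\mathbf{k})\to\coprod_{j>i}\mathrm{CPF}(\widetilde{\mathbf{k}}_j),$$ $$\pi_{\mathrm{lazy}}:\mathrm{Tour}(\mathbf{k})\to\coprod_{j>i}\mathrm{Tour}(\widetilde{\mathbf{k}}_j),\qquad \coprod\tau:\coprod_{j>i}\mathrm{Tour}(\widetilde{\mathbf{k}}_j)\to\coprod_{j>i}\mathrm{CPF}(\widetilde{\mathbf{k}}_j)$$ commutes, i.e. $\hat r\circ\tau=\left(\coprod\tau\right)\circ\pi_{\mathrm{lazy}}$.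
   Context: **Weak compositions and the tilde construction.** A weak composition $\mathbf{k}=(k_1,\dots,k_n)$ of $n$ here means a sequence of $n$ nonnegative integers with sum $n$. Let $i=\max\{\ell:k_\ell=0\}$, with the convention $i=c$ if $\mathbf{k}=(1,1,\dots,1)$. For $j>i$ with $j\in\{1,\dots,n\}$ (all $j\in\{1,\dots,n\}$ are allowed if $i=c$), $\widetilde{\mathbf{k}}_j$ is the weak composition of $n-1$ of length $n-1$ obtained by decreasing $k_j$ by $1$ and then removing the rightmost $0$ in the resulting sequence. **Trees.** Let $X_n=\{a,b,c,1,\dots,n\}$, ordered by $a<b<c<1<2<\cdots<n$. A trivalent tree is a finite tree in which every vertex has degree $1$ or $3$ and at least one vertex has degree $3$. It is leaf-labeled by $X_n$ if its leaves are in bijection with $X_n$; such trees are considered up to label-preserving isomorphism. A leaf edge is an edge incident to a leaf. **Lazy tournament** of a leaf-labeled trivalent tree $T$: a labeling of the edges of $T$ computed as follows. Label each leaf edge by the label of its leaf. Then repeat the following round until all edges are labeled (there are $n$ rounds). (1) Among all pairs of labeled edges $(i,j)$ (written by their labels, with $i<j$) that share a vertex whose third edge $E$ is unlabeled, choose the pair with the largest value of $i$; $i$ and $j$ face off (compete) in this round. (2) The larger label $j$ wins the round and the smaller label $i$ loses it. (3) If $E$ is adjacent to a labeled edge with label $u\ne j$ and $u>i$, label $E$ by $i$ ($i$ advances); this is the laziness rule. Otherwise label $E$ by $j$ ($j$ advances). **Tour.** $\mathrm{Tour}(\mathbf{k})$ is the set of trivalent trees with leaves labeled by $X_n$ in which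 the leaf edges $a$ and $b$ share a vertex, and each label $i\in\{1,\dots,n\}$ wins exactly $k_i$ rounds of the lazy tournament. For $n=0$, $\mathrm{Tour}(\emptyset)=\{T_0\}$ where $T_0$ is the unique trivalent tree with leaves $a,b,c$. **The map $\pi_{\mathrm{lazy}}$.** $\coprod$ denotes formal disjoint union of sets. For $T\in\mathrm{Tour}(\mathbf{k})$, let $(i,j)$ with $i<j$ be the pair that faces off first in the tournament of $T$ (it is known that this $i$ is the index of the rightmost $0$ of $\mathbf{k}$, with the convention that this index is $c$ if $\mathbf{k}=(1,1,\dots,1)$), and let $v$ be the vertex at which the leaf edges $i$ and $j$ meet. If $k_j>1$, then $\pi_{\mathrm{lazy}}(T)$ is the tree formed by labeling $v$ by $j$, removing the leaves and leaf edges of $i$ and $j$, and decreasing all of the labels $i+1,\dots,n$ by $1$ (so $v$ becomes a leaf with label $j-1$). If $k_j=1$, then $\pi_{\mathrm{lazy}}(T)$ is the tree formed by labeling $v$ by $i$, removing the leaves and leaf edges of $i$ and $j$, and decreasing all of the labels $j+1,\dots,n$ by $1$. The tree $\pi_{\mathrm{lazy}}(T)$ is regarded as an element of the summand $\mathrm{Tour}(\widetilde{\mathbf{k}}_j)$ indexed by $j$. **Parking functions.** A Dyck path of height $n$ is a lattice path from $(0,n)$ to $(n,0)$ using right $(1,0)$ and down $(0,-1)$ unit steps that stays weakly above the diagonal line connecting the endpoints. A parking function of size $n$ is a labeling of the unit squares just to the left of the down steps of a Dyck path of height $n$ with the numbers $1,\dots,n$ (each used once) such that the numbers in each column increase going up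 the column. The $i$th column is the $i$th column of squares from the left in the $n\times n$ box. $\mathrm{PF}(n)$ is the set of parking functions of size $n$. A label $x$ of a parking function dominates a column to its right if that column contains no entry greater than $x$ (so empty columns are dominated); the dominance index $d_x$ is the number of columns to the right of $x$ dominated by $x$. A parking function is column-restricted if $x>d_x$ for all $x=1,\dots,n$. $\mathrm{CPF}(k_1,\dots,k_n)$ is the set of column-restricted parking functions having exactly $k_i$ labels in the $i$th column for all $i$. **The map $\hat r$.** $r:\mathrm{PF}(n)\to\mathrm{PF}(n-1)$ is defined by removing the row containing the number $1$, decrementing all remaining labels, and then deleting the rightmost empty column. $\hat r:\mathrm{CPF}(\mathbf{k})\to\coprod_{j>i}\mathrm{CPF}(\widetilde{\mathbf{k}}_j)$ is the map induced by $r$: if $1$ lies in column $j$ of $P$, then $\hat r(P)$ is $r(P)$ in the summand indexed by $j$. (It is known from earlier work that $\hat r$ is a well-defined bijection.) **The map $\tau$.** For $T\in\mathrm{Tour}(\mathbf{k})$, $\tau(T)$ is the unique parking function of size $n$ such that for all $1\le j,m\le n$, $\tau(T)$ contains the number $m$ in column $j$ if and only if $j$ wins round $m$ of the tournament of $T$. The map $\coprod\tau$ is $\tau$ applied on each summand. *)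

theory Defs
  imports Main "HOL-Library.FuncSet"
begin

section \<open>Weak compositions\<close>

text \<open>A sequence (k_1, ..., k_n) is a list, so k_j is \<open>k ! (j - 1)\<close>.  The leaf labels
  a, b, c, 1, ..., n are the integers -2, -1, 0, 1, ..., n with their usual order.  In particular
  c is 0, and this is also the value of \<open>last_zero\<close> when no entry is zero.\<close>

definition weak_composition :: "nat \<Rightarrow> nat list \<Rightarrow> bool" where
  "weak_composition n k \<longleftrightarrow> length k = n \<and> sum_list k = n"

definition last_zero :: "nat list \<Rightarrow> nat" where
  "last_zero k =
     (if 0 \<in> set k then Max {l \<in> {1..length k}. k ! (l - 1) = 0} else 0)"

definition tilde :: "nat list \<Rightarrow> nat \<Rightarrow> nat list" where
  "tilde k j = rev (remove1 0 (rev (k[j - 1 := k ! (j - 1) - 1])))"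

definition summands :: "nat list \<Rightarrow> nat set" where
  "summands k = {last_zero k<..length k}"


section \<open>Leaf-labeled trivalent trees\<close>

text \<open>An edge is the set of its two endpoints.  Only the values of \<open>lab\<close> at leaves matter.\<close>

record 'v ltree =
  verts :: "'v set"
  edges :: "'v set set"
  lab :: "'v \<Rightarrow> int"

abbreviation label_a :: int where "label_a \<equiv> -2"
abbreviation label_b :: int where "label_b \<equiv> -1"
abbreviation label_c :: int where "label_c \<equiv> 0"

definition leaf_labels :: "nat \<Rightarrow> int set" where
  "leaf_labels n = {label_a, label_b, label_c} \<union> {1..int n}"

definition adj :: "'v ltree \<Rightarrow> 'v \<Rightarrow> 'v \<Rightarrow> bool" where
  "adj T u v \<longleftrightarrow> {u, v} \<in> edges T"

definition simple_graph :: "'v ltree \<Rightarrow> bool" where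
  "simple_graph T \<longleftrightarrow> (\<forall>e \<in> edges T. e \<subseteq> verts T \<and> card e = 2)"

definition connected_graph :: "'v ltree \<Rightarrow> bool" where
  "connected_graph T \<longleftrightarrow>
     verts T \<noteq> {} \<and> (\<forall>u \<in> verts T. \<forall>v \<in> verts T. (adj T)\<^sup>*\<^sup>* u v)"

definition cycle :: "'v ltree \<Rightarrow> 'v list \<Rightarrow> bool" where
  "cycle T p \<longleftrightarrow>
     3 \<le> length p \<and> distinct p \<and> successively (adj T) p \<and> adj T (last p) (hd p)"

definition finite_tree :: "'v ltree \<Rightarrow> bool" where
  "finite_tree T \<longleftrightarrow>
     finite (verts T) \<and> simple_graph T \<and> connected_graph T \<and> (\<nexists>p. cycle T p)"

definition degree :: "'v ltree \<Rightarrow> 'v \<Rightarrow> nat" where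
  "degree T v = card {e \<in> edges T. v \<in> e}"

definition trivalent_tree :: "'v ltree \<Rightarrow> bool" where
  "trivalent_tree T \<longleftrightarrow> finite_tree T \<and>
     (\<forall>v \<in> verts T. degree T v = 1 \<or> degree T v = 3) \<and> (\<exists>v \<in> verts T. degree T v = 3)"

definition leaves :: "'v ltree \<Rightarrow> 'v set" where
  "leaves T = {v \<in> verts T. degree T v = 1}"

definition leaf_labeled_tree :: "nat \<Rightarrow> 'v ltree \<Rightarrow> bool" where
  "leaf_labeled_tree n T \<longleftrightarrow> trivalent_tree T \<and> bij_betw (lab T) (leaves T) (leaf_labels n)"

definition isomorphic :: "'v ltree \<Rightarrow> 'w ltree \<Rightarrow> bool" where
  "isomorphic T T' \<longleftrightarrow> (\<exists>\<phi>. bij_betw \<phi> (verts T) (verts T') \<and>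
     edges T' = (\<lambda>e. \<phi> ` e) ` edges T \<and> (\<forall>v \<in> leaves T. lab T' (\<phi> v) = lab T v))"

text \<open>Vertices are natural numbers from here on: every finite tree is isomorphic to such a tree.\<close>

definition tree_iso :: "nat \<Rightarrow> (nat ltree \<times> nat ltree) set" where
  "tree_iso n = {(T, T'). leaf_labeled_tree n T \<and> leaf_labeled_tree n T' \<and> isomorphic T T'}"


section \<open>The lazy tournament\<close>

text \<open>A state of the tournament is a partial labeling of the edges.\<close>

definition leaf_edge_labeling :: "'v ltree \<Rightarrow> 'v set \<Rightarrow> int option" where
  "leaf_edge_labeling T e =
     (if e \<in> edges T \<and> (\<exists>v \<in> leaves T. v \<in> e)
      then Some (lab T (THE v. v \<in> leaves T \<and> v \<in> e)) else None)"

text \<open>A quadruple (i, j, v, E) in \<open>contests T \<sigma>\<close> is a pair of labels i < j of edges meeting at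
  the vertex v, whose third edge E is unlabeled.\<close>

definition contests ::
  "'v ltree \<Rightarrow> ('v set \<Rightarrow> int option) \<Rightarrow> (int \<times> int \<times> 'v \<times> 'v set) set" where
  "contests T \<sigma> = {(i, j, v, E). v \<in> verts T \<and> i < j \<and>
     (\<exists>e \<in> edges T. \<exists>f \<in> edges T. v \<in> e \<and> v \<in> f \<and> \<sigma> e = Some i \<and> \<sigma> f = Some j) \<and>
     E \<in> edges T \<and> v \<in> E \<and> \<sigma> E = None}"

text \<open>On the states that occur, the contest with the largest smaller label is unique.\<close>

definition face_off ::
  "'v ltree \<Rightarrow> ('v set \<Rightarrow> int option) \<Rightarrow> int \<times> int \<times> 'v \<times> 'v set" where
  "face_off T \<sigma> = (ARG_MAX fst q. q \<in> contests T \<sigma>)"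

definition lazy_rule ::
  "'v ltree \<Rightarrow> ('v set \<Rightarrow> int option) \<Rightarrow> int \<Rightarrow> int \<Rightarrow> 'v set \<Rightarrow> bool" where
  "lazy_rule T \<sigma> i j E \<longleftrightarrow>
     (\<exists>f \<in> edges T. \<exists>u. f \<noteq> E \<and> f \<inter> E \<noteq> {} \<and> \<sigma> f = Some u \<and> u \<noteq> j \<and> u > i)"

definition play_round ::
  "'v ltree \<Rightarrow> ('v set \<Rightarrow> int option) \<Rightarrow> ('v set \<Rightarrow> int option)" where
  "play_round T \<sigma> =
     (case face_off T \<sigma> of (i, j, v, E) \<Rightarrow> \<sigma>(E \<mapsto> (if lazy_rule T \<sigma> i j E then i else j)))"

primrec tournament_state :: "'v ltree \<Rightarrow> nat \<Rightarrow> ('v set \<Rightarrow> int option)" where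
  "tournament_state T 0 = leaf_edge_labeling T"
| "tournament_state T (Suc m) = play_round T (tournament_state T m)"

text \<open>Rounds are numbered from 1, and round m is played in the state left by m - 1 rounds.\<close>

definition round_contest :: "'v ltree \<Rightarrow> nat \<Rightarrow> int \<times> int \<times> 'v \<times> 'v set" where
  "round_contest T m = face_off T (tournament_state T (m - 1))"

definition wins_round :: "'v ltree \<Rightarrow> nat \<Rightarrow> nat \<Rightarrow> bool" where
  "wins_round T j m \<longleftrightarrow> fst (snd (round_contest T m)) = int j"

definition ab_adjacent :: "'v ltree \<Rightarrow> bool" where
  "ab_adjacent T \<longleftrightarrow> (\<exists>e \<in> edges T. \<exists>f \<in> edges T.
     leaf_edge_labeling T e = Some label_a \<and> leaf_edge_labeling T f = Some label_b \<and> e \<inter> f \<noteq> {})"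

definition Tour_trees :: "nat list \<Rightarrow> nat ltree set" where
  "Tour_trees k = {T. leaf_labeled_tree (length k) T \<and> ab_adjacent T \<and>
     (\<forall>i \<in> {1..length k}. card {m \<in> {1..length k}. wins_round T i m} = k ! (i - 1))}"

text \<open>Elements of \<open>Tour k\<close> are isomorphism classes of trees.  Maps on \<open>Tour k\<close> are defined on
  representatives; \<open>the_elem\<close> extracts the common value on a class.\<close>

definition Tour :: "nat list \<Rightarrow> nat ltree set set" where
  "Tour k = Tour_trees k // tree_iso (length k)"


section \<open>The map pi lazy\<close>

definition pi_tree :: "nat list \<Rightarrow> 'v ltree \<Rightarrow> 'v ltree" where
  "pi_tree k T = (case round_contest T 1 of (i, j, v, E) \<Rightarrow>
     let D = {x \<in> leaves T. lab T x = i \<or> lab T x = j};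
         (new, t) = (if k ! (nat j - 1) > 1 then (j, i) else (i, j))
     in \<lparr> verts = verts T - D,
          edges = {e \<in> edges T. e \<inter> D = {}},
          lab = (\<lambda>x. let l = ((lab T)(v := new)) x in if l > t then l - 1 else l) \<rparr>)"

definition pi_lazy :: "nat list \<Rightarrow> nat ltree set \<Rightarrow> nat \<times> nat ltree set" where
  "pi_lazy k C = the_elem
     ((\<lambda>T. (nat (fst (snd (round_contest T 1))),
            tree_iso (length k - 1) `` {pi_tree k T})) ` C)"


section \<open>Parking functions\<close>

text \<open>A lattice path is the list of points it visits.\<close>

definition path_step :: "nat \<times> nat \<Rightarrow> nat \<times> nat \<Rightarrow> bool" where
  "path_step p q \<longleftrightarrow> q = (Suc (fst p), snd p) \<or> p = (fst q, Suc (snd q))"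

definition dyck_path :: "nat \<Rightarrow> (nat \<times> nat) list \<Rightarrow> bool" where
  "dyck_path n p \<longleftrightarrow> p \<noteq> [] \<and> hd p = (0, n) \<and> last p = (n, 0) \<and>
     successively path_step p \<and> (\<forall>(x, y) \<in> set p. x + y \<ge> n)"

text \<open>The unit square with upper right corner (x, y) is denoted by (x, y); it lies in column x
  from the left and row y from the bottom, and it is the square just left of a down step
  starting at (x, y).\<close>

definition left_squares :: "(nat \<times> nat) list \<Rightarrow> (nat \<times> nat) set" where
  "left_squares p =
     {(x, Suc y) | x y. \<exists>t. Suc t < length p \<and> p ! t = (x, Suc y) \<and> p ! Suc t = (x, y)}"

text \<open>A parking function is a partial labeling of the squares; its domain determines the path.\<close>

type_synonym labeling = "nat \<times> nat \<Rightarrow> nat option"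

definition PF :: "nat \<Rightarrow> labeling set" where
  "PF n = {P. (\<exists>p. dyck_path n p \<and> dom P = left_squares p) \<and>
     inj_on P (dom P) \<and> ran P = {1..n} \<and>
     (\<forall>x y y' m m'. P (x, y) = Some m \<and> P (x, y') = Some m' \<and> y < y' \<longrightarrow> m < m')}"

definition in_column :: "labeling \<Rightarrow> nat \<Rightarrow> nat \<Rightarrow> bool" where
  "in_column P m j \<longleftrightarrow> (\<exists>y. P (j, y) = Some m)"

definition column_of :: "labeling \<Rightarrow> nat \<Rightarrow> nat" where
  "column_of P m = (THE j. in_column P m j)"

definition row_of :: "labeling \<Rightarrow> nat \<Rightarrow> nat" where
  "row_of P m = (THE y. \<exists>x. P (x, y) = Some m)"

definition dominance_index :: "nat \<Rightarrow> labeling \<Rightarrow> nat \<Rightarrow> nat" where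
  "dominance_index n P x =
     card {j \<in> {column_of P x<..n}. \<forall>m. in_column P m j \<longrightarrow> \<not> m > x}"

definition column_restricted :: "nat \<Rightarrow> labeling \<Rightarrow> bool" where
  "column_restricted n P \<longleftrightarrow> (\<forall>x \<in> {1..n}. x > dominance_index n P x)"

definition CPF :: "nat list \<Rightarrow> labeling set" where
  "CPF k = {P \<in> PF (length k). column_restricted (length k) P \<and>
     (\<forall>i \<in> {1..length k}. card {m. in_column P m i} = k ! (i - 1))}"


section \<open>The map r hat\<close>

definition delete_row :: "nat \<Rightarrow> labeling \<Rightarrow> labeling" where
  "delete_row b P = (\<lambda>(x, y). P (x, if y < b then y else Suc y))"

definition delete_column :: "nat \<Rightarrow> labeling \<Rightarrow> labeling" where
  "delete_column a P = (\<lambda>(x, y). P (if x < a then x else Suc x, y))"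

definition rightmost_empty_column :: "nat \<Rightarrow> labeling \<Rightarrow> nat" where
  "rightmost_empty_column n P = Max {j \<in> {1..n}. \<forall>m. \<not> in_column P m j}"

definition r_map :: "nat \<Rightarrow> labeling \<Rightarrow> labeling" where
  "r_map n P =
     (let Q = map_option (\<lambda>m. m - 1) \<circ> delete_row (row_of P 1) P
      in delete_column (rightmost_empty_column n Q) Q)"

definition r_hat :: "nat \<Rightarrow> labeling \<Rightarrow> nat \<times> labeling" where
  "r_hat n P = (column_of P 1, r_map n P)"


section \<open>The map tau\<close>

definition tau_tree :: "nat \<Rightarrow> 'v ltree \<Rightarrow> labeling" where
  "tau_tree n T = (THE P. P \<in> PF n \<and>
     (\<forall>j \<in> {1..n}. \<forall>m \<in> {1..n}. in_column P m j \<longleftrightarrow> wins_round T j m))"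

definition tau :: "nat \<Rightarrow> nat ltree set \<Rightarrow> labeling" where
  "tau n C = the_elem (tau_tree n ` C)"

text \<open>The disjoint unions are indexed by j, and \<open>coprod_tau n\<close> is applied to trees with
  leaf labels up to n.\<close>

definition coprod_tau :: "nat \<Rightarrow> nat \<times> nat ltree set \<Rightarrow> nat \<times> labeling" where
  "coprod_tau n = (\<lambda>(j, C). (j, tau n C))"

definition coprod_Tour :: "nat list \<Rightarrow> (nat \<times> nat ltree set) set" where
  "coprod_Tour k = (SIGMA j : summands k. Tour (tilde k j))"

definition coprod_CPF :: "nat list \<Rightarrow> (nat \<times> labeling) set" where
  "coprod_CPF k = (SIGMA j : summands k. CPF (tilde k j))"

end

theory Submission
  imports Defs
begin

text \<open>Both trees and parking functions are encoded by words of length n: a tree by the winners of its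
  rounds (\<open>winners\<close>), a parking function by the columns of its labels 1, ..., n (\<open>park\<close>).  The map
  \<open>\<tau>\<close> turns a tree into the parking function with the same word, so it is enough to show that both
  encodings are bijections onto the same set of words and that \<open>r\<close> and the lazy pruning act in
  the same way on words.

  Let \<open>S\<close> be the set of available labels, initially c = 0, 1, ..., n.  The words in question are
  the \<open>restricted\<close> ones, which is column-restrictedness read off the columns.  They have a recursive
  description (\<open>restricted_Cons\<close>): if \<open>S\<close> has one label more than \<open>j # u\<close> has letters, then
  \<open>j # u\<close> is restricted over \<open>S\<close> iff \<open>j\<close> is in \<open>S\<close>, every label of \<open>S\<close> beyond \<open>j\<close> occurs
  in \<open>u\<close>, and \<open>u\<close> is restricted over \<open>S\<close> without the largest label \<open>t\<close> that does not
  occur in \<open>u\<close>.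

  On the side of trees, once the first pair i < j has met at a vertex v and a label has advanced, the
  third edge at v behaves like a leaf edge, and the remaining rounds are those of the tree in
  which the leaves i and j are pruned and v carries the advancing label (\<open>winners_first\<close>).  The point
  of the laziness rule is the following.  If i advances, it faces a larger label next and loses
  again; if j advances, the next loser is smaller than i.  By induction, i is the largest label
  that never wins and, unless the round is the last one, j advances iff it wins again.  So while
  rounds remain the label that disappears is exactly \<open>t\<close>, and the recursion for winners is the
  recursion for restricted words (\<open>winners_restricted\<close>).  It can be run backwards by attaching
  cherries (\<open>exists_tree_with_winners\<close>), and the tree is determined up to isomorphism
  (\<open>tree_determined_by_winners\<close>).

  On the side of parking functions, a labelling is recovered from its word, since going up through
  the rows one meets the labels in the order of decreasing columns and, inside a column, of
  increasing labels.  The Dyck condition follows from the restriction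
  (\<open>restricted_few_small_letters\<close>), hence column-restricted parking functions correspond to
  restricted words (\<open>CPF_eq_park\<close>).

  Finally, \<open>r\<close> removes the label 1, that is the first letter, and the column \<open>t\<close>
  (\<open>r_hat_park\<close>), while the map on trees drops the first round and the label \<open>t\<close>
  (\<open>pi_tree_winners\<close>).  Both then renumber, so the square commutes.\<close>

section \<open>Neighbours in a tree\<close>

definition nb :: "'v ltree \<Rightarrow> 'v \<Rightarrow> 'v set" where
  "nb T v = {u. adj T v u}"

lemma adj_commute: "adj T u v \<longleftrightarrow> adj T v u"
  by (simp add: adj_def insert_commute)

lemma in_nb_iff [simp]: "u \<in> nb T v \<longleftrightarrow> adj T v u"
  by (simp add: nb_def)

lemma adj_simple:
  assumes "simple_graph T" "adj T u v"
  shows "u \<in> verts T" "v \<in> verts T" "u \<noteq> v"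
  using assms by (force simp: simple_graph_def adj_def)+

lemma edge_at:
  assumes "simple_graph T" "e \<in> edges T" "v \<in> e"
  obtains u where "e = {v, u}" "adj T v u"
proof -
  have "card e = 2" using assms by (auto simp: simple_graph_def)
  then obtain p q where "e = {p, q}" by (auto simp: card_2_iff)
  then show ?thesis using assms that by (cases "v = p") (auto simp: adj_def insert_commute)
qed

lemma simple_edge:
  assumes "simple_graph T" "e \<in> edges T"
  obtains u v where "e = {u, v}" "adj T u v"
proof -
  have "card e = 2" using assms by (auto simp: simple_graph_def)
  then obtain p q where "e = {p, q}" by (auto simp: card_2_iff)
  then show ?thesis using assms that by (auto simp: adj_def)
qed

lemma degree_eq_card_nb:
  assumes "simple_graph T"
  shows "degree T v = card (nb T v)"
proof -
  have "{e \<in> edges T. v \<in> e} = (\<lambda>u. {v, u}) ` nb T v"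
    using assms by (auto simp: adj_def elim!: edge_at)
  moreover have "inj_on (\<lambda>u. {v, u}) (nb T v)"
    by (auto simp: inj_on_def doubleton_eq_iff)
  ultimately show ?thesis by (simp add: degree_def card_image)
qed

lemma trivalent_simple: "trivalent_tree T \<Longrightarrow> simple_graph T"
  and trivalent_finite: "trivalent_tree T \<Longrightarrow> finite (verts T)"
  by (auto simp: trivalent_tree_def finite_tree_def)

lemma leaves_subset: "leaves T \<subseteq> verts T"
  by (auto simp: leaves_def)

lemma finite_leaves: "trivalent_tree T \<Longrightarrow> finite (leaves T)"
  by (meson finite_subset leaves_subset trivalent_finite)

lemma leaf_nb:
  assumes "simple_graph T" "x \<in> leaves T"
  obtains p where "nb T x = {p}"
  using assms by (auto simp: leaves_def degree_eq_card_nb card_1_singleton_iff)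

lemma leaf_unique_nb:
  assumes "simple_graph T" "x \<in> leaves T" "adj T x p" "adj T x q"
  shows "p = q"
  using leaf_nb[OF assms(1,2)] assms(3,4) by (metis in_nb_iff singletonD)

lemma inner_card_nb:
  assumes "trivalent_tree T" "v \<in> verts T" "v \<notin> leaves T"
  shows "card (nb T v) = 3"
  using assms by (auto simp: leaves_def trivalent_tree_def
      degree_eq_card_nb[OF trivalent_simple[OF assms(1)], symmetric])

lemma third_nb:
  assumes "trivalent_tree T" "v \<notin> leaves T" "adj T v x" "adj T v y" "x \<noteq> y"
  obtains w where "nb T v = {x, y, w}" "w \<noteq> x" "w \<noteq> y"
proof -
  have v: "v \<in> verts T" using assms adj_simple trivalent_simple by metis
  then have c: "card (nb T v) = 3" using inner_card_nb assms by metis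
  then have "card (nb T v - {x, y}) = 1"
    using assms by (subst card_Diff_subset) auto
  then obtain w where w: "nb T v - {x, y} = {w}" by (auto simp: card_1_singleton_iff)
  have "x \<in> nb T v" "y \<in> nb T v" using assms by simp_all
  then have "nb T v = {x, y, w}" "w \<noteq> x" "w \<noteq> y" using w by blast+
  then show ?thesis using that by blast
qed

lemma closed_nb_all_verts:
  assumes T: "trivalent_tree T" and A: "v \<in> A" "v \<in> verts T"
    and closed: "\<And>p q. p \<in> A \<Longrightarrow> adj T p q \<Longrightarrow> q \<in> A"
  shows "verts T \<subseteq> A"
proof
  fix u assume "u \<in> verts T"
  then have "(adj T)\<^sup>*\<^sup>* v u"
    using T A by (auto simp: trivalent_tree_def finite_tree_def connected_graph_def)
  then show "u \<in> A" by (induction) (use A closed in auto)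
qed

lemma leaves_not_adj:
  assumes T: "trivalent_tree T" and x: "x \<in> leaves T" and y: "y \<in> leaves T"
  shows "\<not> adj T x y"
proof
  assume xy: "adj T x y"
  note s = trivalent_simple[OF T]
  have "verts T \<subseteq> {x, y}"
  proof (rule closed_nb_all_verts[OF T, of x])
    show "x \<in> verts T" using x by (auto simp: leaves_def)
    have "q = y" if "adj T x q" for q using leaf_unique_nb[OF s x that xy] .
    moreover have "q = x" if "adj T y q" for q
      using leaf_unique_nb[OF s y that] xy adj_commute[of T x y] by blast
    ultimately show "q \<in> {x, y}" if "p \<in> {x, y}" "adj T p q" for p q
      using that by blast
  qed simp
  moreover have "degree T x = 1" "degree T y = 1" using x y by (simp_all add: leaves_def)
  ultimately have "\<not> (\<exists>v \<in> verts T. degree T v = 3)" by auto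
  then show False using T by (simp add: trivalent_tree_def)
qed

lemma nb_leaf_not_leaf:
  assumes "trivalent_tree T" "x \<in> leaves T" "adj T x v"
  shows "v \<notin> leaves T"
  using leaves_not_adj[OF assms(1,2)] assms(3) by auto

lemma star_if_all_leaves:
  assumes T: "trivalent_tree T" and r: "r \<in> verts T" "r \<notin> leaves T" and n: "nb T r \<subseteq> leaves T"
  shows "verts T = insert r (nb T r)" "leaves T = nb T r"
proof -
  note s = trivalent_simple[OF T]
  have "verts T \<subseteq> insert r (nb T r)"
  proof (rule closed_nb_all_verts[OF T, of r])
    show "q \<in> insert r (nb T r)" if "p \<in> insert r (nb T r)" "adj T p q" for p q
    proof (cases "p = r")
      case False
      then have "p \<in> leaves T" "adj T p r" using that n adj_commute by fastforce+
      then have "q = r" using leaf_unique_nb[OF s] that by metis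
      then show ?thesis by simp
    qed (use that in auto)
  qed (use r in auto)
  then show 1: "verts T = insert r (nb T r)" using r adj_simple[OF s] by auto
  show "leaves T = nb T r" using 1 n r leaves_subset by fast
qed

text \<open>A path that bends back onto itself closes a cycle.\<close>

lemma path_extend:
  assumes nc: "\<nexists>p. cycle T p" and p: "distinct (h # h2 # rest)" "successively (adj T) (h # h2 # rest)"
    and s: "adj T s h" "s \<noteq> h" "s \<noteq> h2"
  shows "s \<notin> set (h # h2 # rest)"
proof
  assume "s \<in> set (h # h2 # rest)"
  then have "s \<in> set rest" using s by auto
  then obtain xs ys where r: "rest = xs @ s # ys" by (meson split_list)
  let ?c = "h # h2 # xs @ [s]"
  have "h # h2 # rest = ?c @ ys" using r by simp
  then have "distinct ?c" "successively (adj T) ?c"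
    using p by (metis distinct_append, metis successively_append_iff)
  then have "cycle T ?c" using s by (auto simp: cycle_def)
  then show False using nc by blast
qed

text \<open>The far end of a longest path that starts at a leaf is a cherry: a neighbour of the last but
  one vertex that were not a leaf would extend the path.  The condition on \<open>x\<close> makes the path long
  enough for this cherry to lie away from the start, which later excludes the cherry of a and b.\<close>

lemma far_cherry:
  assumes T: "trivalent_tree T" and a: "a \<in> leaves T" "adj T a r"
    and x: "adj T r x" "x \<notin> leaves T"
  shows "\<exists>w z z'. w \<noteq> r \<and> z \<in> leaves T \<and> z' \<in> leaves T \<and> z \<noteq> z' \<and> adj T z w \<and> adj T z' w"
proof -
  note s = trivalent_simple[OF T]
  have nc: "\<nexists>p. cycle T p" using T by (auto simp: trivalent_tree_def finite_tree_def)
  define P where "P = {p. distinct p \<and> successively (adj T) p \<and> set p \<subseteq> verts T \<and> p \<noteq> [] \<and> last p = a}"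
  have r: "r \<notin> leaves T" using nb_leaf_not_leaf[OF T a] .
  have len: "length p \<le> card (verts T)" if "p \<in> P" for p
    using that card_mono[OF trivalent_finite[OF T], of "set p"] by (auto simp: P_def distinct_card)
  have "card (nb T x) = 3" using inner_card_nb[OF T _ x(2)] adj_simple[OF s] x by blast
  then have "\<not> nb T x \<subseteq> {r}" using card_mono[of "{r}" "nb T x"] by auto
  then obtain q where q: "adj T x q" "q \<noteq> r" by (metis in_nb_iff singletonI subsetI)
  have "x \<noteq> a" using x a by auto
  moreover have "q \<noteq> a" using q a leaf_unique_nb[OF s a(1)] x nb_leaf_not_leaf[OF T] adj_commute
    by (metis adj_simple(3) s)
  ultimately have "[q, x, r, a] \<in> P"
    using q x a adj_simple[OF s] adj_commute[of T] by (fastforce simp: P_def)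
  then have ex: "\<exists>p. p \<in> P" by blast
  define p where "p = (ARG_MAX length p. p \<in> P)"
  have pP: "p \<in> P" and pmax: "\<And>p'. p' \<in> P \<Longrightarrow> length p' \<le> length p"
    using arg_max_natI[of "\<lambda>p. p \<in> P" _ length "Suc (card (verts T))"]
      arg_max_nat_le[of "\<lambda>p. p \<in> P" _ length "Suc (card (verts T))"] ex len
    unfolding p_def by (auto simp: less_Suc_eq_le)
  have "4 \<le> length p" using pmax[OF \<open>[q, x, r, a] \<in> P\<close>] by simp
  then obtain z w u rest where p: "p = z # w # u # rest" and "rest \<noteq> []"
    by (auto simp: numeral_eq_Suc Suc_le_length_iff)
  have d: "distinct p" "successively (adj T) p" "set p \<subseteq> verts T" "last p = a" using pP by (auto simp: P_def)
  have wr: "w \<noteq> r"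
  proof
    assume "w = r"
    obtain l where l: "u # rest = l @ [a]"
      using d(4) p by (metis append_butlast_last_id last_ConsR list.distinct(1))
    then have "l \<noteq> []" using \<open>rest \<noteq> []\<close> by auto
    then obtain l' y where "l = l' @ [y]" by (metis rev_exhaust)
    then have eq: "p = (z # w # l') @ [y, a]" using l p by simp
    then have "successively (adj T) [y, a]" using d(2) by (metis successively_append_iff)
    then have "adj T y a" by simp
    then have "y = r" using leaf_unique_nb[OF s a(1)] a adj_commute by metis
    then show False using eq \<open>w = r\<close> d(1) by auto
  qed
  have leaf: "q \<in> leaves T" if q: "adj T w q" "q \<noteq> u" for q
  proof (rule ccontr)
    assume nl: "q \<notin> leaves T"
    have qw: "adj T q w" "q \<noteq> w" using q adj_commute adj_simple[OF s] by metis+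
    have q': "q \<notin> set (w # u # rest)"
      using path_extend[OF nc _ _ qw q(2)] d(1,2) p by auto
    have d2: "distinct (q # w # u # rest)" "successively (adj T) (q # w # u # rest)"
      using q' d p qw by auto
    have qv: "q \<in> verts T" using adj_simple[OF s] q by blast
    have "card (nb T q) = 3" using inner_card_nb[OF T qv nl] .
    then have "\<not> nb T q \<subseteq> {w}" using card_mono[of "{w}" "nb T q"] by auto
    then obtain t where t: "adj T q t" "t \<noteq> w" by (metis in_nb_iff singletonI subsetI)
    have t': "adj T t q" "t \<noteq> q" using t adj_commute adj_simple[OF s] by metis+
    have "t \<notin> set (q # w # u # rest)"
      using path_extend[OF nc d2 t' t(2)] .
    then have "t # q # w # u # rest \<in> P"
      using d2 t' d p qv adj_simple[OF s t'(1)] by (auto simp: P_def)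
    from pmax[OF this] show False using p by simp
  qed
  have "adj T w u" "w \<in> verts T" "adj T w z" using d p adj_commute[of T z w] by auto
  moreover have "z \<noteq> u" using d(1) p by auto
  ultimately have "w \<notin> leaves T" using leaf_unique_nb[OF s] by metis
  from third_nb[OF T this \<open>adj T w u\<close> \<open>adj T w z\<close>] \<open>z \<noteq> u\<close> obtain z' where
    z': "nb T w = {u, z, z'}" "z' \<noteq> u" "z' \<noteq> z" by metis
  then have "adj T w z'" by (metis in_nb_iff insertI1 insert_commute)
  then show ?thesis using leaf z' \<open>adj T w z\<close> \<open>z \<noteq> u\<close> wr adj_commute by metis
qed

section \<open>Removing and attaching leaves\<close>

lemma adj_mk [simp]: "adj \<lparr>verts = V, edges = E, lab = l\<rparr> u v \<longleftrightarrow> {u, v} \<in> E"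
  by (simp add: adj_def)

text \<open>A walk that visits the leaf enters and leaves it through its only neighbour, so the visit can be
  cut out.\<close>

lemma finite_tree_remove_leaf:
  assumes T: "finite_tree T" and x: "nb T x = {p}"
    and T': "verts T' = verts T - {x}" "edges T' = {e \<in> edges T. x \<notin> e}"
  shows "finite_tree T'"
proof -
  have s: "simple_graph T" and fin: "finite (verts T)" and con: "connected_graph T"
    and nc: "\<nexists>p. cycle T p" using T by (auto simp: finite_tree_def)
  have adj': "adj T' u v \<longleftrightarrow> adj T u v \<and> u \<noteq> x \<and> v \<noteq> x" for u v
    using T' by (auto simp: adj_def)
  have xp: "adj T x q \<longleftrightarrow> q = p" for q using x by (metis in_nb_iff singleton_iff)
  have px: "p \<in> verts T" "p \<noteq> x" using xp adj_simple[OF s, of x p] by auto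
  have reach: "(z \<noteq> x \<longrightarrow> (adj T')\<^sup>*\<^sup>* u z) \<and> (z = x \<longrightarrow> (adj T')\<^sup>*\<^sup>* u p)"
    if "u \<noteq> x" "(adj T)\<^sup>*\<^sup>* u z" for u z
    using that(2)
  proof (induction)
    case (step y z)
    then show ?case
      using xp[of y] xp[of z] adj_commute[of T] adj'[of y z]
      by (cases "y = x"; cases "z = x") (auto intro: rtranclp.rtrancl_into_rtrancl)
  qed (use that in auto)
  have "connected_graph T'"
    using con px reach T' unfolding connected_graph_def by auto
  moreover have "simple_graph T'"
    using s T' by (auto simp: simple_graph_def)
  moreover have "\<not> cycle T' c" for c
  proof
    assume "cycle T' c"
    then have "cycle T c" using adj' by (auto simp: cycle_def intro: successively_mono)
    then show False using nc by blast
  qed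
  ultimately show ?thesis using fin T' by (auto simp: finite_tree_def)
qed

text \<open>The only neighbour of the new leaf would have to occur twice in a cycle through that leaf.\<close>

lemma finite_tree_add_leaf:
  assumes T: "finite_tree T" and v: "v \<in> verts T" and x: "x \<notin> verts T"
    and T': "verts T' = insert x (verts T)" "edges T' = insert {v, x} (edges T)"
  shows "finite_tree T'"
proof -
  have s: "simple_graph T" and fin: "finite (verts T)" and con: "connected_graph T"
    and nc: "\<nexists>p. cycle T p" using T by (auto simp: finite_tree_def)
  have vx: "v \<noteq> x" using v x by auto
  have s': "simple_graph T'"
    using s T' v vx by (auto simp: simple_graph_def)
  have adj': "adj T' p q \<longleftrightarrow> adj T p q \<or> (p = v \<and> q = x) \<or> (p = x \<and> q = v)" for p q
    using T' by (auto simp: adj_def doubleton_eq_iff)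
  have nx: "\<not> adj T p x" "\<not> adj T x p" for p using adj_simple[OF s] x by blast+
  have mono: "(adj T')\<^sup>*\<^sup>* p q" if "(adj T)\<^sup>*\<^sup>* p q" for p q
    using that by (rule rtranclp_mono[THEN predicate2D, rotated]) (auto simp: adj')
  have "(adj T')\<^sup>*\<^sup>* p v \<and> (adj T')\<^sup>*\<^sup>* v p" if "p \<in> verts T'" for p
  proof (cases "p = x")
    case True
    then show ?thesis using adj'[of p v] adj'[of v p] by (simp add: r_into_rtranclp)
  next
    case False
    then have "(adj T)\<^sup>*\<^sup>* p v" "(adj T)\<^sup>*\<^sup>* v p"
      using that T' v con by (auto simp: connected_graph_def)
    then show ?thesis using mono by simp
  qed
  then have con': "connected_graph T'"
    unfolding connected_graph_def using T' by (auto intro: rtranclp_trans)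
  have "\<not> cycle T' c" for c
  proof
    assume c: "cycle T' c"
    show False
    proof (cases "x \<in> set c")
      case False
      have suc: "successively (adj T') c" and len: "3 \<le> length c" and cl: "adj T' (last c) (hd c)"
        using c by (simp_all add: cycle_def)
      have "successively (adj T) c"
        by (rule successively_mono[OF suc]) (use False adj' in \<open>metis\<close>)
      moreover have "c \<noteq> []" using len by auto
      then have "last c \<noteq> x" "hd c \<noteq> x" using False by (metis last_in_set, metis hd_in_set)
      then have "adj T (last c) (hd c)" using cl by (simp add: adj')
      ultimately have "cycle T c" using c by (auto simp: cycle_def)
      then show False using nc by blast
    next
      case True
      then obtain i where i: "i < length c" "c ! i = x" by (auto simp: in_set_conv_nth)
      have len: "3 \<le> length c" and dis: "distinct c" and suc: "successively (adj T') c"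
        and cl: "adj T' (last c) (hd c)" using c by (auto simp: cycle_def)
      have ne: "c \<noteq> []" using len by auto
      have only: "q = v" if "adj T' x q \<or> adj T' q x" for q
        using that adj' nx vx by blast
      define i1 where "i1 = (if Suc i < length c then Suc i else 0)"
      define i2 where "i2 = (if i = 0 then length c - 1 else i - 1)"
      have step: "adj T' (c ! m) (c ! Suc m)" if "Suc m < length c" for m
        using suc that by (simp add: successively_conv_nth)
      have wrap: "adj T' (c ! (length c - 1)) (c ! 0)"
        using cl ne by (simp add: hd_conv_nth last_conv_nth)
      have "adj T' x (c ! i1)"
      proof (cases "Suc i < length c")
        case False
        then have "i = length c - 1" using i by simp
        then show ?thesis using wrap i False by (simp add: i1_def)
      qed (use step[of i] i in \<open>simp add: i1_def\<close>)
      moreover have "adj T' (c ! i2) x"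
        using wrap step[of "i - 1"] i by (cases i) (simp_all add: i2_def)
      ultimately have "c ! i1 = c ! i2" using only by metis
      moreover have "i1 \<noteq> i2" "i1 < length c" "i2 < length c"
        using len i by (auto simp: i1_def i2_def)
      ultimately show False using dis nth_eq_iff_index_eq by blast
    qed
  qed
  then show ?thesis using s' con' fin T' by (auto simp: finite_tree_def)
qed

text \<open>All other leaves keep their labels here; renumbering them is a separate step, so that the
  rounds of a tree and of its pruned tree can be compared literally.\<close>

definition prune :: "'v ltree \<Rightarrow> 'v \<Rightarrow> 'v \<Rightarrow> 'v \<Rightarrow> int \<Rightarrow> 'v ltree" where
  "prune T x y v s = \<lparr> verts = verts T - {x, y}, edges = {e \<in> edges T. e \<inter> {x, y} = {}},
     lab = (lab T)(v := s) \<rparr>"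

definition cherry :: "'v ltree \<Rightarrow> 'v \<Rightarrow> 'v \<Rightarrow> 'v \<Rightarrow> bool" where
  "cherry T x y v \<longleftrightarrow> x \<in> leaves T \<and> y \<in> leaves T \<and> x \<noteq> y \<and> adj T x v \<and> adj T y v"

lemma cherry_commute: "cherry T x y v \<longleftrightarrow> cherry T y x v"
  by (auto simp: cherry_def)

lemma cherry_vertex:
  assumes "trivalent_tree T" "cherry T x y v"
  shows "v \<in> verts T" "v \<notin> leaves T" "v \<noteq> x" "v \<noteq> y"
  using assms adj_simple[OF trivalent_simple] nb_leaf_not_leaf by (fastforce simp: cherry_def)+

lemma adj_prune [simp]:
  "adj (prune T x y v s) p q \<longleftrightarrow> adj T p q \<and> p \<noteq> x \<and> p \<noteq> y \<and> q \<noteq> x \<and> q \<noteq> y"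
  by (auto simp: prune_def adj_def)

lemma prune_simps [simp]:
  "verts (prune T x y v s) = verts T - {x, y}"
  "lab (prune T x y v s) = (lab T)(v := s)"
  by (simp_all add: prune_def)

lemma edges_prune_disjoint: "edges (prune T x y v s) = {e \<in> edges T. e \<inter> {x, y} = {}}"
  by (simp add: prune_def)

lemma prune_tree:
  assumes T: "trivalent_tree T" and ch: "cherry T x y v"
    and nbv: "nb T v = {x, y, w}" and w: "w \<notin> leaves T"
  shows "trivalent_tree (prune T x y v s)" "leaves (prune T x y v s) = insert v (leaves T - {x, y})"
    "nb (prune T x y v s) v = {w}"
    "\<And>u. u \<noteq> v \<Longrightarrow> u \<noteq> x \<Longrightarrow> u \<noteq> y \<Longrightarrow> nb (prune T x y v s) u = nb T u"
proof -
  let ?T = "prune T x y v s"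
  note sg = trivalent_simple[OF T]
  have x: "x \<in> leaves T" "y \<in> leaves T" "x \<noteq> y" "adj T x v" "adj T y v"
    using ch by (auto simp: cherry_def)
  have v: "v \<in> verts T" "v \<notin> leaves T" "v \<noteq> x" "v \<noteq> y" using cherry_vertex[OF T ch] by auto
  have only: "q = v" if "adj T x q \<or> adj T q x \<or> adj T y q \<or> adj T q y" for q
    using that leaf_unique_nb[OF sg] x adj_commute by metis
  define T1 where "T1 = \<lparr> verts = verts T - {x}, edges = {e \<in> edges T. x \<notin> e}, lab = lab T\<rparr>"
  have "nb T x = {v}" using only x by auto
  then have f1: "finite_tree T1"
    using finite_tree_remove_leaf[of T x v T1] T by (auto simp: T1_def trivalent_tree_def)
  have "nb T1 y = {v}" using only x v by (auto simp: T1_def adj_def)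
  then have f2: "finite_tree ?T"
    by (rule finite_tree_remove_leaf[OF f1]) (auto simp: T1_def edges_prune_disjoint)
  then have sg2: "simple_graph ?T" by (auto simp: finite_tree_def)
  show n1: "nb ?T v = {w}"
  proof -
    have "adj T v w" using nbv by (metis in_nb_iff insertI1 insert_commute)
    moreover have "w \<noteq> x" "w \<noteq> y" using w x by auto
    moreover have "q = x \<or> q = y \<or> q = w" if "adj T v q" for q
      using nbv that by (metis in_nb_iff insertE singletonD)
    ultimately show ?thesis using v by (auto dest: \<open>\<And>q. adj T v q \<Longrightarrow> q = x \<or> q = y \<or> q = w\<close>)
  qed
  show n2: "nb ?T u = nb T u" if "u \<noteq> v" "u \<noteq> x" "u \<noteq> y" for u
    using that only by auto
  have deg: "degree ?T u = (if u = v then 1 else degree T u)" if "u \<in> verts ?T" for u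
    using that n1 n2[of u] by (auto simp: degree_eq_card_nb[OF sg2] degree_eq_card_nb[OF sg])
  show "leaves ?T = insert v (leaves T - {x, y})"
    using deg v by (auto simp: leaves_def)
  have "w \<in> verts T" "w \<noteq> v" using nbv adj_simple[OF sg]
    by (metis in_nb_iff insertI1 insert_commute)+
  moreover from this have "degree T w = 3" using w T by (auto simp: leaves_def trivalent_tree_def)
  moreover have "w \<noteq> x" "w \<noteq> y" using w x by auto
  ultimately have "degree ?T w = 3" "w \<in> verts ?T" using deg[of w] by auto
  then have "\<exists>u \<in> verts ?T. degree ?T u = 3" by blast
  then show "trivalent_tree ?T"
    using f2 deg T unfolding trivalent_tree_def by auto
qed

definition graft :: "'v ltree \<Rightarrow> 'v \<Rightarrow> 'v \<Rightarrow> 'v \<Rightarrow> int \<Rightarrow> int \<Rightarrow> 'v ltree" where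
  "graft T x y v i j = \<lparr> verts = insert x (insert y (verts T)),
     edges = insert {v, x} (insert {v, y} (edges T)), lab = (lab T)(x := i, y := j) \<rparr>"

lemma graft_tree:
  assumes T: "trivalent_tree T" and v: "v \<in> leaves T" "adj T v w"
    and x: "x \<notin> verts T" "y \<notin> verts T" "x \<noteq> y"
  shows "trivalent_tree (graft T x y v i j)"
    "leaves (graft T x y v i j) = insert x (insert y (leaves T - {v}))"
    "nb (graft T x y v i j) v = {x, y, w}" "cherry (graft T x y v i j) x y v"
    "w \<notin> leaves (graft T x y v i j)"
    "verts (prune (graft T x y v i j) x y v s) = verts T"
    "edges (prune (graft T x y v i j) x y v s) = edges T"
proof -
  let ?T = "graft T x y v i j"
  note sg = trivalent_simple[OF T]
  have vv: "v \<in> verts T" using v(1) by (simp add: leaves_def)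
  then have vx: "v \<noteq> x" "v \<noteq> y" using x by auto
  define T1 where "T1 = \<lparr> verts = insert x (verts T), edges = insert {v, x} (edges T), lab = lab T\<rparr>"
  have f1: "finite_tree T1"
    using finite_tree_add_leaf[of T v x T1] T vv x by (auto simp: T1_def trivalent_tree_def)
  have f2: "finite_tree ?T"
    by (rule finite_tree_add_leaf[OF f1, of v y]) (use vv x in \<open>auto simp: T1_def graft_def\<close>)
  then have sg2: "simple_graph ?T" by (auto simp: finite_tree_def)
  have adjT: "adj ?T p q \<longleftrightarrow> adj T p q \<or> (p = v \<and> (q = x \<or> q = y)) \<or> (q = v \<and> (p = x \<or> p = y))" for p q
    by (auto simp: graft_def adj_def doubleton_eq_iff)
  have nx: "\<not> adj T p x" "\<not> adj T x p" "\<not> adj T p y" "\<not> adj T y p" for p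
    using adj_simple[OF sg] x by blast+
  have vw: "adj T v q \<longleftrightarrow> q = w" for q using v leaf_unique_nb[OF sg] by metis
  show n1: "nb ?T v = {x, y, w}"
    unfolding set_eq_iff in_nb_iff adjT vw using vx by blast
  have n2: "nb ?T x = {v}" "nb ?T y = {v}"
    unfolding set_eq_iff in_nb_iff adjT using nx vx x by blast+
  have n3: "nb ?T u = nb T u" if "u \<noteq> v" "u \<noteq> x" "u \<noteq> y" for u
    unfolding set_eq_iff in_nb_iff adjT using that by blast
  have wx: "w \<in> verts T" "w \<noteq> x" "w \<noteq> y" "w \<noteq> v" using v(2) nx adj_simple[OF sg] by blast+
  have deg: "degree ?T u = (if u = v then 3 else if u = x \<or> u = y then 1 else degree T u)" for u
    using n1 n2 n3[of u] wx x
    by (auto simp: degree_eq_card_nb[OF sg2] degree_eq_card_nb[OF sg])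
  show lv: "leaves ?T = insert x (insert y (leaves T - {v}))"
    using deg vv vx x by (auto simp: leaves_def) (auto simp: graft_def)
  have "degree ?T v = 3" "v \<in> verts ?T" using deg vv by (auto simp: graft_def)
  then show "trivalent_tree ?T"
    using f2 deg T by (auto simp: trivalent_tree_def) (auto simp: graft_def)
  show "cherry ?T x y v" using lv x by (auto simp: cherry_def adjT)
  show "w \<notin> leaves ?T" using lv wx nb_leaf_not_leaf[OF T v] by auto
  have "e \<inter> {x, y} = {}" if "e \<in> edges T" for e
    using that sg x by (auto simp: simple_graph_def)
  then have "{e \<in> insert {v, x} (insert {v, y} (edges T)). e \<inter> {x, y} = {}} = edges T" by auto
  then show "edges (prune ?T x y v s) = edges T" by (simp only: graft_def prune_simps edges_prune_disjoint ltree.simps)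
  have "insert x (insert y (verts T)) - {x, y} = verts T" using x by blast
  then show "verts (prune ?T x y v s) = verts T" by (simp only: graft_def prune_simps edges_prune_disjoint ltree.simps)
qed

section \<open>Column-restricted words\<close>

text \<open>A word lists the columns of the labels 1, 2, ... of a parking function, or the winners of the
  rounds 1, 2, ... of a tournament.  The inequality says that the label in position \<open>x\<close> (counted
  from 0) exceeds its dominance index.  The columns are taken from an arbitrary set \<open>S\<close>, so that
  a letter can be removed without renumbering the others.\<close>

definition restricted :: "int set \<Rightarrow> int list \<Rightarrow> bool" where
  "restricted S w \<longleftrightarrow> set w \<subseteq> S \<and>
     (\<forall>x < length w. card {s \<in> S. w ! x < s \<and> s \<notin> set (drop (Suc x) w)} \<le> x)"

lemma restricted_Nil [simp]: "restricted S []"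
  by (simp add: restricted_def)

lemma exists_nonletter:
  assumes "finite S" "length w < card S"
  shows "S - set w \<noteq> {}"
  using assms card_length[of w] card_mono[of "set w" S] by fastforce

text \<open>This is the bijectivity of r in terms of words.  Removing the column \<open>t\<close> lowers the dominance
  index of exactly the letters to its left; a letter to its right dominates only columns whose
  entries all lie before it, so its inequality holds anyway with one to spare.\<close>

lemma restricted_Cons:
  assumes fin: "finite S" and card: "card S = Suc (Suc (length w))"
  shows "restricted S (j # w) \<longleftrightarrow> j \<in> S \<and> (\<forall>s \<in> S. j < s \<longrightarrow> s \<in> set w) \<and>
    restricted (S - {Max (S - set w)}) w"
proof -
  define t where "t = Max (S - set w)"
  have "t \<in> S - set w" unfolding t_def
    using exists_nonletter[OF fin, of w] card fin by (intro Max_in) auto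
  then have t: "t \<in> S" "t \<notin> set w" by auto
  have t_max: "s \<in> set w" if "s \<in> S" "t < s" for s
    using that Max_ge[of "S - set w" s] fin unfolding t_def by fastforce
  define A where "A x = {s \<in> S. w ! x < s \<and> s \<notin> set (drop (Suc x) w)}" for x
  define B where "B x = {s \<in> S - {t}. w ! x < s \<and> s \<notin> set (drop (Suc x) w)}" for x
  have AB: "A x \<noteq> {} \<and> card (A x) = Suc (card (B x))" if "x < length w" "w ! x < t" for x
  proof -
    have "A x = insert t (B x)" "t \<notin> B x" "finite (B x)"
      using that t fin in_set_dropD[of t "Suc x" w] by (auto simp: A_def B_def)
    then show ?thesis by simp
  qed
  have B: "A x = B x \<and> card (B x) \<le> x" if "x < length w" "\<not> w ! x < t" for x
  proof -
    have "w ! x \<noteq> t" using t that nth_mem by metis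
    then have gt: "t < w ! x" using that by simp
    have "B x \<subseteq> set (take x w)"
    proof
      fix s assume "s \<in> B x"
      then have s: "s \<in> S" "w ! x < s" "s \<notin> set (drop (Suc x) w)" by (auto simp: B_def)
      then have "s \<in> set w" using t_max gt by simp
      moreover have "w = take x w @ w ! x # drop (Suc x) w" using that by (simp add: id_take_nth_drop)
      ultimately show "s \<in> set (take x w)" using s
        by (metis Un_iff less_irrefl set_ConsD set_append)
    qed
    then have "card (B x) \<le> length (take x w)"
      by (meson List.finite_set card_length card_mono le_trans)
    moreover have "A x = B x" using gt by (auto simp: A_def B_def)
    ultimately show ?thesis using that by simp
  qed
  have iff: "card (A x) \<le> Suc x \<longleftrightarrow> card (B x) \<le> x" if "x < length w" for x
    using AB[OF that] B[OF that] by (cases "w ! x < t") auto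
  have "restricted S (j # w) \<longleftrightarrow> j \<in> S \<and> set w \<subseteq> S \<and> card {s \<in> S. j < s \<and> s \<notin> set w} \<le> 0 \<and>
      (\<forall>x < length w. card (A x) \<le> Suc x)"
    by (simp add: restricted_def A_def All_less_Suc2)
  also have "card {s \<in> S. j < s \<and> s \<notin> set w} \<le> 0 \<longleftrightarrow> (\<forall>s \<in> S. j < s \<longrightarrow> s \<in> set w)"
    using fin by auto
  also have "(\<forall>x < length w. card (A x) \<le> Suc x) \<longleftrightarrow> (\<forall>x < length w. card (B x) \<le> x)"
    using iff by blast
  finally show ?thesis
    using t unfolding t_def[symmetric] restricted_def B_def[symmetric] by auto
qed

lemma restricted_map:
  assumes g: "strict_mono_on S g" and w: "restricted S w"
  shows "restricted (g ` S) (map g w)"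
proof -
  have sub: "set w \<subseteq> S" using w by (simp add: restricted_def)
  have inj: "inj_on g S" using g by (rule strict_mono_on_imp_inj_on)
  have "card {s \<in> g ` S. map g w ! x < s \<and> s \<notin> set (drop (Suc x) (map g w))} \<le> x"
    if x: "x < length w" for x
  proof -
    have wx: "w ! x \<in> S" using x sub nth_mem by blast
    have "{s \<in> g ` S. map g w ! x < s \<and> s \<notin> set (drop (Suc x) (map g w))}
        = g ` {s \<in> S. w ! x < s \<and> s \<notin> set (drop (Suc x) w)}"
    proof -
      have 1: "g (w ! x) < g s \<longleftrightarrow> w ! x < s" if "s \<in> S" for s
        using strict_mono_on_less[OF g wx that] .
      have 2: "g s \<in> g ` set (drop (Suc x) w) \<longleftrightarrow> s \<in> set (drop (Suc x) w)" if "s \<in> S" for s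
        using that sub inj inj_on_image_mem_iff[of g S s "set (drop (Suc x) w)"]
          set_drop_subset[of "Suc x" w] by blast
      show ?thesis using x 1 2 by (auto simp: drop_map)
    qed
    also have "card \<dots> = card {s \<in> S. w ! x < s \<and> s \<notin> set (drop (Suc x) w)}"
      by (rule card_image) (use inj in \<open>auto intro: inj_on_subset\<close>)
    finally show ?thesis using w x by (simp add: restricted_def)
  qed
  then show ?thesis using sub by (auto simp: restricted_def)
qed


section \<open>The lazy tournament as repeated pruning\<close>

text \<open>The trees of a tour, but with an arbitrary set \<open>S\<close> of labels in the place of c, 1, ..., n,
  which is what pruning without renumbering leads to.  The tournament has \<open>card S - 1\<close> rounds.\<close>

definition ab_tree :: "int set \<Rightarrow> 'v ltree \<Rightarrow> bool" where
  "ab_tree S T \<longleftrightarrow> trivalent_tree T \<and> bij_betw (lab T) (leaves T) ({label_a, label_b} \<union> S) \<and>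
     S \<subseteq> {0..} \<and> (\<exists>p q r. cherry T p q r \<and> lab T p = label_a \<and> lab T q = label_b)"

lemma lab_inj:
  assumes "ab_tree S T" "x \<in> leaves T" "y \<in> leaves T" "lab T x = lab T y"
  shows "x = y"
  using assms by (auto simp: ab_tree_def bij_betw_def dest: inj_onD)

lemma lab_range:
  assumes "ab_tree S T" "x \<in> leaves T"
  shows "lab T x = label_a \<or> lab T x = label_b \<or> lab T x \<in> S"
  using assms by (auto simp: ab_tree_def bij_betw_def)

lemma ab_tree_finite:
  assumes "ab_tree S T" shows "finite S"
proof -
  have "finite (leaves T)" "bij_betw (lab T) (leaves T) ({label_a, label_b} \<union> S)"
    using assms by (auto simp: ab_tree_def finite_leaves)
  then show ?thesis using bij_betw_finite by blast
qed

lemma card_leaves: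
  assumes "ab_tree S T" shows "card (leaves T) = card S + 2"
proof -
  have "card (leaves T) = card ({label_a, label_b} \<union> S)"
    using assms bij_betw_same_card by (auto simp: ab_tree_def)
  also have "\<dots> = card S + 2"
    using assms ab_tree_finite[OF assms] by (subst card_Un_disjoint) (auto simp: ab_tree_def)
  finally show ?thesis .
qed

lemma leaf_with_label:
  assumes "ab_tree S T" "l \<in> S"
  obtains x where "x \<in> leaves T" "lab T x = l"
  using assms by (auto simp: ab_tree_def bij_betw_def) (metis UnCI imageE insertCI)

lemma leaf_edge_labeling_leaf:
  assumes T: "trivalent_tree T" and x: "x \<in> leaves T" "adj T x v"
  shows "leaf_edge_labeling T {x, v} = Some (lab T x)"
proof -
  have "v \<notin> leaves T" using nb_leaf_not_leaf[OF T x] .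
  then have "(THE u. u \<in> leaves T \<and> u \<in> {x, v}) = x" using x by (intro the_equality) auto
  then show ?thesis using x by (auto simp: leaf_edge_labeling_def adj_def)
qed

lemma leaf_edge_labeling_SomeE:
  assumes T: "trivalent_tree T" and e: "leaf_edge_labeling T e = Some l"
  obtains x v where "e = {x, v}" "x \<in> leaves T" "adj T x v" "lab T x = l" "v \<notin> leaves T"
proof -
  have "e \<in> edges T" "\<exists>v \<in> leaves T. v \<in> e"
    using e by (auto simp: leaf_edge_labeling_def split: if_splits)
  then obtain x where x: "x \<in> leaves T" "x \<in> e" by blast
  obtain v where v: "e = {x, v}" "adj T x v"
    using edge_at[OF trivalent_simple[OF T] \<open>e \<in> edges T\<close> x(2)] .
  moreover have "lab T x = l" using e leaf_edge_labeling_leaf[OF T x(1) v(2)] v by simp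
  ultimately show ?thesis using that x nb_leaf_not_leaf[OF T] by blast
qed

lemma leaf_edge_labeling_None:
  assumes T: "trivalent_tree T" and e: "{u, z} \<in> edges T"
  shows "leaf_edge_labeling T {u, z} = None \<longleftrightarrow> u \<notin> leaves T \<and> z \<notin> leaves T"
  using e by (auto simp: leaf_edge_labeling_def)

definition first_cherry :: "'v ltree \<Rightarrow> 'v \<Rightarrow> 'v \<Rightarrow> 'v \<Rightarrow> bool" where
  "first_cherry T x y v \<longleftrightarrow> cherry T x y v \<and> lab T x < lab T y \<and>
     (\<forall>x' y' v'. cherry T x' y' v' \<and> lab T x' < lab T y' \<longrightarrow> lab T x' \<le> lab T x)"

lemma cherry_third_nb_inner:
  assumes T: "ab_tree S T" and big: "2 \<le> card S" and ch: "cherry T x y v"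
    and nbv: "nb T v = {x, y, w}"
  shows "w \<notin> leaves T"
proof
  assume w: "w \<in> leaves T"
  have tri: "trivalent_tree T" using T by (simp add: ab_tree_def)
  have "nb T v \<subseteq> leaves T" using nbv ch w by (auto simp: cherry_def)
  then have "leaves T = {x, y, w}"
    using star_if_all_leaves(2)[OF tri] cherry_vertex[OF tri ch] nbv by metis
  then have "card (leaves T) \<le> 3" by (simp add: card_insert_if)
  then show False using card_leaves[OF T] big by simp
qed

text \<open>The cherry of a and b is not the only one, hence a and b do not take part in the first round.\<close>

lemma exists_cherry_in_S:
  assumes T: "ab_tree S T" and big: "2 \<le> card S"
  shows "\<exists>z z' w. cherry T z z' w \<and> lab T z \<in> S \<and> lab T z' \<in> S"
proof -
  have tri: "trivalent_tree T" using T by (simp add: ab_tree_def)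
  obtain p q r where ch: "cherry T p q r" and lp: "lab T p = label_a" "lab T q = label_b"
    using T by (auto simp: ab_tree_def)
  then have p: "p \<in> leaves T" "q \<in> leaves T" "p \<noteq> q" "adj T r p" "adj T r q" "adj T p r" "adj T q r"
    using adj_commute by (force simp: cherry_def)+
  obtain x where x: "nb T r = {p, q, x}"
    using third_nb[OF tri cherry_vertex(2)[OF tri ch] p(4,5,3)] by metis
  have "x \<notin> leaves T" using cherry_third_nb_inner[OF T big ch x] .
  moreover have "adj T r x" using x by (metis in_nb_iff insertI1 insert_commute)
  ultimately obtain w z z' where w: "w \<noteq> r" "z \<in> leaves T" "z' \<in> leaves T" "z \<noteq> z'" "adj T z w" "adj T z' w"
    using far_cherry[OF tri p(1,6)] by blast
  have "lab T u \<in> S" if u: "u \<in> leaves T" "adj T u w" for u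
  proof -
    have "u \<noteq> p" "u \<noteq> q"
      using u w(1) p leaf_unique_nb[OF trivalent_simple[OF tri]] by metis+
    then show ?thesis using lab_range[OF T u(1)] lab_inj[OF T u(1)] p lp by metis
  qed
  then show ?thesis using w unfolding cherry_def by blast
qed

text \<open>The first pair that faces off consists of the leaf edges of x and y, which meet at v, and the
  winner or the loser advances towards w.\<close>

locale first_match =
  fixes S :: "int set" and T :: "'v ltree" and x y v w
  assumes tree: "ab_tree S T" and big: "2 \<le> card S"
    and first: "first_cherry T x y v" and nbv: "nb T v = {x, y, w}"

lemma exists_first_match:
  assumes T: "ab_tree S T" and big: "2 \<le> card S"
  obtains x y v w where "first_match S T x y v w"
proof -
  have tri: "trivalent_tree T" using T by (simp add: ab_tree_def)
  define A where "A = {lab T x | x. \<exists>y v. cherry T x y v \<and> lab T x < lab T y}"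
  have "A \<subseteq> lab T ` leaves T" by (auto simp: A_def cherry_def)
  then have fin: "finite A" using finite_leaves[OF tri] by (meson finite_imageI finite_subset)
  obtain z z' u where ch: "cherry T z z' u" using exists_cherry_in_S[OF assms] by blast
  then have "lab T z \<noteq> lab T z'" using lab_inj[OF T] by (auto simp: cherry_def)
  then have "A \<noteq> {}" using ch cherry_commute[of T z z' u] unfolding A_def
    by (cases "lab T z < lab T z'") force+
  then have "Max A \<in> A" using fin by simp
  then obtain x y v where m: "cherry T x y v" "lab T x < lab T y" "Max A = lab T x"
    by (auto simp: A_def)
  have "first_cherry T x y v"
    unfolding first_cherry_def using m Max_ge[OF fin] by (auto simp: A_def)
  moreover obtain w where "nb T v = {x, y, w}"
    using third_nb[OF tri cherry_vertex(2)[OF tri m(1)], of x y] m(1) adj_commute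
    unfolding cherry_def by metis
  ultimately show ?thesis using that assms by (auto simp: first_match_def)
qed

lemma arg_max_eqI:
  fixes f :: "'a \<Rightarrow> 'b :: linorder"
  assumes "P q" "\<And>r. P r \<Longrightarrow> r \<noteq> q \<Longrightarrow> f r < f q"
  shows "arg_max f P = q"
proof -
  have "\<not> f q < f r" if "P r" for r using assms(2)[OF that] by (cases "r = q") auto
  then have "is_arg_max f P r \<longleftrightarrow> r = q" for r
    using assms unfolding is_arg_max_def by blast
  then show ?thesis by (simp add: arg_max_def)
qed

lemma finite_contests:
  assumes "finite_tree T"
  shows "finite (contests T \<sigma>)"
proof -
  have "edges T \<subseteq> Pow (verts T)" using assms by (auto simp: finite_tree_def simple_graph_def)
  then have fin: "finite (edges T)" "finite (verts T)"
    using assms by (auto simp: finite_tree_def intro: finite_subset)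
  let ?L = "(\<lambda>e. the (\<sigma> e)) ` edges T"
  have "contests T \<sigma> \<subseteq> ?L \<times> ?L \<times> verts T \<times> edges T"
    by (force simp: contests_def)
  then show ?thesis using fin by (meson finite_SigmaI finite_imageI finite_subset)
qed

lemma face_off_in_contests:
  assumes "finite_tree T" "contests T \<sigma> \<noteq> {}"
  shows "face_off T \<sigma> \<in> contests T \<sigma>"
proof -
  let ?A = "fst ` contests T \<sigma>"
  have "Max ?A \<in> ?A" using finite_contests[OF assms(1)] assms(2) by simp
  then obtain q where "q \<in> contests T \<sigma>" "fst q = Max ?A" by auto
  then have "is_arg_max fst (\<lambda>q. q \<in> contests T \<sigma>) q"
    using finite_contests[OF assms(1)] by (auto simp: is_arg_max_linorder)
  then have "is_arg_max fst (\<lambda>q. q \<in> contests T \<sigma>) (face_off T \<sigma>)"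
    unfolding face_off_def arg_max_def by (rule someI)
  then show ?thesis by (simp add: is_arg_max_def)
qed

lemma initial_contestsE:
  assumes T: "trivalent_tree T" and q: "(i, j, u, E) \<in> contests T (leaf_edge_labeling T)"
  obtains p p' z where "cherry T p p' u" "lab T p = i" "lab T p' = j" "i < j"
    "E = {u, z}" "adj T u z" "z \<notin> leaves T"
proof -
  obtain e f where ef: "e \<in> edges T" "f \<in> edges T" "u \<in> e" "u \<in> f"
      "leaf_edge_labeling T e = Some i" "leaf_edge_labeling T f = Some j"
    and E: "E \<in> edges T" "u \<in> E" "leaf_edge_labeling T E = None" and ij: "i < j"
    using q by (auto simp: contests_def)
  obtain z where z: "E = {u, z}" "adj T u z"
    using edge_at[OF trivalent_simple[OF T] E(1,2)] .
  then have nl: "u \<notin> leaves T" "z \<notin> leaves T"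
    using E leaf_edge_labeling_None[OF T] by simp_all
  obtain p b where p: "e = {p, b}" "p \<in> leaves T" "adj T p b" "lab T p = i"
    using leaf_edge_labeling_SomeE[OF T ef(5)] by metis
  obtain p' b' where p': "f = {p', b'}" "p' \<in> leaves T" "adj T p' b'" "lab T p' = j"
    using leaf_edge_labeling_SomeE[OF T ef(6)] by metis
  have "b = u" "b' = u" using p p' ef nl by auto
  then have "cherry T p p' u" using p p' ij by (auto simp: cherry_def)
  then show ?thesis using that p p' ij z nl by blast
qed

lemma initial_contestsI:
  assumes T: "trivalent_tree T" and ch: "cherry T p p' u" "lab T p < lab T p'"
    and z: "adj T u z" "z \<notin> leaves T"
  shows "(lab T p, lab T p', u, {u, z}) \<in> contests T (leaf_edge_labeling T)"
proof -
  have p: "p \<in> leaves T" "adj T p u" "p' \<in> leaves T" "adj T p' u" using ch by (auto simp: cherry_def)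
  have "{p, u} \<in> edges T" "{p', u} \<in> edges T" "{u, z} \<in> edges T" using p z by (simp_all add: adj_def)
  moreover have "leaf_edge_labeling T {u, z} = None"
    using leaf_edge_labeling_None[OF T \<open>{u, z} \<in> edges T\<close>] z cherry_vertex[OF T ch(1)] by simp
  moreover note leaf_edge_labeling_leaf[OF T p(1,2)] leaf_edge_labeling_leaf[OF T p(3,4)]
  ultimately show ?thesis
    using cherry_vertex[OF T ch(1)] ch(2) unfolding contests_def mem_Collect_eq case_prod_conv
    by (intro conjI bexI[of _ "{p, u}"] bexI[of _ "{p', u}"]) simp_all
qed

context first_match
begin

abbreviation "i \<equiv> lab T x"
abbreviation "j \<equiv> lab T y"

lemma tri: "trivalent_tree T" using tree by (simp add: ab_tree_def)
lemma simp_T: "simple_graph T" using tri by (rule trivalent_simple)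
lemma ch: "cherry T x y v" using first by (simp add: first_cherry_def)
lemma ij: "i < j" using first by (simp add: first_cherry_def)
lemma i_max: "cherry T p q u \<Longrightarrow> lab T p < lab T q \<Longrightarrow> lab T p \<le> i"
  using first unfolding first_cherry_def by blast
lemma xy: "x \<in> leaves T" "y \<in> leaves T" "x \<noteq> y" "adj T x v" "adj T y v"
  using ch by (auto simp: cherry_def)
lemma v: "v \<in> verts T" "v \<notin> leaves T" "v \<noteq> x" "v \<noteq> y"
  using cherry_vertex[OF tri ch] by auto
lemma w_inner: "w \<notin> leaves T"
  by (rule cherry_third_nb_inner[OF tree big ch nbv])
lemma adj_v: "adj T v u \<longleftrightarrow> u = x \<or> u = y \<or> u = w"
  using nbv by (metis in_nb_iff insert_iff singletonD)
lemma adj_x: "adj T x u \<longleftrightarrow> u = v" and adj_y: "adj T y u \<longleftrightarrow> u = v"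
  using xy leaf_unique_nb[OF simp_T] by blast+
lemma w: "w \<noteq> x" "w \<noteq> y" "w \<noteq> v" "adj T v w" "adj T w v"
  using w_inner xy adj_v[of w] adj_commute[of T v w] adj_simple(3)[OF simp_T, of v w] by auto

lemma in_S: "i \<in> S" "j \<in> S"
proof -
  obtain z z' u where z: "cherry T z z' u" "lab T z \<in> S" "lab T z' \<in> S"
    using exists_cherry_in_S[OF tree big] by blast
  have pos: "0 \<le> l" if "l \<in> S" for l using that tree by (auto simp: ab_tree_def)
  have "lab T z \<noteq> lab T z'" using z lab_inj[OF tree] by (auto simp: cherry_def)
  then have "lab T z \<le> i \<or> lab T z' \<le> i" using i_max z(1) cherry_commute[of T z z' u]
    by (metis linorder_neqE)
  then have "0 \<le> i" using pos z by force
  then show "i \<in> S" "j \<in> S" using lab_range[OF tree] xy ij by fastforce+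
qed

lemma i_less: "cherry T p q u \<Longrightarrow> lab T p < lab T q \<Longrightarrow> p \<noteq> x \<Longrightarrow> lab T p < i"
  using i_max lab_inj[OF tree _ xy(1)] unfolding cherry_def by (metis order_less_le)

text \<open>Labels of leaves are distinct, so a contest with the same smaller label is the same contest.\<close>

lemma face_off_first: "face_off T (leaf_edge_labeling T) = (i, j, v, {v, w})"
  unfolding face_off_def
proof (rule arg_max_eqI)
  show "(i, j, v, {v, w}) \<in> contests T (leaf_edge_labeling T)"
    by (rule initial_contestsI[OF tri ch ij w(4) w_inner])
  fix q assume q: "q \<in> contests T (leaf_edge_labeling T)" "q \<noteq> (i, j, v, {v, w})"
  obtain i' j' u E where q': "q = (i', j', u, E)" by (cases q)
  obtain p p' z where c: "cherry T p p' u" "lab T p = i'" "lab T p' = j'" "i' < j'"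
    "E = {u, z}" "adj T u z" "z \<notin> leaves T"
    using initial_contestsE[OF tri q(1)[unfolded q']] by metis
  have "p \<noteq> x"
  proof
    assume "p = x"
    then have "u = v" using c(1) adj_x by (simp add: cherry_def)
    moreover from this have "p' = y"
      using c(1) \<open>p = x\<close> adj_v[of p'] adj_commute[of T p' v] w_inner unfolding cherry_def by metis
    moreover have "z = w" using c(6,7) \<open>u = v\<close> adj_v[of z] xy by metis
    ultimately show False using q(2) q' c(2,3,5) \<open>p = x\<close> by blast
  qed
  then show "fst q < fst (i, j, v, {v, w})"
    using i_less[OF c(1)] c q' by simp
qed

definition lazy :: bool where
  "lazy \<longleftrightarrow> (\<exists>u \<in> leaves T. adj T u w \<and> i < lab T u)"

text \<open>At v only the edges of x and y are labelled, and they cannot trigger the rule, so a larger label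
  must sit on a leaf at w.\<close>

lemma lazy_rule_first: "lazy_rule T (leaf_edge_labeling T) i j {v, w} \<longleftrightarrow> lazy"
proof
  assume lazy
  then obtain u where u: "u \<in> leaves T" "adj T u w" "i < lab T u" by (auto simp: lazy_def)
  have "u \<noteq> y" using u(2) adj_y w by auto
  then have "lab T u \<noteq> j" using lab_inj[OF tree u(1) xy(2)] by blast
  moreover have "{u, w} \<noteq> {v, w}" using u v w by (auto simp: doubleton_eq_iff)
  moreover have "{u, w} \<in> edges T" using u by (simp add: adj_def)
  ultimately show "lazy_rule T (leaf_edge_labeling T) i j {v, w}"
    using u(3) leaf_edge_labeling_leaf[OF tri u(1,2)] unfolding lazy_rule_def
    by (intro bexI[of _ "{u, w}"] exI[of _ "lab T u"]) simp_all
next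
  assume "lazy_rule T (leaf_edge_labeling T) i j {v, w}"
  then obtain f l where f: "f \<in> edges T" "f \<noteq> {v, w}" "f \<inter> {v, w} \<noteq> {}"
    "leaf_edge_labeling T f = Some l" "l \<noteq> j" "i < l" by (auto simp: lazy_rule_def)
  obtain u b where u: "f = {u, b}" "u \<in> leaves T" "adj T u b" "lab T u = l"
    using leaf_edge_labeling_SomeE[OF tri f(4)] by metis
  have "b = v \<or> b = w" using f(3) u v w_inner by auto
  moreover have "b \<noteq> v"
  proof
    assume "b = v"
    then have "adj T v u" using u adj_commute by metis
    then have "u = x \<or> u = y" using adj_v u w_inner by auto
    then show False using u f by auto
  qed
  ultimately show lazy using u f by (auto simp: lazy_def)
qed

abbreviation "adv \<equiv> (if lazy then i else j)"
abbreviation "out \<equiv> (if lazy then j else i)"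
abbreviation "T' \<equiv> prune T x y v adv"
abbreviation "S' \<equiv> S - {out}"

lemma leaves_prune: "leaves (prune T x y v s) = insert v (leaves T - {x, y})"
  by (rule prune_tree(2)[OF tri ch nbv w_inner])

lemma tri_prune: "trivalent_tree (prune T x y v s)"
  by (rule prune_tree(1)[OF tri ch nbv w_inner])

lemma ab_tree_prune:
  assumes st: "(s, t) = (i, j) \<or> (s, t) = (j, i)"
  shows "ab_tree (S - {t}) (prune T x y v s)"
proof -
  let ?T = "prune T x y v s"
  let ?L = "{label_a, label_b} \<union> S"
  have bij: "bij_betw (lab T) (leaves T) ?L" and S0: "S \<subseteq> {0..}"
    using tree by (auto simp: ab_tree_def)
  have "bij_betw (lab T) {x, y} {i, j}" using ij by (auto simp: bij_betw_def)
  then have "bij_betw (lab T) (leaves T - {x, y}) (?L - {i, j})"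
    using bij_betw_DiffI[OF bij] xy in_S by auto
  then have "bij_betw ((lab T)(v := s)) (leaves T - {x, y}) (?L - {i, j})"
    using v by (subst bij_betw_cong[of _ _ "lab T"]) auto
  moreover have "s \<notin> ?L - {i, j}" using st by auto
  ultimately have "bij_betw ((lab T)(v := s)) (insert v (leaves T - {x, y})) (insert s (?L - {i, j}))"
    using v notIn_Un_bij_betw[of v "leaves T - {x, y}" "(lab T)(v := s)" "?L - {i, j}"] by auto
  moreover have "insert s (?L - {i, j}) = {label_a, label_b} \<union> (S - {t})"
    using st in_S S0 ij by auto
  ultimately have bij': "bij_betw (lab ?T) (leaves ?T) ({label_a, label_b} \<union> (S - {t}))"
    by (simp add: leaves_prune)
  obtain p q r where r: "cherry T p q r" "lab T p = label_a" "lab T q = label_b"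
    using tree by (auto simp: ab_tree_def)
  have "lab T p \<notin> S" "lab T q \<notin> S" using S0 r by auto
  then have pq: "p \<noteq> x" "p \<noteq> y" "q \<noteq> x" "q \<noteq> y" using in_S by auto
  have "r \<noteq> x" "r \<noteq> y" using cherry_vertex[OF tri r(1)] xy by auto
  then have "cherry ?T p q r" "p \<noteq> v" "q \<noteq> v"
    using r(1) pq v by (auto simp: cherry_def leaves_prune)
  then show ?thesis using r bij' tri_prune S0
    unfolding ab_tree_def by (intro conjI exI[of _ p] exI[of _ q] exI[of _ r]) auto
qed

lemma tree': "ab_tree S' T'"
  by (rule ab_tree_prune) simp

lemma card_S: "card S = Suc (card S')"
  using in_S ab_tree_finite[OF tree] by (metis card.remove)

lemma edges_prune: "edges (prune T x y v s) = edges T - {{x, v}, {y, v}}"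
proof -
  have "e \<inter> {x, y} = {} \<longleftrightarrow> e \<noteq> {x, v} \<and> e \<noteq> {y, v}" if e: "e \<in> edges T" for e
  proof -
    have "e = {x, v}" if "x \<in> e" using edge_at[OF simp_T e that] adj_x by metis
    moreover have "e = {y, v}" if "y \<in> e" using edge_at[OF simp_T e that] adj_y by metis
    ultimately show ?thesis by blast
  qed
  then show ?thesis unfolding edges_prune_disjoint by blast
qed

lemma edges_at_v: "e \<in> edges T \<Longrightarrow> v \<in> e \<Longrightarrow> e = {x, v} \<or> e = {y, v} \<or> e = {v, w}"
  using edge_at[OF simp_T] adj_v by (metis insert_commute)

lemma edge_x: "e \<in> edges T \<Longrightarrow> x \<in> e \<Longrightarrow> e = {x, v}"
  using edge_at[OF simp_T] adj_x by metis

lemma edge_y: "e \<in> edges T \<Longrightarrow> y \<in> e \<Longrightarrow> e = {y, v}"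
  using edge_at[OF simp_T] adj_y by metis

text \<open>The three edges at v are labelled after the first round, and from then on the
  tournaments of T and of the pruned tree run in parallel.\<close>

definition agree :: "('v set \<Rightarrow> int option) \<Rightarrow> ('v set \<Rightarrow> int option) \<Rightarrow> bool" where
  "agree \<sigma> \<sigma>' \<longleftrightarrow> (\<forall>e \<in> edges T'. \<sigma> e = \<sigma>' e) \<and>
     \<sigma> {x, v} \<noteq> None \<and> \<sigma> {y, v} \<noteq> None \<and> \<sigma> {v, w} \<noteq> None"

lemma contests_agree:
  assumes ag: "agree \<sigma> \<sigma>'"
  shows "contests T \<sigma> = contests T' \<sigma>'"
proof (rule set_eqI)
  fix q :: "int \<times> int \<times> 'v \<times> 'v set"
  obtain l m u E where q: "q = (l, m, u, E)" by (cases q)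
  have eq: "\<sigma>' e = \<sigma> e" if "e \<in> edges T" "e \<noteq> {x, v}" "e \<noteq> {y, v}" for e
  proof -
    have "e \<in> edges T'" using that unfolding edges_prune by simp
    then show ?thesis using ag by (simp only: agree_def)
  qed
  show "q \<in> contests T \<sigma> \<longleftrightarrow> q \<in> contests T' \<sigma>'"
  proof
    assume "q \<in> contests T \<sigma>"
    then obtain e f where u: "u \<in> verts T" "l < m" and ef: "e \<in> edges T" "f \<in> edges T" "u \<in> e" "u \<in> f"
        "\<sigma> e = Some l" "\<sigma> f = Some m" and E: "E \<in> edges T" "u \<in> E" "\<sigma> E = None"
      unfolding contests_def q by blast
    have nE: "E \<noteq> {x, v}" "E \<noteq> {y, v}" "E \<noteq> {v, w}" using E ag by (auto simp: agree_def)
    then have nu: "u \<noteq> v" "u \<noteq> x" "u \<noteq> y"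
      using edges_at_v edge_x edge_y E by blast+
    then have ne: "e \<noteq> {x, v}" "e \<noteq> {y, v}" "f \<noteq> {x, v}" "f \<noteq> {y, v}" using ef by auto
    have "e \<in> edges T'" "f \<in> edges T'" "E \<in> edges T'" "u \<in> verts T'"
      using ne ef(1,2) E(1) nE u(1) nu unfolding edges_prune by simp_all
    moreover have "\<sigma>' e = Some l" "\<sigma>' f = Some m" "\<sigma>' E = None"
      using eq ef E ne nE by simp_all
    ultimately show "q \<in> contests T' \<sigma>'"
      unfolding contests_def q mem_Collect_eq case_prod_conv
      using u(2) ef(3,4) E(2) by blast
  next
    assume "q \<in> contests T' \<sigma>'"
    then obtain e f where u: "u \<in> verts T'" "l < m" and ef: "e \<in> edges T'" "f \<in> edges T'"
        "u \<in> e" "u \<in> f" "\<sigma>' e = Some l" "\<sigma>' f = Some m"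
      and E: "E \<in> edges T'" "u \<in> E" "\<sigma>' E = None"
      unfolding contests_def q by blast
    have "e \<in> edges T" "f \<in> edges T" "E \<in> edges T" "u \<in> verts T"
      using ef(1,2) E(1) u(1) unfolding edges_prune by simp_all
    moreover have "\<sigma> e = Some l" "\<sigma> f = Some m" "\<sigma> E = None"
      using ag ef E by (simp_all only: agree_def)
    ultimately show "q \<in> contests T \<sigma>"
      unfolding contests_def q mem_Collect_eq case_prod_conv
      using u(2) ef(3,4) E(2) by blast
  qed
qed

lemma agree_step:
  assumes ag: "agree \<sigma> \<sigma>'" and ne: "contests T' \<sigma>' \<noteq> {}"
  shows "agree (play_round T \<sigma>) (play_round T' \<sigma>')"
proof -
  have fin': "finite_tree T'" using tri_prune by (simp add: trivalent_tree_def)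
  obtain l m u E where q: "face_off T' \<sigma>' = (l, m, u, E)" by (cases "face_off T' \<sigma>'")
  then have "(l, m, u, E) \<in> contests T' \<sigma>'" using face_off_in_contests[OF fin' ne] by simp
  then have E: "E \<in> edges T'" "\<sigma>' E = None" by (auto simp: contests_def)
  have vw: "{v, w} \<in> edges T'"
    using w v xy unfolding edges_prune by (auto simp: adj_def doubleton_eq_iff)
  have nE: "E \<noteq> {v, w}" using E ag vw by (auto simp: agree_def)
  have E': "E \<in> edges T" "E \<noteq> {x, v}" "E \<noteq> {y, v}" using E(1) unfolding edges_prune by auto
  have disj: "x \<notin> E" "y \<notin> E" "v \<notin> E" using nE E' edges_at_v edge_x edge_y by blast+
  have q': "face_off T \<sigma> = (l, m, u, E)"
    using q contests_agree[OF ag] unfolding face_off_def by simp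
  have "lazy_rule T \<sigma> l m E = lazy_rule T' \<sigma>' l m E"
  proof -
    have "f \<in> edges T \<and> f \<inter> E \<noteq> {} \<longleftrightarrow> f \<in> edges T' \<and> f \<inter> E \<noteq> {}" for f
      unfolding edges_prune using disj by auto
    moreover have "\<sigma> f = \<sigma>' f" if "f \<in> edges T'" for f using that ag by (simp add: agree_def)
    ultimately show ?thesis unfolding lazy_rule_def by metis
  qed
  then show ?thesis using ag nE E' unfolding play_round_def q q' agree_def by auto
qed

lemma agree_first: "agree (tournament_state T 1) (tournament_state T' 0)"
proof -
  have st: "tournament_state T 1 = (leaf_edge_labeling T)({v, w} \<mapsto> adv)"
    by (simp add: play_round_def face_off_first lazy_rule_first)
  have "leaf_edge_labeling T {x, v} \<noteq> None" "leaf_edge_labeling T {y, v} \<noteq> None"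
    using leaf_edge_labeling_leaf[OF tri] xy by simp_all
  moreover have "((leaf_edge_labeling T)({v, w} \<mapsto> adv)) e = leaf_edge_labeling T' e" if e: "e \<in> edges T'" for e
  proof (cases "e = {v, w}")
    case True
    have "v \<in> leaves T'" "adj T' v w" using leaves_prune w v by auto
    then show ?thesis using leaf_edge_labeling_leaf[OF tri_prune] True by simp
  next
    case False
    have e': "e \<in> edges T" "e \<noteq> {x, v}" "e \<noteq> {y, v}" using e unfolding edges_prune by auto
    then have n: "v \<notin> e" "x \<notin> e" "y \<notin> e" using False edges_at_v edge_x edge_y by blast+
    obtain p q where pq: "e = {p, q}" "adj T p q" using simple_edge[OF simp_T e'(1)] .
    have l: "leaf_edge_labeling T' {p, q} = leaf_edge_labeling T {p, q}"
      if "p \<in> leaves T" "adj T p q" "v \<notin> {p, q}" "x \<notin> {p, q}" "y \<notin> {p, q}" for p q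
    proof -
      have "p \<in> leaves T'" "adj T' p q" "lab T' p = lab T p" using leaves_prune that by auto
      then show ?thesis
        using leaf_edge_labeling_leaf[OF tri_prune] leaf_edge_labeling_leaf[OF tri] that by metis
    qed
    show ?thesis
    proof (cases "p \<in> leaves T \<or> q \<in> leaves T")
      case True
      then show ?thesis using l[of p q] l[of q p] pq n False adj_commute[of T p q]
        by (auto simp: insert_commute)
    next
      case nl: False
      then have "leaf_edge_labeling T e = None" using leaf_edge_labeling_None[OF tri] e' pq by simp
      moreover have "p \<notin> leaves T'" "q \<notin> leaves T'" using nl n pq leaves_prune by auto
      then have "leaf_edge_labeling T' e = None" using leaf_edge_labeling_None[OF tri_prune] e pq by simp
      ultimately show ?thesis using False by simp
    qed
  qed
  ultimately show ?thesis unfolding agree_def st by auto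
qed

end

text \<open>Without a contest the next state would be unspecified.  After the first round the contests are
  those of the pruned tree, so each round reduces to the existence of a cherry.\<close>

lemma contests_nonempty:
  assumes "ab_tree S T" "Suc m < card S"
  shows "contests T (tournament_state T m) \<noteq> {}"
  using assms
proof (induction m arbitrary: S T rule: less_induct)
  case (less m)
  have "2 \<le> card S" using less.prems(2) by simp
  then obtain x y v w where "first_match S T x y v w"
    using exists_first_match[OF less.prems(1)] by blast
  then interpret first_match S T x y v w .
  show ?case
  proof (cases m)
    case 0
    then show ?thesis using initial_contestsI[OF tri ch ij w(4) w_inner] by auto
  next
    case (Suc m')
    have ne: "contests T' (tournament_state T' l) \<noteq> {}" if "l \<le> m'" for l
      using less.IH[of l S' T'] tree' that Suc less.prems(2) card_S by simp
    have "agree (tournament_state T (Suc l)) (tournament_state T' l)" if "l \<le> m'" for l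
      using that
    proof (induction l)
      case (Suc l)
      then show ?case using agree_step[OF _ ne[of l]] by simp
    qed (use agree_first in simp)
    then have "contests T (tournament_state T m) = contests T' (tournament_state T' m')"
      using contests_agree Suc by simp
    then show ?thesis using ne[of m'] by simp
  qed
qed

definition winners :: "'v ltree \<Rightarrow> nat \<Rightarrow> int list" where
  "winners T n = map (\<lambda>m. fst (snd (face_off T (tournament_state T m)))) [0..<n]"

lemma length_winners [simp]: "length (winners T n) = n"
  by (simp add: winners_def)

context first_match
begin

lemma agree_state:
  assumes "l < card S'"
  shows "agree (tournament_state T (Suc l)) (tournament_state T' l)"
  using assms
proof (induction l)
  case (Suc l)
  then show ?case using agree_step[OF _ contests_nonempty[OF tree', of l]] by simp
qed (use agree_first in simp)

lemma winners_first:
  assumes "card S' = Suc n"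
  shows "winners T (Suc n) = j # winners T' n"
proof -
  have "face_off T (tournament_state T (Suc l)) = face_off T' (tournament_state T' l)" if "l < n" for l
    using contests_agree[OF agree_state, of l] that assms unfolding face_off_def by simp
  then have "map (\<lambda>m. fst (snd (face_off T (tournament_state T m)))) [Suc 0..<Suc n] = winners T' n"
    unfolding winners_def map_Suc_upt[symmetric] by simp
  then show ?thesis
    by (simp add: winners_def upt_conv_Cons face_off_first del: upt_Suc)
qed

text \<open>If i advances then it loses the next round too.  If j advances then no labelled edge that
  it can meet beats i, so the next loser is smaller than i.\<close>

lemma next_loser:
  assumes "first_match S' T' x2 y2 v2 w2"
  shows "if lazy then lab T' x2 = i else lab T' x2 < i"
proof -
  interpret nxt: first_match S' T' x2 y2 v2 w2 by fact
  have adj': "adj T' v u \<longleftrightarrow> u = w" for u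
    using adj_v[of u] v w xy by (auto simp: adj_simple[OF simp_T])
  have small: "lab T u < i" if u: "u \<in> leaves T" "adj T u w" "\<not> lazy" for u
  proof -
    have "u \<noteq> x" using u adj_x w by auto
    then have "lab T u \<noteq> i" using lab_inj[OF tree u(1) xy(1)] by blast
    then show ?thesis using u by (force simp: lazy_def)
  qed
  have x2: "x2 \<in> insert v (leaves T - {x, y})" "y2 \<in> insert v (leaves T - {x, y})" "x2 \<noteq> y2"
    using nxt.xy leaves_prune by auto
  have a2: "adj T x2 v2" "adj T y2 v2" using nxt.xy by simp_all
  consider "x2 = v" | "y2 = v" "x2 \<noteq> v" | "x2 \<noteq> v" "y2 \<noteq> v" by blast
  then have le: "if lazy then lab T' x2 \<le> i else lab T' x2 < i"
  proof cases
    case 1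
    then have "v2 = w" using nxt.xy adj' by blast
    then show ?thesis using small[of y2] nxt.ij 1 x2 a2 by auto
  next
    case 2
    then have "v2 = w" using nxt.xy adj' by blast
    then show ?thesis using small[of x2] nxt.ij 2 x2 a2 by auto
  next
    case 3
    then have "cherry T x2 y2 v2" using x2 a2 by (auto simp: cherry_def)
    then show ?thesis using i_less[of x2 y2 v2] nxt.ij 3 x2 by auto
  qed
  moreover have "i \<le> lab T' x2" if lz: lazy
  proof -
    obtain u where u: "u \<in> leaves T" "adj T u w" "i < lab T u" using lz by (auto simp: lazy_def)
    have "u \<noteq> x" "u \<noteq> y" "u \<noteq> v" using u adj_x adj_y w v by auto
    then have "cherry T' v u w" using u w v leaves_prune by (auto simp: cherry_def)
    from nxt.i_max[OF this] show ?thesis using u lz \<open>u \<noteq> v\<close> by simp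
  qed
  ultimately show ?thesis by auto
qed

text \<open>If j advances then it exceeds the next loser, the largest label without a further win,
  so it wins again.  If i advances then j is out of the tournament.\<close>

lemma lazy_iff_next:
  assumes fm: "first_match S' T' x2 y2 v2 w2" and sub: "set W \<subseteq> S'"
    and loser: "lab T' x2 = Max (S' - set W)"
  shows "lazy \<longleftrightarrow> j \<notin> set W"
proof (cases lazy)
  case False
  then have "Max (S' - set W) < i" using next_loser[OF fm] unfolding loser by metis
  moreover have "j \<in> S'" using False in_S ij by auto
  then have "j \<le> Max (S' - set W)" if "j \<notin> set W"
    using that ab_tree_finite[OF tree] by (intro Max_ge) auto
  ultimately show ?thesis using False ij by force
qed (use sub in auto)

end

text \<open>Before the last round, the two ways to advance are the two cases of \<open>restricted_Cons\<close>: the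
  label that disappears is the largest label without a later win.  It is j if i advances, and i if
  j advances.\<close>

lemma winners_restricted:
  assumes "ab_tree S T" "card S = Suc n"
  shows "restricted S (winners T n) \<and>
    (\<forall>x y v w. first_match S T x y v w \<longrightarrow> lab T x = Max (S - set (winners T n)))"
  using assms
proof (induction n arbitrary: S T)
  case 0
  then show ?case by (auto simp: winners_def first_match_def)
next
  case (Suc n)
  have *: "restricted S (winners T (Suc n)) \<and> lab T x = Max (S - set (winners T (Suc n)))"
    if "first_match S T x y v w" for x y v w
  proof -
    interpret first_match S T x y v w by fact
    have c': "card S' = Suc n" using card_S Suc.prems by simp
    have W: "winners T (Suc n) = j # winners T' n" by (rule winners_first[OF c'])
    let ?W = "winners T' n"
    have IH: "restricted S' ?W"
      "\<And>x2 y2 v2 w2. first_match S' T' x2 y2 v2 w2 \<Longrightarrow> lab T' x2 = Max (S' - set ?W)"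
      using Suc.IH[OF tree' c'] by blast+
    have sub: "set ?W \<subseteq> S'" using IH(1) by (simp add: restricted_def)
    have fin: "finite S" using tree by (rule ab_tree_finite)
    show ?thesis
    proof (cases n)
      case 0
      then have W: "winners T (Suc n) = [j]" using W by (simp add: winners_def)
      have "card S = 2" using Suc.prems 0 by simp
      then have S: "S = {i, j}" using in_S ij fin
        by (metis card_2_iff' card_seteq insert_subset card_2_iff empty_subsetI less_irrefl order_refl)
      then have "S - {j} = {i}" using ij by auto
      moreover have "restricted S [j]"
        using restricted_Cons[OF fin, of "[]" j] Suc.prems 0 S ij by auto
      ultimately show ?thesis using W by simp
    next
      case (Suc n')
      then have "2 \<le> card S'" using c' by simp
      then obtain x2 y2 v2 w2 where fm: "first_match S' T' x2 y2 v2 w2"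
        using exists_first_match[OF tree'] by blast
      have nl: "if lazy then Max (S' - set ?W) = i else Max (S' - set ?W) < i"
        using next_loser[OF fm] unfolding IH(2)[OF fm] .
      have fin': "finite (S' - set ?W)" using fin by simp
      have lz: "lazy \<longleftrightarrow> j \<notin> set ?W"
        by (rule lazy_iff_next[OF fm sub IH(2)[OF fm]])
      have iW: "i \<notin> set ?W"
        using sub nl Max_in[OF fin'] exists_nonletter[of S' ?W] fin c' by (cases lazy) auto
      have le: "s \<le> i" if "s \<in> S" "s \<notin> set ?W" "s \<noteq> j" for s
      proof (cases "s = i")
        case False
        then have "s \<le> Max (S' - set ?W)" using that fin' by (intro Max_ge) auto
        then show ?thesis using nl by (auto split: if_splits)
      qed simp
      have i: "i = Max (S - set (winners T (Suc n)))"
        by (rule Max_eqI[symmetric]) (use le W in_S iW fin ij in auto)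
      have out: "Max (S - set ?W) = out"
        by (rule Max_eqI) (use le lz in_S iW fin ij in \<open>auto, force\<close>)
      have "restricted S (j # ?W)"
        using restricted_Cons[OF fin, of ?W j] IH(1) out Suc.prems in_S le ij by fastforce
      then show ?thesis using W i by simp
    qed
  qed
  have "2 \<le> card S" using Suc.prems(2) by simp
  then obtain x y v w where "first_match S T x y v w"
    using exists_first_match[OF Suc.prems(1)] by blast
  then show ?case using * by blast
qed

lemma (in first_match) lazy_iff:
  assumes "card S' = Suc (Suc n)"
  shows "lazy \<longleftrightarrow> j \<notin> set (winners T' (Suc n))"
proof -
  let ?W = "winners T' (Suc n)"
  have "2 \<le> card S'" using assms by simp
  then obtain x2 y2 v2 w2 where fm: "first_match S' T' x2 y2 v2 w2"
    using exists_first_match[OF tree'] by blast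
  have "restricted S' ?W" "lab T' x2 = Max (S' - set ?W)"
    using winners_restricted[OF tree' assms] fm by blast+
  then show ?thesis by (intro lazy_iff_next[OF fm]) (simp_all add: restricted_def)
qed

section \<open>Relabelling and isomorphism\<close>

text \<open>For \<open>g = id\<close> this is isomorphism of labelled trees; for \<open>\<phi> = id\<close> it is a change of labels.\<close>

definition tree_map :: "(int \<Rightarrow> int) \<Rightarrow> ('v \<Rightarrow> 'w) \<Rightarrow> 'v ltree \<Rightarrow> 'w ltree \<Rightarrow> bool" where
  "tree_map g \<phi> T U \<longleftrightarrow> bij_betw \<phi> (verts T) (verts U) \<and> edges U = (\<lambda>e. \<phi> ` e) ` edges T \<and>
     (\<forall>x \<in> leaves T. lab U (\<phi> x) = g (lab T x))"

lemma isomorphic_iff_tree_map: "isomorphic T U \<longleftrightarrow> (\<exists>\<phi>. tree_map id \<phi> T U)"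
  by (simp add: isomorphic_def tree_map_def)

lemma tree_map_adj:
  assumes m: "tree_map g \<phi> T U" and s: "simple_graph T" and pq: "p \<in> verts T" "q \<in> verts T"
  shows "adj U (\<phi> p) (\<phi> q) \<longleftrightarrow> adj T p q"
proof
  have inj: "inj_on \<phi> (verts T)" using m by (simp add: tree_map_def bij_betw_def)
  assume "adj U (\<phi> p) (\<phi> q)"
  then obtain e where e: "e \<in> edges T" "{\<phi> p, \<phi> q} = \<phi> ` e" using m by (auto simp: adj_def tree_map_def)
  then have "e \<subseteq> verts T" using s by (auto simp: simple_graph_def)
  then have "e = {p, q}" using inj_on_image_eq_iff[OF inj, of "{p, q}" e] e(2) pq by auto
  then show "adj T p q" using e by (simp add: adj_def)
next
  assume "adj T p q"
  then have "\<phi> ` {p, q} \<in> edges U" using m unfolding tree_map_def adj_def by blast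
  then show "adj U (\<phi> p) (\<phi> q)" by (simp add: adj_def)
qed

lemma tree_map_nb:
  assumes m: "tree_map g \<phi> T U" and s: "simple_graph T" "simple_graph U" and p: "p \<in> verts T"
  shows "nb U (\<phi> p) = \<phi> ` nb T p"
proof (rule set_eqI)
  fix z
  have im: "\<phi> ` verts T = verts U" using m by (simp add: tree_map_def bij_betw_def)
  have "z \<in> nb U (\<phi> p) \<longleftrightarrow> (\<exists>q \<in> verts T. z = \<phi> q \<and> adj U (\<phi> p) z)"
    using adj_simple(2)[OF s(2), of "\<phi> p" z] im by (auto simp del: adj_mk)
  also have "\<dots> \<longleftrightarrow> (\<exists>q \<in> verts T. z = \<phi> q \<and> adj T p q)"
    using tree_map_adj[OF m s(1) p] by blast
  also have "\<dots> \<longleftrightarrow> z \<in> \<phi> ` nb T p"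
    using adj_simple(2)[OF s(1), of p] by (auto simp: image_iff)
  finally show "z \<in> nb U (\<phi> p) \<longleftrightarrow> z \<in> \<phi> ` nb T p" .
qed

lemma tree_map_leaves:
  assumes m: "tree_map g \<phi> T U" and s: "simple_graph T" "simple_graph U"
  shows "leaves U = \<phi> ` leaves T"
proof -
  have im: "\<phi> ` verts T = verts U" and inj: "inj_on \<phi> (verts T)"
    using m by (auto simp: tree_map_def bij_betw_def)
  have "degree U (\<phi> p) = degree T p" if p: "p \<in> verts T" for p
  proof -
    have "nb T p \<subseteq> verts T" using adj_simple(2)[OF s(1)] by (auto simp: nb_def)
    then have "card (\<phi> ` nb T p) = card (nb T p)" using inj by (meson card_image inj_on_subset)
    then show ?thesis
      by (simp add: degree_eq_card_nb[OF s(1)] degree_eq_card_nb[OF s(2)] tree_map_nb[OF m s p])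
  qed
  then show ?thesis unfolding leaves_def im[symmetric] by auto
qed

lemma tree_map_cherry:
  assumes m: "tree_map g \<phi> T U" and s: "simple_graph T" "simple_graph U"
    and pqr: "p \<in> verts T" "q \<in> verts T" "r \<in> verts T"
  shows "cherry U (\<phi> p) (\<phi> q) (\<phi> r) \<longleftrightarrow> cherry T p q r"
proof -
  have inj: "inj_on \<phi> (verts T)" using m by (simp add: tree_map_def bij_betw_def)
  have "\<phi> z \<in> leaves U \<longleftrightarrow> z \<in> leaves T" if "z \<in> verts T" for z
    unfolding tree_map_leaves[OF m s] using inj_on_image_mem_iff[OF inj that leaves_subset] .
  moreover have "\<phi> p = \<phi> q \<longleftrightarrow> p = q" using inj pqr by (auto dest: inj_onD)
  ultimately show ?thesis using tree_map_adj[OF m s(1)] pqr by (simp add: cherry_def)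
qed

lemma (in first_match) tree_map_first_match:
  assumes U: "ab_tree S2 U" and m: "tree_map g \<phi> T U"
    and g: "strict_mono_on ({label_a, label_b} \<union> S) g"
  shows "first_match S2 U (\<phi> x) (\<phi> y) (\<phi> v) (\<phi> w)"
proof -
  have triU: "trivalent_tree U" using U by (simp add: ab_tree_def)
  note sU = trivalent_simple[OF triU]
  note lv = tree_map_leaves[OF m simp_T sU]
  have inj: "inj_on \<phi> (verts T)" and im: "\<phi> ` verts T = verts U"
    using m by (auto simp: tree_map_def bij_betw_def)
  have labU: "lab U (\<phi> p) = g (lab T p)" if "p \<in> leaves T" for p
    using m that by (simp add: tree_map_def)
  have less: "lab U (\<phi> p) < lab U (\<phi> q) \<longleftrightarrow> lab T p < lab T q" if "p \<in> leaves T" "q \<in> leaves T" for p q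
    using strict_mono_on_less[OF g, of "lab T p" "lab T q"] lab_range[OF tree] that labU by auto
  have vs: "x \<in> verts T" "y \<in> verts T" "v \<in> verts T"
    using xy v leaves_subset[of T] by auto
  have "card (leaves U) = card (leaves T)"
    unfolding lv using inj leaves_subset by (meson card_image inj_on_subset)
  then have "2 \<le> card S2" using card_leaves[OF tree] card_leaves[OF U] big by simp
  moreover have "nb U (\<phi> v) = {\<phi> x, \<phi> y, \<phi> w}"
    unfolding tree_map_nb[OF m simp_T sU vs(3)] nbv by simp
  moreover have "first_cherry U (\<phi> x) (\<phi> y) (\<phi> v)"
    unfolding first_cherry_def
  proof (intro conjI allI impI)
    show "cherry U (\<phi> x) (\<phi> y) (\<phi> v)" using tree_map_cherry[OF m simp_T sU] vs ch by simp
    show "lab U (\<phi> x) < lab U (\<phi> y)" using less xy ij by simp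
    fix p' q' r' assume *: "cherry U p' q' r' \<and> lab U p' < lab U q'"
    then obtain p q where p: "p' = \<phi> p" "p \<in> leaves T" and q: "q' = \<phi> q" "q \<in> leaves T"
      unfolding cherry_def lv by blast
    have "r' \<in> \<phi> ` verts T" using * cherry_vertex(1)[OF triU] im by metis
    then obtain r where r: "r' = \<phi> r" "r \<in> verts T" by blast
    have "p \<in> verts T" "q \<in> verts T" using p q leaves_subset[of T] by auto
    then have "cherry T p q r" using * tree_map_cherry[OF m simp_T sU] p q r by simp
    moreover have "lab T p < lab T q" using * less p q by simp
    ultimately have "lab T p \<le> lab T x" by (rule i_max)
    then show "lab U p' \<le> lab U (\<phi> x)" using less[OF xy(1) p(2)] p(1) by simp
  qed
  ultimately show ?thesis using U by (simp add: first_match_def)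
qed

lemma (in first_match) tree_map_prune:
  assumes U: "first_match S2 U (\<phi> x) (\<phi> y) (\<phi> v) (\<phi> w)" and m: "tree_map g \<phi> T U"
  shows "tree_map g \<phi> (prune T x y v s) (prune U (\<phi> x) (\<phi> y) (\<phi> v) (g s))"
proof -
  interpret u: first_match S2 U "\<phi> x" "\<phi> y" "\<phi> v" "\<phi> w" by (rule U)
  have b: "bij_betw \<phi> (verts T) (verts U)" and inj: "inj_on \<phi> (verts T)"
    using m by (auto simp: tree_map_def bij_betw_def)
  have vs: "x \<in> verts T" "y \<in> verts T" "v \<in> verts T"
    using xy v leaves_subset[of T] by auto
  have "bij_betw \<phi> {x, y} {\<phi> x, \<phi> y}" using inj vs by (auto simp: bij_betw_def inj_on_def)
  then have "bij_betw \<phi> (verts T - {x, y}) (verts U - {\<phi> x, \<phi> y})"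
    using bij_betw_DiffI[OF b] vs u.xy leaves_subset[of U] by blast
  moreover have "edges (prune U (\<phi> x) (\<phi> y) (\<phi> v) (g s)) = (\<lambda>e. \<phi> ` e) ` edges (prune T x y v s)"
  proof -
    have "inj_on (\<lambda>e. \<phi> ` e) (Pow (verts T))" using inj by (rule inj_on_image_Pow)
    moreover have "edges T \<subseteq> Pow (verts T)" using simp_T by (auto simp: simple_graph_def)
    moreover have "{{x, v}, {y, v}} \<subseteq> Pow (verts T)" using vs by simp
    ultimately have "(\<lambda>e. \<phi> ` e) ` (edges T - {{x, v}, {y, v}}) =
        (\<lambda>e. \<phi> ` e) ` edges T - (\<lambda>e. \<phi> ` e) ` {{x, v}, {y, v}}"
      by (meson inj_on_image_set_diff Diff_subset subset_trans)
    also have "(\<lambda>e. \<phi> ` e) ` edges T = edges U" using m by (simp add: tree_map_def)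
    finally show ?thesis unfolding edges_prune u.edges_prune by simp
  qed
  moreover have "lab (prune U (\<phi> x) (\<phi> y) (\<phi> v) (g s)) (\<phi> p) = g (lab (prune T x y v s) p)"
    if p: "p \<in> leaves (prune T x y v s)" for p
  proof (cases "p = v")
    case False
    then have "p \<in> leaves T" "p \<in> verts T" using p leaves_prune leaves_subset[of T] by auto
    moreover from this have "\<phi> p \<noteq> \<phi> v" using inj vs False by (auto dest: inj_onD)
    ultimately show ?thesis using m False by (simp add: tree_map_def)
  qed simp
  ultimately show ?thesis by (simp add: tree_map_def)
qed

text \<open>Contests are chosen by comparing labels, and the first one is unique, so an order-preserving
  relabelling carries it along; the pruned trees are related in the same way.\<close>

lemma winners_relabel:
  assumes "ab_tree S T" "card S = Suc n" "ab_tree S2 U" "tree_map g \<phi> T U"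
    "strict_mono_on ({label_a, label_b} \<union> S) g"
  shows "winners U n = map g (winners T n)"
  using assms
proof (induction n arbitrary: S T S2 U)
  case 0
  then show ?case by (simp add: winners_def)
next
  case (Suc n)
  have "2 \<le> card S" using Suc.prems(2) by simp
  then obtain x y v w where "first_match S T x y v w"
    using exists_first_match[OF Suc.prems(1)] by blast
  then interpret t: first_match S T x y v w .
  have fu: "first_match S2 U (\<phi> x) (\<phi> y) (\<phi> v) (\<phi> w)"
    by (rule t.tree_map_first_match[OF Suc.prems(3-5)])
  then interpret u: first_match S2 U "\<phi> x" "\<phi> y" "\<phi> v" "\<phi> w" .
  have m: "tree_map g \<phi> T U" by fact
  note lv = tree_map_leaves[OF m t.simp_T u.simp_T]
  have labU: "lab U (\<phi> p) = g (lab T p)" if "p \<in> leaves T" for p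
    using m that by (simp add: tree_map_def)
  have "w \<in> verts T" using adj_simple[OF t.simp_T] t.w by blast
  then have "adj U (\<phi> p) (\<phi> w) \<longleftrightarrow> adj T p w" if "p \<in> leaves T" for p
    using tree_map_adj[OF m t.simp_T] that leaves_subset[of T] by blast
  moreover have "lab U (\<phi> x) < lab U (\<phi> p) \<longleftrightarrow> lab T x < lab T p" if "p \<in> leaves T" for p
    using strict_mono_on_less[OF Suc.prems(5), of "lab T x" "lab T p"] t.xy(1)
      lab_range[OF t.tree] that labU by auto
  ultimately have lz: "u.lazy \<longleftrightarrow> t.lazy"
    unfolding u.lazy_def t.lazy_def lv by blast
  have adv: "u.adv = g t.adv" using lz labU t.xy by simp
  have mono: "strict_mono_on ({label_a, label_b} \<union> t.S') g"
    by (rule monotone_on_subset[OF Suc.prems(5)]) auto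
  have c: "card t.S' = Suc n" using t.card_S Suc.prems(2) by simp
  have "card (leaves U) = card (leaves T)"
    unfolding lv using m leaves_subset[of T]
    by (meson card_image inj_on_subset tree_map_def bij_betw_def)
  then have "card S2 = card S" using card_leaves[OF t.tree] card_leaves[OF u.tree] by simp
  then have c2: "card u.S' = Suc n" using u.card_S Suc.prems(2) by simp
  have "winners u.T' n = map g (winners t.T' n)"
    by (rule Suc.IH[OF t.tree' c u.tree' _ mono])
      (unfold adv, rule t.tree_map_prune[OF fu m])
  then show ?case
    unfolding t.winners_first[OF c] u.winners_first[OF c2] using labU t.xy by simp
qed

section \<open>A tree is determined by its winners\<close>

lemma star_tree:
  assumes T: "ab_tree {s} T"
  obtains r p q z where "verts T = {r, p, q, z}" "leaves T = {p, q, z}" "distinct [r, p, q, z]"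
    "edges T = {{p, r}, {q, r}, {z, r}}" "lab T p = label_a" "lab T q = label_b" "lab T z = s"
proof -
  have tri: "trivalent_tree T" using T by (simp add: ab_tree_def)
  note sg = trivalent_simple[OF tri]
  have s: "0 \<le> s" using T by (simp add: ab_tree_def)
  obtain p q r where ch: "cherry T p q r" and lp: "lab T p = label_a" "lab T q = label_b"
    using T by (auto simp: ab_tree_def)
  then have p: "p \<in> leaves T" "q \<in> leaves T" "p \<noteq> q" "adj T p r" "adj T q r"
    by (auto simp: cherry_def)
  have a: "adj T r p" "adj T r q" using p adj_commute by metis+
  note r = cherry_vertex[OF tri ch]
  obtain z where z: "nb T r = {p, q, z}" "z \<noteq> p" "z \<noteq> q"
    using third_nb[OF tri r(2) a p(3)] by metis
  then have rz: "adj T r z" by (metis in_nb_iff insertI1 insert_commute)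
  have "z \<in> leaves T"
  proof (rule ccontr)
    assume "z \<notin> leaves T"
    then obtain w c c' where c: "w \<noteq> r" "c \<in> leaves T" "c' \<in> leaves T" "c \<noteq> c'" "adj T c w" "adj T c' w"
      using far_cherry[OF tri p(1,4) rz] by blast
    have "c \<noteq> p" "c \<noteq> q" "c' \<noteq> p" "c' \<noteq> q" using c p leaf_unique_nb[OF sg] by metis+
    then have "card {p, q, c, c'} = 4" using p c by simp
    moreover have "{p, q, c, c'} \<subseteq> leaves T" using p c by simp
    ultimately have "4 \<le> card (leaves T)" using card_mono[OF finite_leaves[OF tri]] by metis
    then show False using card_leaves[OF T] by simp
  qed
  then have sub: "nb T r \<subseteq> leaves T" using z p by simp
  have vs: "verts T = {r, p, q, z}" and lv: "leaves T = {p, q, z}"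
    using star_if_all_leaves[OF tri r(1,2) sub] z(1) by simp_all
  have d: "distinct [r, p, q, z]" using r(3,4) p z adj_simple(3)[OF sg rz] by simp
  have "lab T z = s"
    using lab_range[OF T \<open>z \<in> leaves T\<close>] lab_inj[OF T \<open>z \<in> leaves T\<close>] p lp z by (metis singletonD)
  moreover have "edges T = {{p, r}, {q, r}, {z, r}}"
  proof
    show "edges T \<subseteq> {{p, r}, {q, r}, {z, r}}"
    proof
      fix e assume "e \<in> edges T"
      then obtain c c' where c: "e = {c, c'}" "adj T c c'" using simple_edge[OF sg] by metis
      have "c \<in> {r, p, q, z}" using adj_simple(1)[OF sg c(2)] vs by simp
      moreover have "c = r \<or> c' = r"
      proof (rule ccontr)
        assume "\<not> ?thesis"
        then have "c \<in> leaves T" "c' \<in> leaves T" using adj_simple(1,2)[OF sg c(2)] vs lv by auto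
        then show False using leaves_not_adj[OF tri] c by blast
      qed
      ultimately consider "c = r" "c' \<in> nb T r" | "c' = r" "c \<in> {p, q, z}"
        using c(2) adj_simple(3)[OF sg c(2)] by auto
      then show "e \<in> {{p, r}, {q, r}, {z, r}}"
        using c(1) z(1) by cases (auto simp: insert_commute)
    qed
    show "{{p, r}, {q, r}, {z, r}} \<subseteq> edges T"
      using p rz by (auto simp: adj_def insert_commute)
  qed
  ultimately show ?thesis using that vs lv d lp by blast
qed

text \<open>With a single round the laziness rule compares i with a and b only.\<close>

lemma star_not_lazy:
  assumes "first_match S T x y v w" "card S = 2"
  shows "\<not> first_match.lazy T x w"
proof
  interpret first_match S T x y v w by fact
  assume lazy
  then obtain u where u: "u \<in> leaves T" "adj T u w" "i < lab T u" by (auto simp: lazy_def)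
  have "u \<noteq> y" using u adj_y w by auto
  then have "lab T u \<noteq> j" using lab_inj[OF tree u(1) xy(2)] by blast
  moreover have "0 \<le> i" using in_S tree by (auto simp: ab_tree_def)
  then have "lab T u \<in> S" using lab_range[OF tree u(1)] u by auto
  ultimately have "{i, j, lab T u} \<subseteq> S" "card {i, j, lab T u} = 3" using in_S ij u by auto
  then show False using card_mono[OF ab_tree_finite[OF tree], of "{i, j, lab T u}"] assms(2) by simp
qed

text \<open>The word of winners reveals the first pair (the loser is the largest label that never wins) and
  the advancing label (by \<open>lazy_iff\<close>), so an isomorphism of the pruned trees extends to the
  two removed leaves.\<close>

lemma tree_determined_by_winners:
  assumes "ab_tree S T" "ab_tree S U" "card S = Suc n" "winners T n = winners U n"
  shows "\<exists>\<phi>. tree_map id \<phi> T U"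
  using assms
proof (induction n arbitrary: S T U)
  case 0
  then obtain s where S: "S = {s}" using card_1_singletonE by auto
  obtain r p q z where T: "verts T = {r, p, q, z}" "leaves T = {p, q, z}" "distinct [r, p, q, z]"
    "edges T = {{p, r}, {q, r}, {z, r}}" "lab T p = label_a" "lab T q = label_b" "lab T z = s"
    using star_tree[of s T] 0 S by blast
  obtain r' p' q' z' where U: "verts U = {r', p', q', z'}" "leaves U = {p', q', z'}" "distinct [r', p', q', z']"
    "edges U = {{p', r'}, {q', r'}, {z', r'}}" "lab U p' = label_a" "lab U q' = label_b" "lab U z' = s"
    using star_tree[of s U] 0 S by blast
  have "tree_map id (\<lambda>a. if a = r then r' else if a = p then p' else if a = q then q' else z') T U"
    unfolding tree_map_def T U bij_betw_def inj_on_def using T(3,5-7) U(3,5-7)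
    by (auto simp: insert_commute)
  then show ?case by blast
next
  case (Suc n)
  have big: "2 \<le> card S" using Suc.prems(3) by simp
  obtain x y v w where "first_match S T x y v w"
    using exists_first_match[OF Suc.prems(1) big] by blast
  then interpret t: first_match S T x y v w .
  obtain x2 y2 v2 w2 where "first_match S U x2 y2 v2 w2"
    using exists_first_match[OF Suc.prems(2) big] by blast
  then interpret u: first_match S U x2 y2 v2 w2 .
  have c: "card t.S' = Suc n" "card u.S' = Suc n" using t.card_S u.card_S Suc.prems(3) by simp_all
  have "t.j = u.j" and W: "winners t.T' n = winners u.T' n"
    using Suc.prems(4) unfolding t.winners_first[OF c(1)] u.winners_first[OF c(2)] by simp_all
  note j = \<open>t.j = u.j\<close>
  have i: "t.i = u.i"
    using winners_restricted[OF Suc.prems(1,3)] winners_restricted[OF Suc.prems(2,3)]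
      t.first_match_axioms u.first_match_axioms Suc.prems(4) by metis
  have lz: "t.lazy \<longleftrightarrow> u.lazy"
  proof (cases n)
    case 0
    then show ?thesis
      using star_not_lazy[OF t.first_match_axioms] star_not_lazy[OF u.first_match_axioms] Suc.prems(3) by simp
  next
    case (Suc m)
    then show ?thesis using t.lazy_iff[of m] u.lazy_iff[of m] c W j by simp
  qed
  have S': "t.S' = u.S'" and adv: "t.adv = u.adv" using i j lz by simp_all
  have "ab_tree t.S' u.T'" using u.tree' by (simp only: S')
  then obtain \<phi> where m: "tree_map id \<phi> t.T' u.T'"
    using Suc.IH[OF t.tree' _ c(1) W] by blast
  have bij: "bij_betw \<phi> (verts T - {x, y}) (verts U - {x2, y2})"
    and ed: "edges u.T' = (\<lambda>e. \<phi> ` e) ` edges t.T'"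
    and lb: "\<And>p. p \<in> leaves t.T' \<Longrightarrow> lab u.T' (\<phi> p) = lab t.T' p"
    using m by (auto simp: tree_map_def)
  have "\<phi> v \<in> leaves u.T'"
    using tree_map_leaves[OF m trivalent_simple[OF t.tri_prune] trivalent_simple[OF u.tri_prune]]
      t.leaves_prune by auto
  moreover have "v2 \<in> leaves u.T'" using u.leaves_prune by auto
  moreover have "lab u.T' (\<phi> v) = lab u.T' v2" using lb[of v] t.leaves_prune adv by simp
  ultimately have v: "\<phi> v = v2" using lab_inj[OF u.tree'] by blast
  define \<psi> where "\<psi> = \<phi>(x := x2, y := y2)"
  have \<psi>: "\<psi> x = x2" "\<psi> y = y2" "\<psi> v = v2" "\<And>p. p \<noteq> x \<Longrightarrow> p \<noteq> y \<Longrightarrow> \<psi> p = \<phi> p"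
    using t.xy t.v v by (auto simp: \<psi>_def)
  have "bij_betw \<psi> {x, y} {x2, y2}" using \<psi> t.xy u.xy by (auto simp: bij_betw_def)
  moreover have "bij_betw \<psi> (verts T - {x, y}) (verts U - {x2, y2})"
    using bij by (rule bij_betw_cong[THEN iffD1, rotated]) (use \<psi>(4) in auto)
  ultimately have "bij_betw \<psi> ({x, y} \<union> (verts T - {x, y})) ({x2, y2} \<union> (verts U - {x2, y2}))"
    by (rule bij_betw_combine) auto
  moreover have "{x, y} \<union> (verts T - {x, y}) = verts T" "{x2, y2} \<union> (verts U - {x2, y2}) = verts U"
    using t.xy u.xy leaves_subset[of T] leaves_subset[of U] by auto
  ultimately have b: "bij_betw \<psi> (verts T) (verts U)" by simp
  have "\<psi> ` e = \<phi> ` e" if "e \<in> edges t.T'" for e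
  proof (rule image_cong[OF refl])
    fix p assume "p \<in> e"
    then have "p \<noteq> x" "p \<noteq> y" using that by (auto simp: edges_prune_disjoint)
    then show "\<psi> p = \<phi> p" by (rule \<psi>(4))
  qed
  then have "edges u.T' = (\<lambda>e. \<psi> ` e) ` edges t.T'" unfolding ed by (rule image_cong[OF refl, symmetric])
  moreover have "edges T = edges t.T' \<union> {{x, v}, {y, v}}" "edges U = edges u.T' \<union> {{x2, v2}, {y2, v2}}"
    using t.edges_prune u.edges_prune t.xy u.xy by (auto simp: adj_def)
  ultimately have e: "edges U = (\<lambda>e. \<psi> ` e) ` edges T" using \<psi> by (simp add: image_Un)
  have "lab U (\<psi> p) = lab T p" if p: "p \<in> leaves T" for p
  proof -
    consider "p = x" | "p = y" | "p \<noteq> x" "p \<noteq> y" "p \<noteq> v" using t.v p by blast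
    then show ?thesis
    proof cases
      case 3
      then have "\<phi> p \<noteq> v2" using v bij t.v p leaves_subset[of T]
        by (auto simp: bij_betw_def dest: inj_onD)
      then show ?thesis using lb[of p] t.leaves_prune 3 p \<psi> by simp
    qed (use \<psi> i j in auto)
  qed
  then show ?case using b e unfolding tree_map_def by auto
qed

section \<open>Every restricted word is the list of winners of a tree\<close>

lemma exists_star_tree:
  assumes "0 \<le> s"
  shows "\<exists>T :: nat ltree. ab_tree {s} T"
proof -
  define l :: "nat \<Rightarrow> int" where "l = (\<lambda>x. if x = 1 then label_a else if x = 2 then label_b else s)"
  define T0 where "T0 = \<lparr>verts = {0 :: nat}, edges = {}, lab = l\<rparr>"
  define T1 where "T1 = \<lparr>verts = {1, 0}, edges = {{0, 1}}, lab = l\<rparr>"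
  define T2 where "T2 = \<lparr>verts = {2, 1, 0}, edges = {{0, 2}, {0, 1}}, lab = l\<rparr>"
  define T where "T = \<lparr>verts = {3, 2, 1, 0}, edges = {{0, 3}, {0, 2}, {0, 1}}, lab = l\<rparr>"
  have "finite_tree T0"
    by (auto simp: T0_def finite_tree_def simple_graph_def connected_graph_def cycle_def)
  then have "finite_tree T1"
    by (rule finite_tree_add_leaf[of _ 0 1]) (auto simp: T0_def T1_def)
  then have "finite_tree T2"
    by (rule finite_tree_add_leaf[of _ 0 2]) (auto simp: T1_def T2_def)
  then have ft: "finite_tree T"
    by (rule finite_tree_add_leaf[of _ 0 3]) (auto simp: T2_def T_def)
  then have sg: "simple_graph T" by (simp add: finite_tree_def)
  have "nb T 0 = {1, 2, 3}" "nb T 1 = {0}" "nb T 2 = {0}" "nb T 3 = {0}"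
    by (auto simp: T_def doubleton_eq_iff)
  then have deg: "degree T 0 = 3" "degree T 1 = 1" "degree T 2 = 1" "degree T 3 = 1"
    by (simp_all add: degree_eq_card_nb[OF sg])
  have vT: "verts T = {3, 2, 1, 0}" by (simp add: T_def)
  have lv: "leaves T = {1, 2, 3}" using deg unfolding leaves_def vT by auto
  have "trivalent_tree T" using ft deg unfolding trivalent_tree_def vT by simp
  moreover have "bij_betw (lab T) (leaves T) ({label_a, label_b} \<union> {s})"
    unfolding lv using assms by (auto simp: T_def l_def bij_betw_def)
  moreover have "cherry T 1 2 0" unfolding cherry_def lv by (simp add: T_def insert_commute)
  moreover have "lab T 1 = label_a" "lab T 2 = label_b" by (simp_all add: T_def l_def)
  ultimately show ?thesis using assms unfolding ab_tree_def by auto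
qed

lemma ab_tree_graft:
  assumes T: "ab_tree S' T" and v: "v \<in> leaves T" "adj T v w" "lab T v = s"
    and x: "x \<notin> verts T" "y \<notin> verts T" "x \<noteq> y"
    and S: "S \<subseteq> {0..}" "S' = S - {t}" "t \<in> S" "s \<in> S" and st: "(s, t) = (i, j) \<or> (s, t) = (j, i)" "i \<noteq> j"
  shows "ab_tree S (graft T x y v i j)"
proof -
  let ?T = "graft T x y v i j"
  let ?L = "{label_a, label_b} \<union> S'"
  have tri: "trivalent_tree T" and bij: "bij_betw (lab T) (leaves T) ?L"
    using T by (auto simp: ab_tree_def)
  note g = graft_tree[OF tri v(1,2) x, of i j]
  have labg: "lab ?T = (lab T)(x := i, y := j)" by (simp add: graft_def)
  have xl: "x \<notin> leaves T" "y \<notin> leaves T" using x leaves_subset[of T] by auto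
  have "bij_betw (lab T) {v} {s}" using v by simp
  then have "bij_betw (lab T) (leaves T - {v}) (?L - {s})"
    using bij_betw_DiffI[OF bij] v S st by auto
  then have b: "bij_betw (lab ?T) (leaves T - {v}) (?L - {s})"
    by (rule bij_betw_cong[THEN iffD1, rotated]) (use xl labg in auto)
  have "bij_betw (lab ?T) {x, y} {i, j}" using x st labg by (auto simp: bij_betw_def)
  moreover have "{i, j} \<inter> (?L - {s}) = {}" using S st by auto
  ultimately have "bij_betw (lab ?T) ({x, y} \<union> (leaves T - {v})) ({i, j} \<union> (?L - {s}))"
    using b by (intro bij_betw_combine)
  moreover have "{i, j} \<union> (?L - {s}) = {label_a, label_b} \<union> S" using S st by auto
  ultimately have "bij_betw (lab ?T) (leaves ?T) ({label_a, label_b} \<union> S)"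
    unfolding g(2) by simp
  moreover obtain p q r where r: "cherry T p q r" "lab T p = label_a" "lab T q = label_b"
    using T by (auto simp: ab_tree_def)
  then have "p \<noteq> v" "q \<noteq> v" using v S by auto
  moreover from this have "cherry ?T p q r"
    using r(1) unfolding cherry_def g(2) by (auto simp: graft_def adj_def)
  moreover have "p \<noteq> x" "p \<noteq> y" "q \<noteq> x" "q \<noteq> y" using r(1) xl by (auto simp: cherry_def)
  ultimately show ?thesis using g(1) S r unfolding ab_tree_def labg
    by (intro conjI exI[of _ p] exI[of _ q] exI[of _ r]) auto
qed

text \<open>Read backwards, \<open>restricted_Cons\<close> says which leaf to replace by a cherry.  The loser i of the
  new pair is the largest label that never wins, so no other cherry comes first, and
  the first contest of the smaller tree shows which label advances.\<close>

lemma exists_tree_with_winners: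
  assumes "S \<subseteq> {0..}" "card S = Suc (length w)" "restricted S w"
  shows "\<exists>T :: nat ltree. ab_tree S T \<and> winners T (length w) = w"
  using assms
proof (induction w arbitrary: S)
  case Nil
  then obtain s where "S = {s}" using card_1_singletonE by auto
  then show ?case using exists_star_tree[of s] Nil by (auto simp: winners_def)
next
  case (Cons j w)
  have fin: "finite S" using Cons.prems(2) card.infinite by fastforce
  define t where "t = Max (S - set w)"
  define i where "i = Max (S - set (j # w))"
  define S' where "S' = S - {t}"
  have jS: "j \<in> S" and up: "\<And>s. s \<in> S \<Longrightarrow> j < s \<Longrightarrow> s \<in> set w" and rw: "restricted S' w"
    using restricted_Cons[OF fin, of w j] Cons.prems unfolding t_def S'_def by auto
  have tS: "t \<in> S - set w" unfolding t_def
    using exists_nonletter[OF fin, of w] Cons.prems(2) fin by (intro Max_in) auto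
  have iS: "i \<in> S - set (j # w)" unfolding i_def
    using exists_nonletter[OF fin, of "j # w"] Cons.prems(2) fin by (intro Max_in) auto
  have t_max: "s \<le> t" if "s \<in> S - set w" for s using that fin unfolding t_def by (intro Max_ge) auto
  have i_max: "s \<le> i" if "s \<in> S - set (j # w)" for s using that fin unfolding i_def by (intro Max_ge) auto
  have ij: "i < j" using iS up[of i] by (metis Diff_iff linorder_neqE list.set_intros)
  have pos: "0 \<le> i" using iS Cons.prems(1) by auto
  \<comment> \<open>s is the label of the leaf of the smaller tree that is replaced by the cherry of i and j\<close>
  define s where "s = (if j \<in> set w then j else i)"
  have t: "t = (if j \<in> set w then i else j)"
  proof (cases "j \<in> set w")
    case True
    then have "set (j # w) = set w" by auto
    then show ?thesis using True unfolding t_def i_def by simp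
  next
    case False
    then have "j \<le> t" using t_max jS by simp
    then show ?thesis using up[of t] tS False by force
  qed
  have st: "(s, t) = (i, j) \<or> (s, t) = (j, i)" unfolding s_def t by simp
  have sS': "s \<in> S'" using s_def t jS iS ij unfolding S'_def by auto
  have card': "card S' = Suc (length w)" using Cons.prems(2) tS unfolding S'_def by simp
  obtain T1 :: "nat ltree" where T1: "ab_tree S' T1" "winners T1 (length w) = w"
    using Cons.IH[of S'] Cons.prems(1) card' rw unfolding S'_def by blast
  have tri1: "trivalent_tree T1" using T1 by (simp add: ab_tree_def)
  note sg1 = trivalent_simple[OF tri1]
  obtain v where v: "v \<in> leaves T1" "lab T1 v = s" using leaf_with_label[OF T1(1) sS'] .
  obtain z where nbz: "nb T1 v = {z}" using leaf_nb[OF sg1 v(1)] .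
  then have vz: "adj T1 v u \<longleftrightarrow> u = z" for u by (metis in_nb_iff singleton_iff)
  define x where "x = Suc (Max (verts T1))"
  define y where "y = Suc x"
  have fresh: "x \<notin> verts T1" "y \<notin> verts T1" "x \<noteq> y"
    using Max_ge[OF trivalent_finite[OF tri1]] by (force simp: x_def y_def)+
  define T where "T = graft T1 x y v i j"
  have vz': "adj T1 v z" using vz by simp
  note g = graft_tree[OF tri1 v(1) vz' fresh, of i j, folded T_def]
  have abT: "ab_tree S T" unfolding T_def
    by (rule ab_tree_graft[OF T1(1) v(1) vz' v(2) fresh Cons.prems(1) S'_def])
      (use tS sS' st ij in \<open>auto simp: S'_def\<close>)
  have labT: "lab T x = i" "lab T y = j" "\<And>u. u \<in> leaves T1 \<Longrightarrow> lab T u = lab T1 u"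
    using fresh leaves_subset[of T1] unfolding T_def graft_def by auto
  have leafT: "u \<in> leaves T \<longleftrightarrow> u = x \<or> u = y \<or> (u \<in> leaves T1 \<and> u \<noteq> v)" for u
    unfolding g(2) by auto
  have adjT: "adj T p q \<longleftrightarrow> adj T1 p q" if "p \<in> leaves T1" "p \<noteq> v" for p q
  proof -
    have "p \<noteq> x" "p \<noteq> y" using that fresh leaves_subset[of T1] by auto
    then show ?thesis using that(2) by (auto simp: T_def graft_def adj_def doubleton_eq_iff)
  qed
  \<comment> \<open>the loser at another cherry is a or b, or it is bounded by the maximality of i\<close>
  have old: "lab T p < i" if c: "cherry T1 p q u" "lab T1 p < lab T1 q" "p \<noteq> v" "q \<noteq> v" for p q u
  proof (cases "lab T1 p \<in> S'")
    case False
    then show ?thesis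
      using lab_range[OF T1(1), of p] c(1) labT(3)[of p] pos unfolding cherry_def by auto
  next
    case True
    have pl: "p \<in> leaves T1" using c by (simp add: cherry_def)
    have ps: "lab T1 p \<noteq> s" using lab_inj[OF T1(1) pl v(1)] c(3) v(2) by auto
    have "card {lab T1 p, s} \<le> card S'"
      using True sS' fin by (intro card_mono) (auto simp: S'_def)
    then have big: "2 \<le> card S'" using ps by simp
    obtain x2 y2 v2 w2 where fm: "first_match S' T1 x2 y2 v2 w2"
      using exists_first_match[OF T1(1) big] .
    then have "lab T1 p \<le> lab T1 x2" using first_match.i_max c by metis
    also have "lab T1 x2 = Max (S' - set w)"
      using winners_restricted[OF T1(1) card'] fm T1(2) by metis
    also have "\<dots> \<in> S' - set w"
      using exists_nonletter[of S' w] fin card' unfolding S'_def by (intro Max_in) auto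
    then have "Max (S' - set w) \<le> i"
      using i_max t ij s_def unfolding S'_def by (auto split: if_splits)
    finally have "lab T1 p \<le> i" .
    moreover have "lab T1 p \<noteq> i" using True ps st unfolding S'_def by auto
    ultimately show ?thesis using labT(3)[OF pl] by simp
  qed
  have nbv: "nb T v = {x, y, z}" by (rule g(3))
  have triT: "trivalent_tree T" by (rule g(1))
  have "first_cherry T x y v"
    unfolding first_cherry_def
  proof (intro conjI allI impI)
    show "cherry T x y v" by (rule g(4))
    show "lab T x < lab T y" using labT ij by simp
    fix p q u assume *: "cherry T p q u \<and> lab T p < lab T q"
    then have c: "p \<in> leaves T" "q \<in> leaves T" "p \<noteq> q" "adj T p u" "adj T q u" by (auto simp: cherry_def)
    have only: "b = v" if "adj T x b \<or> adj T y b" for b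
      using that g(4) leaf_unique_nb[OF trivalent_simple[OF triT]] unfolding cherry_def by metis
    show "lab T p \<le> lab T x"
    proof (cases "p \<in> {x, y} \<or> q \<in> {x, y}")
      case True
      then have "u = v" using only c by blast
      then have "p \<in> nb T v" "q \<in> nb T v" using c adj_commute by (metis in_nb_iff)+
      then have "p \<in> {x, y}" "q \<in> {x, y}" using c g(5) unfolding nbv by auto
      then show ?thesis using * labT ij by auto
    next
      case False
      then have "p \<in> leaves T1" "p \<noteq> v" "q \<in> leaves T1" "q \<noteq> v" using c leafT by blast+
      moreover from this have "cherry T1 p q u" using c adjT by (simp add: cherry_def)
      ultimately show ?thesis using old[of p q u] * labT by simp
    qed
  qed
  then have "first_match S T x y v z"
    using abT nbv Cons.prems(2) by (simp add: first_match_def)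
  then interpret m: first_match S T x y v z .
  have c': "card m.S' = Suc (length w)" using m.card_S Cons.prems(2) by simp
  have W: "winners T (Suc (length w)) = j # winners m.T' (length w)"
    using m.winners_first[OF c'] labT by simp
  \<comment> \<open>with one round left, the advancing label may differ from s, but nothing remains to be played\<close>
  have "winners m.T' (length w) = w"
  proof (cases w)
    case (Cons l w')
    then have "2 \<le> card S'" using card' by simp
    then obtain x2 y2 v2 w2 where fm: "first_match S' T1 x2 y2 v2 w2"
      using exists_first_match[OF T1(1)] by blast
    interpret n: first_match S' T1 x2 y2 v2 w2 by (rule fm)
    have i2: "n.i = Max (S' - set w)"
      using winners_restricted[OF T1(1) card'] fm T1(2) by metis
    have "m.lazy \<longleftrightarrow> j \<notin> set w"
    proof (cases "j \<in> set w")
      case True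
      have "\<not> m.lazy"
      proof
        assume m.lazy
        then obtain u where u: "u \<in> leaves T" "adj T u z" "i < lab T u"
          unfolding m.lazy_def labT by blast
        have "u \<noteq> x" "u \<noteq> y" using u(2) m.adj_x m.adj_y m.w by auto
        then have u1: "u \<in> leaves T1" "u \<noteq> v" using u leafT by auto
        have lu: "lab T1 u \<noteq> s" using lab_inj[OF T1(1) u1(1) v(1)] u1 v(2) by auto
        have "cherry T1 u v z" using u1 v vz' u(2) adjT by (simp add: cherry_def)
        then have "lab T1 u \<le> n.i \<or> s \<le> n.i"
          using n.i_max cherry_commute[of T1 u v z] lu v(2) by (metis linorder_neqE)
        moreover have "n.i \<le> i"
        proof -
          have "n.i \<in> S' - set w" unfolding i2
            using exists_nonletter[of S' w] fin card' unfolding S'_def by (intro Max_in) auto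
          then show ?thesis using i_max True unfolding S'_def by auto
        qed
        ultimately show False using u(3) labT(3)[OF u1(1)] s_def True ij by auto
      qed
      then show ?thesis using True by simp
    next
      case False
      then have "S' - set w = S - set (j # w)" using t unfolding S'_def by auto
      then have "n.i = lab T1 v" using i2 v(2) False s_def unfolding i_def by simp
      then have "x2 = v" using lab_inj[OF T1(1) n.xy(1) v(1)] by simp
      then have "v2 = z" using n.xy(4) vz by simp
      then have y2: "adj T1 y2 z" "y2 \<in> leaves T1" "y2 \<noteq> v" "lab T1 v < lab T1 y2"
        using n.xy n.ij \<open>x2 = v\<close> by auto
      then have "y2 \<in> leaves T" "adj T y2 z" "i < lab T y2"
        using leafT adjT labT(3) v(2) False s_def by auto
      then have m.lazy unfolding m.lazy_def labT by blast
      then show ?thesis using False by simp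
    qed
    then have adv: "m.adv = s" and S': "m.S' = S'"
      unfolding labT s_def S'_def t by simp_all
    have "tree_map id id T1 m.T'"
      unfolding tree_map_def
    proof (intro conjI ballI)
      show "bij_betw id (verts T1) (verts m.T')" unfolding T_def g(6)[unfolded T_def] by simp
      show "edges m.T' = (\<lambda>e. id ` e) ` edges T1" unfolding T_def g(7)[unfolded T_def] by simp
      show "lab m.T' (id p) = id (lab T1 p)" if "p \<in> leaves T1" for p
        using that labT(3) adv v(2) by simp
    qed
    moreover have "ab_tree S' m.T'" using m.tree' by (simp only: S')
    ultimately have "winners m.T' (length w) = map id (winners T1 (length w))"
      by (intro winners_relabel[OF T1(1) card']) (auto simp: strict_mono_on_def)
    then show ?thesis using T1(2) by simp
  qed (simp add: winners_def)
  then show ?case using W abT by auto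
qed

section \<open>Dyck paths\<close>

lemma left_squares_single: "left_squares [a] = {}"
  by (auto simp: left_squares_def)

lemma left_squares_Cons:
  "s \<in> left_squares (a # b # p) \<longleftrightarrow>
    (s = a \<and> fst a = fst b \<and> snd a = Suc (snd b)) \<or> s \<in> left_squares (b # p)"
proof -
  have alt: "s \<in> left_squares q \<longleftrightarrow> (\<exists>t. Suc t < length q \<and> q ! t = s \<and>
      fst s = fst (q ! Suc t) \<and> snd s = Suc (snd (q ! Suc t)))" for q
    unfolding left_squares_def by (cases s) (auto simp: prod_eq_iff)
  have split: "(\<exists>t. R t) \<longleftrightarrow> R 0 \<or> (\<exists>t. R (Suc t))" for R :: "nat \<Rightarrow> bool"
    by (metis not0_implies_Suc)
  show ?thesis unfolding alt by (subst split) auto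
qed

lemma left_squares_right: "left_squares ((x, y) # (Suc x, y) # p) = left_squares ((Suc x, y) # p)"
  by (rule set_eqI) (simp add: left_squares_Cons)

lemma left_squares_down:
  "left_squares ((x, Suc y) # (x, y) # p) = insert (x, Suc y) (left_squares ((x, y) # p))"
  by (rule set_eqI) (simp add: left_squares_Cons)

lemma atLeastAtMost_Suc_image: "(\<lambda>y. (f y, y)) ` {1..Suc b} = insert (f (Suc b), Suc b) ((\<lambda>y. (f y, y)) ` {1..b})"
  by (simp add: atLeastAtMostSuc_conv)

text \<open>A Dyck path has one down step in each row, and down steps move right as they go down.\<close>

lemma path_left_squares:
  assumes "p \<noteq> []" "hd p = (a, b)" "last p = (n, 0)" "successively path_step p"
    "\<forall>(x, y) \<in> set p. n \<le> x + y"
  shows "a \<le> n \<and> (\<exists>f. left_squares p = (\<lambda>y. (f y, y)) ` {1..b} \<and>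
    (\<forall>y \<in> {1..b}. a \<le> f y \<and> f y \<le> n \<and> n < f y + y) \<and>
    (\<forall>y \<in> {1..b}. \<forall>y' \<in> {1..b}. y < y' \<longrightarrow> f y' \<le> f y))"
  using assms
proof (induction p arbitrary: a b rule: induct_list012)
  case (2 q)
  then show ?case by (auto simp: left_squares_single)
next
  case (3 q q' p)
  have st: "path_step (a, b) q'" and q: "q = (a, b)" using 3 by auto
  have prem: "last (q' # p) = (n, 0)" "successively path_step (q' # p)" "\<forall>(x, y) \<in> set (q' # p). n \<le> x + y"
    using 3 by auto
  from st consider "q' = (Suc a, b)" | b' where "b = Suc b'" "q' = (a, b')"
    by (cases q') (auto simp: path_step_def)
  then show ?case
  proof cases
    case 1
    from "3.IH"(2)[of "Suc a" b] prem 1 have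
      IH: "Suc a \<le> n \<and> (\<exists>f. left_squares (q' # p) = (\<lambda>y. (f y, y)) ` {1..b} \<and>
        (\<forall>y \<in> {1..b}. Suc a \<le> f y \<and> f y \<le> n \<and> n < f y + y) \<and>
        (\<forall>y \<in> {1..b}. \<forall>y' \<in> {1..b}. y < y' \<longrightarrow> f y' \<le> f y))" by simp
    then obtain f where f: "left_squares (q' # p) = (\<lambda>y. (f y, y)) ` {1..b}"
      "\<forall>y \<in> {1..b}. Suc a \<le> f y \<and> f y \<le> n \<and> n < f y + y"
      "\<forall>y \<in> {1..b}. \<forall>y' \<in> {1..b}. y < y' \<longrightarrow> f y' \<le> f y" by blast
    have "\<forall>y \<in> {1..b}. a \<le> f y \<and> f y \<le> n \<and> n < f y + y" using f(2) Suc_leD by blast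
    moreover have "left_squares (q # q' # p) = (\<lambda>y. (f y, y)) ` {1..b}"
      using f(1) left_squares_right unfolding q 1 by simp
    moreover have "a \<le> n" using IH by simp
    ultimately show ?thesis using f(3) by (intro conjI exI[of _ f])
  next
    case 2
    from "3.IH"(2)[of a b'] prem 2 have
      IH: "a \<le> n \<and> (\<exists>f. left_squares (q' # p) = (\<lambda>y. (f y, y)) ` {1..b'} \<and>
        (\<forall>y \<in> {1..b'}. a \<le> f y \<and> f y \<le> n \<and> n < f y + y) \<and>
        (\<forall>y \<in> {1..b'}. \<forall>y' \<in> {1..b'}. y < y' \<longrightarrow> f y' \<le> f y))" by simp
    then obtain f where f: "left_squares (q' # p) = (\<lambda>y. (f y, y)) ` {1..b'}"
      "\<forall>y \<in> {1..b'}. a \<le> f y \<and> f y \<le> n \<and> n < f y + y"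
      "\<forall>y \<in> {1..b'}. \<forall>y' \<in> {1..b'}. y < y' \<longrightarrow> f y' \<le> f y" by blast
    define g where "g = f(b := a)"
    have gf: "g y = f y" if "y \<in> {1..b'}" for y using that 2 by (auto simp: g_def)
    have gb: "g b = a" by (simp add: g_def)
    have "n \<le> a + b'" using prem(3) 2 by auto
    have "(\<lambda>y. (g y, y)) ` {1..b'} = (\<lambda>y. (f y, y)) ` {1..b'}" using gf by (intro image_cong) auto
    then have "left_squares (q # q' # p) = (\<lambda>y. (g y, y)) ` {1..b}"
      using f(1) gb unfolding q 2 left_squares_down atLeastAtMost_Suc_image by simp
    moreover have "a \<le> g y \<and> g y \<le> n \<and> n < g y + y" if "y \<in> {1..b}" for y
    proof (cases "y = b")
      case True
      then show ?thesis using IH \<open>n \<le> a + b'\<close> gb 2 by simp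
    next
      case False
      then have "y \<in> {1..b'}" using that 2 by auto
      then show ?thesis using f(2) gf by simp
    qed
    moreover have "g y' \<le> g y" if "y \<in> {1..b}" "y' \<in> {1..b}" "y < y'" for y y'
    proof (cases "y' = b")
      case True
      then have "y \<in> {1..b'}" using that 2 by auto
      then show ?thesis using f(2) gf gb True by simp
    next
      case False
      then have "y \<in> {1..b'}" "y' \<in> {1..b'}" using that 2 by auto
      then show ?thesis using f(3) gf that(3) by simp
    qed
    moreover have "a \<le> n" using IH by simp
    ultimately show ?thesis by (intro conjI exI[of _ g]) auto
  qed
qed simp

text \<open>The measure counts the remaining steps: each row costs more than the whole width.\<close>

lemma exists_path:
  fixes f :: "nat \<Rightarrow> nat"
  assumes "\<forall>y \<in> {1..b}. f y \<le> n \<and> n < f y + y"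
    "\<forall>y \<in> {1..b}. \<forall>y' \<in> {1..b}. y < y' \<longrightarrow> f y' \<le> f y"
    "n \<le> a + b" "a \<le> (if b = 0 then n else f b)"
  shows "\<exists>p. p \<noteq> [] \<and> hd p = (a, b) \<and> last p = (n, 0) \<and> successively path_step p \<and>
    (\<forall>(x, y) \<in> set p. n \<le> x + y) \<and> left_squares p = (\<lambda>y. (f y, y)) ` {1..b}"
  using assms
proof (induction "b * Suc n + ((if b = 0 then n else f b) - a)" arbitrary: a b rule: less_induct)
  case (less a b)
  let ?t = "if b = 0 then n else f b"
  consider "a < ?t" | "a = ?t" "b = 0" | b' where "a = ?t" "b = Suc b'"
  proof (cases "a < ?t")
    case False
    then have "a = ?t" using less.prems(4) by simp
    then show ?thesis using that(2,3) by (cases b) simp_all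
  qed (use that(1) in simp)
  then show ?case
  proof cases
    case 1
    then have "\<exists>p. p \<noteq> [] \<and> hd p = (Suc a, b) \<and> last p = (n, 0) \<and> successively path_step p \<and>
      (\<forall>(x, y) \<in> set p. n \<le> x + y) \<and> left_squares p = (\<lambda>y. (f y, y)) ` {1..b}"
      using less.prems by (intro less.hyps) auto
    then obtain p where p: "p \<noteq> []" "hd p = (Suc a, b)" "last p = (n, 0)" "successively path_step p"
      "\<forall>(x, y) \<in> set p. n \<le> x + y" "left_squares p = (\<lambda>y. (f y, y)) ` {1..b}" by blast
    then obtain p' where p': "p = (Suc a, b) # p'" by (cases p) auto
    have "path_step (a, b) (Suc a, b)" by (simp add: path_step_def)
    then show ?thesis using p less.prems(3) unfolding p'
      by (intro exI[of _ "(a, b) # (Suc a, b) # p'"]) (simp add: left_squares_right)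
  next
    case 2
    then show ?thesis by (intro exI[of _ "[(n, 0)]"]) (auto simp: left_squares_single)
  next
    case 3
    have "b \<in> {1..b}" using 3 by simp
    then have "f b \<le> n \<and> n < f b + b" using less.prems(1) by blast
    then have ab: "a = f b" "n < a + b" "a \<le> n" using 3 by simp_all
    have "a \<le> (if b' = 0 then n else f b')" using less.prems(2) ab 3 by auto
    then have "\<exists>p. p \<noteq> [] \<and> hd p = (a, b') \<and> last p = (n, 0) \<and> successively path_step p \<and>
      (\<forall>(x, y) \<in> set p. n \<le> x + y) \<and> left_squares p = (\<lambda>y. (f y, y)) ` {1..b'}"
    proof (intro less.hyps)
      have "(if b' = 0 then n else f b') \<le> n" using less.prems(1) 3 by auto
      then show "b' * Suc n + ((if b' = 0 then n else f b') - a) < b * Suc n + ((if b = 0 then n else f b) - a)"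
        using 3 by (simp add: less_Suc_eq_le le_diff_conv)
      show "n \<le> a + b'" using ab(2) 3 by simp
      show "\<forall>y \<in> {1..b'}. f y \<le> n \<and> n < f y + y"
        "\<forall>y \<in> {1..b'}. \<forall>y' \<in> {1..b'}. y < y' \<longrightarrow> f y' \<le> f y"
        using less.prems(1,2) 3 by simp_all
    qed
    then obtain p where p: "p \<noteq> []" "hd p = (a, b')" "last p = (n, 0)" "successively path_step p"
      "\<forall>(x, y) \<in> set p. n \<le> x + y" "left_squares p = (\<lambda>y. (f y, y)) ` {1..b'}" by blast
    then obtain p' where p': "p = (a, b') # p'" by (cases p) auto
    have "path_step (a, b) (a, b')" using 3 by (simp add: path_step_def)
    then show ?thesis using p less.prems(3) ab unfolding p' 3(2)
      by (intro exI[of _ "(a, Suc b') # (a, b') # p'"])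
        (simp add: left_squares_down atLeastAtMostSuc_conv)
  qed
qed

section \<open>Parking functions as words\<close>

text \<open>The labels of a parking function are met, from the bottom row to the top row, in the order of
  decreasing columns, and upwards in each column.\<close>

definition rank :: "nat \<Rightarrow> (nat \<Rightarrow> nat) \<Rightarrow> nat \<Rightarrow> nat" where
  "rank n w m = card {m' \<in> {1..n}. w m < w m' \<or> (w m' = w m \<and> m' \<le> m)}"

definition labeling_of :: "nat \<Rightarrow> (nat \<Rightarrow> nat) \<Rightarrow> labeling" where
  "labeling_of n w = (\<lambda>(x, y). if \<exists>m \<in> {1..n}. w m = x \<and> rank n w m = y
     then Some (THE m. m \<in> {1..n} \<and> w m = x \<and> rank n w m = y) else None)"

lemma rank_less:
  assumes "m \<in> {1..n}" "m' \<in> {1..n}" "w m' < w m \<or> (w m' = w m \<and> m < m')"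
  shows "rank n w m < rank n w m'"
  unfolding rank_def
proof (rule psubset_card_mono)
  show "{l \<in> {1..n}. w m < w l \<or> (w l = w m \<and> l \<le> m)} \<subset> {l \<in> {1..n}. w m' < w l \<or> (w l = w m' \<and> l \<le> m')}"
  proof (rule psubsetI)
    have "m' \<in> {l \<in> {1..n}. w m' < w l \<or> (w l = w m' \<and> l \<le> m')}"
      "m' \<notin> {l \<in> {1..n}. w m < w l \<or> (w l = w m \<and> l \<le> m)}" using assms by auto
    then show "{l \<in> {1..n}. w m < w l \<or> (w l = w m \<and> l \<le> m)} \<noteq> {l \<in> {1..n}. w m' < w l \<or> (w l = w m' \<and> l \<le> m')}"
      by blast
  qed (use assms in auto)
qed simp

lemma rank_inj: "inj_on (rank n w) {1..n}"
proof (rule inj_onI)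
  fix m m' assume m: "m \<in> {1..n}" "m' \<in> {1..n}" and eq: "rank n w m = rank n w m'"
  show "m = m'"
    using rank_less[OF m, of w] rank_less[OF m(2,1), of w] eq by (metis less_irrefl linorder_neqE_nat)
qed

lemma rank_le_iff:
  assumes "m \<in> {1..n}" "m' \<in> {1..n}"
  shows "rank n w m \<le> rank n w m' \<longleftrightarrow> w m' < w m \<or> (w m' = w m \<and> m \<le> m')"
proof (cases "m = m'")
  case False
  then show ?thesis
    using rank_less[OF assms, of w] rank_less[OF assms(2,1), of w]
    by (metis leD le_less less_le_not_le linorder_neqE_nat)
qed simp

lemma rank_bij: "bij_betw (rank n w) {1..n} {1..n}"
proof -
  have "rank n w m \<in> {1..n}" if "m \<in> {1..n}" for m
  proof -
    have "rank n w m \<le> card {1..n}" unfolding rank_def by (rule card_mono) auto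
    moreover have "card {m} \<le> rank n w m" unfolding rank_def by (rule card_mono) (use that in auto)
    ultimately show ?thesis by simp
  qed
  then have "rank n w ` {1..n} \<subseteq> {1..n}" by blast
  then have "rank n w ` {1..n} = {1..n}" using rank_inj by (intro endo_inj_surj) auto
  then show ?thesis using rank_inj by (simp add: bij_betw_def)
qed

lemma labeling_of_Some:
  "labeling_of n w (x, y) = Some m \<longleftrightarrow> m \<in> {1..n} \<and> w m = x \<and> rank n w m = y"
proof -
  have "(THE m. m \<in> {1..n} \<and> w m = x \<and> rank n w m = y) = m"
    if "m \<in> {1..n}" "w m = x" "rank n w m = y" for m
    by (rule the_equality) (use that rank_inj[of n w] in \<open>auto dest: inj_onD\<close>)
  then show ?thesis by (auto simp: labeling_of_def)
qed

lemma labeling_eqI: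
  fixes P Q :: labeling
  assumes "\<And>x y m. P (x, y) = Some m \<longleftrightarrow> Q (x, y) = Some m"
  shows "P = Q"
proof
  fix z :: "nat \<times> nat"
  show "P z = Q z" using assms[of "fst z" "snd z"] by (cases "P z"; cases "Q z") auto
qed

lemma in_column_labeling_of: "in_column (labeling_of n w) m j \<longleftrightarrow> m \<in> {1..n} \<and> w m = j"
  by (auto simp: in_column_def labeling_of_Some)

lemma column_of_labeling_of: "m \<in> {1..n} \<Longrightarrow> column_of (labeling_of n w) m = w m"
  by (auto simp: column_of_def in_column_labeling_of)

lemma row_of_labeling_of: "m \<in> {1..n} \<Longrightarrow> row_of (labeling_of n w) m = rank n w m"
  by (auto simp: row_of_def labeling_of_Some)

text \<open>A label of column \<open>x\<close> lies above all labels of the columns right of \<open>x\<close>; the bound on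
  the number of labels up to column \<open>x\<close> therefore puts it above the diagonal.\<close>

lemma labeling_of_in_PF:
  assumes range: "\<forall>m \<in> {1..n}. w m \<in> {1..n}"
    and dyck: "\<forall>x. card {m \<in> {1..n}. w m \<le> x} \<le> x"
  shows "labeling_of n w \<in> PF n"
proof -
  define g where "g = inv_into {1..n} (rank n w)"
  have g: "g y \<in> {1..n}" "rank n w (g y) = y" if "y \<in> {1..n}" for y
    using that rank_bij[of n w] unfolding g_def bij_betw_def
    by (metis inv_into_into, metis f_inv_into_f)
  have gr: "g (rank n w m) = m" if "m \<in> {1..n}" for m
    unfolding g_def using rank_inj that by (rule inv_into_f_f)
  define f where "f y = w (g y)" for y
  have dom: "dom (labeling_of n w) = (\<lambda>y. (f y, y)) ` {1..n}"
  proof -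
    have "(x, y) \<in> dom (labeling_of n w) \<longleftrightarrow> (x, y) \<in> (\<lambda>y. (f y, y)) ` {1..n}" for x y
    proof
      assume "(x, y) \<in> dom (labeling_of n w)"
      then obtain m where m: "m \<in> {1..n}" "w m = x" "rank n w m = y" by (auto simp: labeling_of_Some)
      then have "f y = x" using gr by (auto simp: f_def)
      moreover have "y \<in> {1..n}" using bij_betwE[OF rank_bij[of n w]] m by blast
      ultimately have "f y = x" "y \<in> {1..n}" .
      then show "(x, y) \<in> (\<lambda>y. (f y, y)) ` {1..n}" by blast
    next
      assume "(x, y) \<in> (\<lambda>y. (f y, y)) ` {1..n}"
      then have y: "y \<in> {1..n}" "x = w (g y)" by (auto simp: f_def)
      then have "labeling_of n w (x, y) = Some (g y)" using g by (simp add: labeling_of_Some)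
      then show "(x, y) \<in> dom (labeling_of n w)" by blast
    qed
    then have "z \<in> dom (labeling_of n w) \<longleftrightarrow> z \<in> (\<lambda>y. (f y, y)) ` {1..n}" for z
      by (cases z) (simp only:)
    then show ?thesis by (rule set_eqI)
  qed
  have f1: "f y \<le> n \<and> n < f y + y" if y: "y \<in> {1..n}" for y
  proof -
    let ?m = "g y"
    have m: "?m \<in> {1..n}" "rank n w ?m = y" using g[OF y] .
    have r: "w ?m \<in> {1..n}" using range m by blast
    let ?A = "{m \<in> {1..n}. w m \<le> w ?m}"
    have "card (insert ?m ({1..n} - ?A)) \<le> rank n w ?m"
      unfolding rank_def by (rule card_mono) (use m in auto)
    moreover have "card (insert ?m ({1..n} - ?A)) = Suc (n - card ?A)"
    proof -
      have "card ({1..n} - ?A) = n - card ?A" by (subst card_Diff_subset) auto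
      then show ?thesis using m by (subst card_insert_disjoint) auto
    qed
    moreover have "card ?A \<le> w ?m" using dyck by blast
    ultimately show ?thesis using r m unfolding f_def by auto
  qed
  have f2: "f y' \<le> f y" if "y \<in> {1..n}" "y' \<in> {1..n}" "y < y'" for y y'
  proof -
    have "rank n w (g y) \<le> rank n w (g y')" using g(2) that by simp
    then show ?thesis
      unfolding f_def rank_le_iff[OF g(1)[OF that(1)] g(1)[OF that(2)]] by auto
  qed
  have "\<exists>p. dyck_path n p \<and> dom (labeling_of n w) = left_squares p"
    using exists_path[of n f n 0] f1 f2 unfolding dyck_path_def dom by auto
  moreover have "inj_on (labeling_of n w) (dom (labeling_of n w))"
  proof (rule inj_onI)
    fix z z' assume "z \<in> dom (labeling_of n w)" and eq: "labeling_of n w z = labeling_of n w z'"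
    then obtain m where "labeling_of n w z = Some m" by blast
    then show "z = z'" using eq by (cases z; cases z') (simp add: labeling_of_Some)
  qed
  moreover have "ran (labeling_of n w) = {1..n}"
    by (auto simp: ran_def labeling_of_Some)
  moreover have "m < m'" if "labeling_of n w (x, y) = Some m" "labeling_of n w (x, y') = Some m'" "y < y'"
    for x y y' m m'
    using that rank_le_iff[of m' n m w] by (auto simp: labeling_of_Some)
  ultimately show ?thesis unfolding PF_def by blast
qed


text \<open>Rows are filled once each, from right to left going up, and columns increase upwards; so the row
  of a label is its position in the order that defines \<open>rank\<close>.\<close>

lemma PF_eq_labeling_of:
  assumes P: "P \<in> PF n" and w: "\<forall>j \<in> {1..n}. \<forall>m \<in> {1..n}. in_column P m j \<longleftrightarrow> w m = j"
  shows "P = labeling_of n w" "\<forall>m \<in> {1..n}. w m \<in> {1..n}"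
proof -
  obtain p where p: "dyck_path n p" "dom P = left_squares p" using P by (auto simp: PF_def)
  have "p \<noteq> []" "hd p = (0, n)" "last p = (n, 0)" "successively path_step p"
    "\<forall>(x, y) \<in> set p. n \<le> x + y" using p(1) by (auto simp: dyck_path_def)
  from path_left_squares[OF this] obtain f where f: "left_squares p = (\<lambda>y. (f y, y)) ` {1..n}"
      "\<forall>y \<in> {1..n}. f y \<le> n \<and> n < f y + y"
      "\<forall>y \<in> {1..n}. \<forall>y' \<in> {1..n}. y < y' \<longrightarrow> f y' \<le> f y"
    by auto
  have inj: "inj_on P (dom P)" and ran: "ran P = {1..n}"
    and up: "\<And>x y y' m m'. P (x, y) = Some m \<Longrightarrow> P (x, y') = Some m' \<Longrightarrow> y < y' \<Longrightarrow> m < m'"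
    using P unfolding PF_def by blast+
  have sq: "x = f y \<and> y \<in> {1..n} \<and> m \<in> {1..n} \<and> x \<in> {1..n} \<and> w m = x" if "P (x, y) = Some m" for x y m
  proof -
    have "(x, y) \<in> (\<lambda>y. (f y, y)) ` {1..n}" using that p(2) f(1) by blast
    then have 1: "x = f y" "y \<in> {1..n}" by auto
    have "f y \<le> n \<and> n < f y + y" using f(2) 1 by blast
    then have x: "x \<in> {1..n}" using 1 by simp
    have m: "m \<in> {1..n}" using that ran by (metis ranI)
    have "in_column P m x" using that by (auto simp: in_column_def)
    then have "w m = x" using w x m by metis
    then show ?thesis using 1 x m by (intro conjI)
  qed
  have row: "\<exists>y. P (w m, y) = Some m" if m: "m \<in> {1..n}" for m
  proof -
    have "m \<in> ran P" using m ran by simp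
    then obtain x y where z: "P (x, y) = Some m" by (auto simp: ran_def)
    then have "w m = x" using sq by blast
    then show ?thesis using z by blast
  qed
  define r where "r m = (SOME y. P (w m, y) = Some m)" for m
  have r: "P (w m, r m) = Some m" if "m \<in> {1..n}" for m
    unfolding r_def using row[OF that] by (rule someI_ex)
  have rf: "w m = f (r m)" "r m \<in> {1..n}" "w m \<in> {1..n}" if "m \<in> {1..n}" for m
    using sq[OF r[OF that]] by simp_all
  have r_bij: "bij_betw r {1..n} {1..n}"
  proof -
    have "inj_on r {1..n}"
    proof (rule inj_onI)
      fix m m' assume m: "m \<in> {1..n}" "m' \<in> {1..n}" "r m = r m'"
      then have "w m = w m'" using rf(1)[OF m(1)] rf(1)[OF m(2)] by simp
      then have "Some m = Some m'" using r[OF m(1)] r[OF m(2)] m(3) by metis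
      then show "m = m'" by simp
    qed
    moreover have "r ` {1..n} \<subseteq> {1..n}" using rf(2) by (rule image_subsetI)
    ultimately show ?thesis unfolding bij_betw_def by (simp add: endo_inj_surj)
  qed
  have before: "w m < w m' \<or> (w m' = w m \<and> m' \<le> m) \<longleftrightarrow> r m' \<le> r m"
    if m: "m \<in> {1..n}" "m' \<in> {1..n}" for m m'
  proof (cases "r m' < r m")
    case True
    then have "w m \<le> w m'" using rf[OF m(1)] rf[OF m(2)] f(3) by metis
    moreover have "m' \<le> m" if "w m' = w m"
      using up[of "w m" "r m'" m' "r m" m] r[OF m(1)] r[OF m(2)] True that by simp
    ultimately show ?thesis using True by auto
  next
    case False
    show ?thesis
    proof (cases "r m' = r m")
      case True
      then have "m = m'" using m r_bij by (auto simp: bij_betw_def dest: inj_onD)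
      then show ?thesis by simp
    next
      case ne: False
      then have lt: "r m < r m'" using False by simp
      then have "w m' \<le> w m" using rf[OF m(1)] rf[OF m(2)] f(3) by metis
      moreover have "m < m'" if "w m' = w m"
        using up[of "w m" "r m" m "r m'" m'] r[OF m(1)] r[OF m(2)] lt that by simp
      ultimately show ?thesis using lt by auto
    qed
  qed
  have rank: "rank n w m = r m" if m: "m \<in> {1..n}" for m
  proof -
    have rm: "r m \<in> {1..n}" using m r_bij by (auto simp: bij_betw_def)
    let ?A = "{m' \<in> {1..n}. r m' \<in> {1..r m}}"
    have before': "{m' \<in> {1..n}. w m < w m' \<or> (w m' = w m \<and> m' \<le> m)} = ?A"
      using before[OF m] rf(2) by auto
    have "r ` ?A = {1..r m}"
    proof
      show "{1..r m} \<subseteq> r ` ?A"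
      proof
        fix y assume y: "y \<in> {1..r m}"
        then have "y \<in> r ` {1..n}" using r_bij rm by (auto simp: bij_betw_def)
        then show "y \<in> r ` ?A" using y by (auto simp: image_iff)
      qed
    qed auto
    moreover have "card (r ` ?A) = card ?A"
      by (rule card_image, rule inj_on_subset[OF bij_betw_imp_inj_on[OF r_bij]]) auto
    ultimately have "rank n w m = card {1..r m}"
      unfolding rank_def before' by simp
    then show ?thesis by simp
  qed
  show "P = labeling_of n w"
  proof (rule labeling_eqI)
    fix x y m
    show "P (x, y) = Some m \<longleftrightarrow> labeling_of n w (x, y) = Some m"
    proof
      assume eq: "P (x, y) = Some m"
      from sq[OF this] have m: "m \<in> {1..n}" "w m = x" by simp_all
      have "P (x, y) = P (w m, r m)" using eq r[OF m(1)] by simp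
      moreover have "(x, y) \<in> dom P" "(w m, r m) \<in> dom P" using eq r[OF m(1)] by auto
      ultimately have "(x, y) = (w m, r m)" using inj by (meson inj_onD)
      then show "labeling_of n w (x, y) = Some m" using m rank by (simp add: labeling_of_Some)
    next
      assume "labeling_of n w (x, y) = Some m"
      then show "P (x, y) = Some m" using r rank by (auto simp: labeling_of_Some)
    qed
  qed
  show "\<forall>m \<in> {1..n}. w m \<in> {1..n}" using rf(3) by blast
qed

definition skip :: "nat \<Rightarrow> nat \<Rightarrow> nat" where
  "skip a c = (if a < c then c - 1 else c)"

text \<open>Deleting the row of 1 and deleting an empty column both preserve the order that defines
  \<open>rank\<close>, so the result again comes from a word.\<close>

lemma r_map_labeling_of:
  assumes n: "1 \<le> n" and a: "a = Max {j \<in> {1..n}. \<forall>m \<in> {2..n}. w m \<noteq> j}"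
  shows "r_map n (labeling_of n w) = labeling_of (n - 1) (\<lambda>m. skip a (w (Suc m)))"
proof -
  define w' where "w' m = w (Suc m)" for m
  define b where "b = rank n w 1"
  have b: "b = row_of (labeling_of n w) 1" unfolding b_def using n by (simp add: row_of_labeling_of)
  define Q where "Q = map_option (\<lambda>m. m - 1) \<circ> delete_row b (labeling_of n w)"
  have rank': "rank n w (Suc m) = rank (n - 1) w' m + (if b < rank n w (Suc m) then 1 else 0)"
    and rank_ne: "rank n w (Suc m) \<noteq> b" if m: "m \<in> {1..n - 1}" for m
  proof -
    have m': "Suc m \<in> {1..n}" "1 \<in> {1..n}" using m by auto
    show ne: "rank n w (Suc m) \<noteq> b" unfolding b_def using inj_onD[OF rank_inj _ m'] m by auto
    let ?R = "\<lambda>l. w (Suc m) < w l \<or> (w l = w (Suc m) \<and> l \<le> Suc m)"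
    have "{l \<in> {1..n}. ?R l} = Suc ` {l \<in> {1..n - 1}. ?R (Suc l)} \<union> {l \<in> {1}. ?R l}"
    proof -
      have "l \<in> Suc ` {l \<in> {1..n - 1}. ?R (Suc l)} \<union> {l \<in> {1}. ?R l}" if "l \<in> {1..n}" "?R l" for l
      proof (cases "l = 1")
        case False
        then have "l = Suc (l - 1)" "l - 1 \<in> {1..n - 1}" using that by auto
        then show ?thesis using that(2) by (metis (mono_tags, lifting) UnI1 image_eqI mem_Collect_eq)
      qed (use that in simp)
      moreover have "Suc l \<in> {1..n}" if "l \<in> {1..n - 1}" for l using that by auto
      ultimately show ?thesis using n by auto
    qed
    then have "rank n w (Suc m) = card (Suc ` {l \<in> {1..n - 1}. ?R (Suc l)} \<union> {l \<in> {1}. ?R l})"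
      unfolding rank_def by simp
    also have "\<dots> = card (Suc ` {l \<in> {1..n - 1}. ?R (Suc l)}) + card {l \<in> {1}. ?R l}"
      by (rule card_Un_disjoint) auto
    also have "card (Suc ` {l \<in> {1..n - 1}. ?R (Suc l)}) = rank (n - 1) w' m"
      unfolding rank_def w'_def by (subst card_image) auto
    also have "card {l \<in> {1}. ?R l} = (if ?R 1 then 1 else 0)"
    proof -
      have "{l \<in> {1}. ?R l} = (if ?R 1 then {1} else {})" by auto
      then show ?thesis by simp
    qed
    also have "?R 1 \<longleftrightarrow> b < rank n w (Suc m)"
      using rank_le_iff[OF m'(2,1), of w] ne unfolding b_def by auto
    finally show "rank n w (Suc m) = rank (n - 1) w' m + (if b < rank n w (Suc m) then 1 else 0)" .
  qed
  have Q: "Q = labeling_of (n - 1) w'"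
  proof (rule labeling_eqI)
    fix x y m
    have "Q (x, y) = Some m \<longleftrightarrow> (\<exists>l. labeling_of n w (x, if y < b then y else Suc y) = Some l \<and> m = l - 1)"
      by (auto simp: Q_def delete_row_def)
    also have "\<dots> \<longleftrightarrow> (\<exists>l \<in> {1..n}. w l = x \<and> rank n w l = (if y < b then y else Suc y) \<and> m = l - 1)"
      by (auto simp: labeling_of_Some)
    also have "\<dots> \<longleftrightarrow> m \<in> {1..n - 1} \<and> w' m = x \<and> rank n w (Suc m) = (if y < b then y else Suc y)"
    proof
      assume "\<exists>l \<in> {1..n}. w l = x \<and> rank n w l = (if y < b then y else Suc y) \<and> m = l - 1"
      then obtain l where l: "l \<in> {1..n}" "w l = x" "rank n w l = (if y < b then y else Suc y)" "m = l - 1"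
        by blast
      have "l \<noteq> 1" using l(3) b_def by (auto split: if_splits)
      then have "l = Suc m" "m \<in> {1..n - 1}" using l by auto
      then show "m \<in> {1..n - 1} \<and> w' m = x \<and> rank n w (Suc m) = (if y < b then y else Suc y)"
        using l w'_def by simp
    next
      assume m: "m \<in> {1..n - 1} \<and> w' m = x \<and> rank n w (Suc m) = (if y < b then y else Suc y)"
      then have "Suc m \<in> {1..n}" by auto
      then show "\<exists>l \<in> {1..n}. w l = x \<and> rank n w l = (if y < b then y else Suc y) \<and> m = l - 1"
        using m w'_def by (intro bexI[of _ "Suc m"]) auto
    qed
    also have "\<dots> \<longleftrightarrow> m \<in> {1..n - 1} \<and> w' m = x \<and> rank (n - 1) w' m = y"
      using rank'[of m] rank_ne[of m] by (auto split: if_splits)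
    finally show "Q (x, y) = Some m \<longleftrightarrow> labeling_of (n - 1) w' (x, y) = Some m"
      by (simp add: labeling_of_Some)
  qed
  have "(\<forall>m. \<not> in_column Q m j) \<longleftrightarrow> (\<forall>m \<in> {2..n}. w m \<noteq> j)" for j
  proof -
    have "(\<forall>m. \<not> in_column Q m j) \<longleftrightarrow> (\<forall>m \<in> {1..n - 1}. w (Suc m) \<noteq> j)"
      unfolding Q in_column_labeling_of w'_def by blast
    also have "\<dots> \<longleftrightarrow> (\<forall>m \<in> Suc ` {1..n - 1}. w m \<noteq> j)" by blast
    also have "Suc ` {1..n - 1} = {2..n}" using n by (simp add: numeral_2_eq_2)
    finally show ?thesis .
  qed
  then have rec: "rightmost_empty_column n Q = a" unfolding rightmost_empty_column_def a by simp
  have "a \<in> {j \<in> {1..n}. \<forall>m \<in> {2..n}. w m \<noteq> j}"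
    unfolding a
  proof (rule Max_in)
    have "card (w ` {2..n}) \<le> card {2..n}" by (rule card_image_le) simp
    also have "\<dots> < card {1..n}" using n by simp
    finally have "\<not> {1..n} \<subseteq> w ` {2..n}" by (meson card_mono finite_atLeastAtMost finite_imageI leD)
    then show "{j \<in> {1..n}. \<forall>m \<in> {2..n}. w m \<noteq> j} \<noteq> {}" by blast
  qed simp
  then have wa: "w' m \<noteq> a" if "m \<in> {1..n - 1}" for m using that unfolding w'_def by auto
  have skip: "skip a (w' m) < skip a (w' l) \<longleftrightarrow> w' m < w' l" "skip a (w' m) = skip a (w' l) \<longleftrightarrow> w' m = w' l"
    if "m \<in> {1..n - 1}" "l \<in> {1..n - 1}" for m l
    using wa[OF that(1)] wa[OF that(2)] by (auto simp: skip_def)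
  have "rank (n - 1) (\<lambda>m. skip a (w' m)) m = rank (n - 1) w' m" if "m \<in> {1..n - 1}" for m
    unfolding rank_def by (rule arg_cong[where f = card]) (use skip that in auto)
  then have "delete_column a Q = labeling_of (n - 1) (\<lambda>m. skip a (w' m))"
    unfolding Q using wa
    by (intro labeling_eqI) (auto simp: delete_column_def labeling_of_Some skip_def split: if_splits)
  then show ?thesis
    unfolding r_map_def Let_def b[symmetric] Q_def[symmetric] rec w'_def by simp
qed

section \<open>Column-restricted parking functions as words\<close>

text \<open>This is the Dyck condition, which is thus implied by the restriction on the columns.  In the
  induction the removed column \<open>t\<close> is at most the first letter \<open>j\<close>, so the bound drops by one
  whenever the count can.\<close>

lemma restricted_few_small_letters:
  assumes "finite S" "card S = Suc (length u)" "restricted S u" "\<exists>s \<in> S. s \<le> b"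
  shows "length (filter (\<lambda>l. l \<le> b) u) < card {s \<in> S. s \<le> b}"
  using assms
proof (induction u arbitrary: S)
  case Nil
  then show ?case by (auto simp: card_gt_0_iff)
next
  case (Cons j u)
  define t where "t = Max (S - set u)"
  have j: "j \<in> S" and up: "\<And>s. s \<in> S \<Longrightarrow> j < s \<Longrightarrow> s \<in> set u" and r: "restricted (S - {t}) u"
    using restricted_Cons[of S u j] Cons.prems unfolding t_def by auto
  have t: "t \<in> S" "t \<notin> set u"
    using Max_in[of "S - set u"] exists_nonletter[of S u] Cons.prems unfolding t_def by auto
  have tj: "t \<le> j" using up t by force
  have fin: "finite (S - {t})" and c: "card (S - {t}) = Suc (length u)" using Cons.prems t by auto
  show ?case
  proof (cases "\<exists>s \<in> S - {t}. s \<le> b")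
    case True
    note IH = Cons.IH[OF fin c r True]
    show ?thesis
    proof (cases "t \<le> b")
      case le: True
      then have "{s \<in> S. s \<le> b} = insert t {s \<in> S - {t}. s \<le> b}" using t by auto
      then have "card {s \<in> S. s \<le> b} = Suc (card {s \<in> S - {t}. s \<le> b})" using fin by simp
      then show ?thesis using IH by simp
    next
      case False
      then have "{s \<in> S. s \<le> b} = {s \<in> S - {t}. s \<le> b}" by auto
      then show ?thesis using IH False tj by simp
    qed
  next
    case False
    \<comment> \<open>then t is the only small element, and it is not a letter\<close>
    have "j \<noteq> t"
    proof
      assume "j = t"
      obtain i where i: "i \<in> S - {t}" "i \<notin> set u"
        using exists_nonletter[OF fin, of u] c by auto
      have "t \<le> b" using False Cons.prems(4) by (metis DiffI singletonD)
      moreover have "b < i" using False i(1) by (meson not_le)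
      ultimately have "j < i" using \<open>j = t\<close> by simp
      then show False using up[of i] i by simp
    qed
    moreover have "set u \<subseteq> S - {t}" using r by (simp add: restricted_def)
    ultimately have "filter (\<lambda>l. l \<le> b) (j # u) = []" using False j by (auto simp: filter_empty_conv)
    moreover have "{s \<in> S. s \<le> b} \<noteq> {}" using Cons.prems(4) by blast
    ultimately show ?thesis using Cons.prems(1) by (simp add: card_gt_0_iff)
  qed
qed

text \<open>The preceding bound for b = 0 leaves no room for the letter 0, which stands for c.\<close>

lemma restricted_positive:
  assumes "restricted {0..int n} u" "length u = n"
  shows "set u \<subseteq> {1..int n}"
proof -
  have "{s \<in> {0..int n}. s \<le> 0} = {0}" by auto
  moreover have "\<exists>s \<in> {0..int n}. s \<le> 0" by (rule bexI[of _ 0]) auto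
  then have "length (filter (\<lambda>l. l \<le> 0) u) < card {s \<in> {0..int n}. s \<le> 0}"
    by (intro restricted_few_small_letters) (use assms in auto)
  ultimately have "length (filter (\<lambda>l. l \<le> 0) u) < 1" by simp
  then have "filter (\<lambda>l. l \<le> 0) u = []" by simp
  then show ?thesis using assms by (force simp: filter_empty_conv restricted_def)
qed

lemma in_set_drop_iff: "a \<in> set (drop m xs) \<longleftrightarrow> (\<exists>x. m \<le> x \<and> x < length xs \<and> xs ! x = a)"
proof
  assume "a \<in> set (drop m xs)"
  then obtain x where "x < length xs - m" "xs ! (m + x) = a" by (auto simp: in_set_conv_nth)
  then show "\<exists>x. m \<le> x \<and> x < length xs \<and> xs ! x = a" by (intro exI[of _ "m + x"]) auto
next
  assume "\<exists>x. m \<le> x \<and> x < length xs \<and> xs ! x = a"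
  then obtain x where "m \<le> x" "x < length xs" "xs ! x = a" by blast
  then show "a \<in> set (drop m xs)" unfolding in_set_conv_nth by (intro exI[of _ "x - m"]) auto
qed

definition words :: "nat list \<Rightarrow> int list set" where
  "words k = {u. length u = length k \<and> restricted {0..int (length k)} u \<and>
     (\<forall>l \<in> {1..length k}. count_list u (int l) = k ! (l - 1))}"

definition park :: "int list \<Rightarrow> labeling" where
  "park u = labeling_of (length u) (\<lambda>m. nat (u ! (m - 1)))"

lemma labeling_of_cong:
  assumes "\<And>m. m \<in> {1..n} \<Longrightarrow> w m = w' m"
  shows "labeling_of n w = labeling_of n w'"
proof -
  have "rank n w m = rank n w' m" if "m \<in> {1..n}" for m
    unfolding rank_def by (rule arg_cong[where f = card]) (use assms that in auto)
  then show ?thesis using assms by (intro labeling_eqI) (auto simp: labeling_of_Some)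
qed

lemma card_shift: "card {m \<in> {1..n}. Q m} = card {x. x < n \<and> Q (Suc x)}"
proof -
  have "{m \<in> {1..n}. Q m} = Suc ` {x. x < n \<and> Q (Suc x)}"
    by (auto simp: image_iff) (metis Suc_le_D Suc_le_lessD)
  then show ?thesis by (simp add: card_image)
qed

lemma count_list_card: "count_list u a = card {x. x < length u \<and> u ! x = a}"
  unfolding count_list_eq_length_filter length_filter_conv_card by (rule arg_cong[where f = card]) auto

lemma column_restricted_park:
  assumes u: "set u \<subseteq> {1..int n}" "length u = n"
  shows "column_restricted n (park u) \<longleftrightarrow> restricted {0..int n} u"
proof -
  have pos: "u ! x \<in> {1..int n}" if "x < n" for x using that u nth_mem by blast
  have "dominance_index n (park u) (Suc x) = card {s \<in> {0..int n}. u ! x < s \<and> s \<notin> set (drop (Suc x) u)}"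
    if x: "x < n" for x
  proof -
    have col: "column_of (park u) (Suc x) = nat (u ! x)"
      unfolding park_def using x u(2) by (subst column_of_labeling_of) auto
    have later: "(\<forall>m. in_column (park u) m j \<longrightarrow> \<not> Suc x < m) \<longleftrightarrow> int j \<notin> set (drop (Suc x) u)" for j
    proof -
      have "(\<forall>m. in_column (park u) m j \<longrightarrow> \<not> Suc x < m) \<longleftrightarrow> (\<forall>m. Suc x \<le> m \<and> m < n \<longrightarrow> u ! m \<noteq> int j)"
      proof (intro iffI allI impI notI)
        fix m assume *: "\<forall>m. in_column (park u) m j \<longrightarrow> \<not> Suc x < m" and m: "Suc x \<le> m \<and> m < n" "u ! m = int j"
        then have "in_column (park u) (Suc m) j"
          unfolding park_def in_column_labeling_of using u(2) by simp
        then show False using * m by auto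
      next
        fix m assume *: "\<forall>m. Suc x \<le> m \<and> m < n \<longrightarrow> u ! m \<noteq> int j"
          and m: "in_column (park u) m j" "Suc x < m"
        then have "m \<in> {1..n}" "nat (u ! (m - 1)) = j"
          unfolding park_def in_column_labeling_of using u(2) by simp_all
        moreover from this have "m - 1 < n" by auto
        ultimately have "u ! (m - 1) = int j" "m - 1 < n" using pos[of "m - 1"] by (auto simp: nat_eq_iff)
        moreover have "Suc x \<le> m - 1" using m(2) by simp
        ultimately show False using * by blast
      qed
      also have "\<dots> \<longleftrightarrow> int j \<notin> set (drop (Suc x) u)"
        using u(2) by (auto simp: in_set_drop_iff)
      finally show ?thesis .
    qed
    have "{s \<in> {0..int n}. u ! x < s \<and> s \<notin> set (drop (Suc x) u)}
        = int ` {j \<in> {nat (u ! x)<..n}. int j \<notin> set (drop (Suc x) u)}"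
    proof (rule set_eqI)
      fix s
      show "s \<in> {s \<in> {0..int n}. u ! x < s \<and> s \<notin> set (drop (Suc x) u)} \<longleftrightarrow>
        s \<in> int ` {j \<in> {nat (u ! x)<..n}. int j \<notin> set (drop (Suc x) u)}"
        using pos[OF x] by (cases s) (auto simp: image_iff)
    qed
    then show ?thesis
      unfolding dominance_index_def col later by (simp add: card_image)
  qed
  then have "column_restricted n (park u) \<longleftrightarrow>
      (\<forall>x < n. card {s \<in> {0..int n}. u ! x < s \<and> s \<notin> set (drop (Suc x) u)} \<le> x)"
    unfolding column_restricted_def image_Suc_lessThan[symmetric] by (simp add: less_Suc_eq_le) (simp add: Ball_def)
  then show ?thesis using u unfolding restricted_def by auto
qed

lemma content_park:
  assumes u: "set u \<subseteq> {1..int n}" "length u = n"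
  shows "card {m. in_column (park u) m l} = count_list u (int l)"
proof -
  have "{m. in_column (park u) m l} = {m \<in> {1..n}. nat (u ! (m - 1)) = l}"
    unfolding park_def in_column_labeling_of using u by auto
  then have "card {m. in_column (park u) m l} = card {x. x < n \<and> nat (u ! x) = l}"
    using card_shift[of n "\<lambda>m. nat (u ! (m - 1)) = l"] by simp
  also have "{x. x < n \<and> nat (u ! x) = l} = {x. x < length u \<and> u ! x = int l}"
  proof -
    have "nat (u ! x) = l \<longleftrightarrow> u ! x = int l" if "x < n" for x
    proof -
      have "u ! x \<in> {1..int n}" using that u nth_mem by blast
      then show ?thesis by (auto simp: nat_eq_iff)
    qed
    then show ?thesis using u(2) by auto
  qed
  finally show ?thesis by (simp add: count_list_card)
qed

lemma park_in_PF:
  assumes u: "restricted {0..int n} u" "length u = n"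
  shows "park u \<in> PF n"
proof -
  note sub = restricted_positive[OF u]
  have pos: "u ! x \<in> {1..int n}" if "x < n" for x using that u(2) sub nth_mem by blast
  have "card {m \<in> {1..n}. nat (u ! (m - 1)) \<le> x} \<le> x" for x
  proof (cases "x \<le> n")
    case True
    have "card {m \<in> {1..n}. nat (u ! (m - 1)) \<le> x} = card {y. y < n \<and> nat (u ! y) \<le> x}"
      using card_shift[of n "\<lambda>m. nat (u ! (m - 1)) \<le> x"] by simp
    also have "{y. y < n \<and> nat (u ! y) \<le> x} = {y. y < length u \<and> u ! y \<le> int x}" using u(2) by auto
    also have "card \<dots> = length (filter (\<lambda>l. l \<le> int x) u)" by (simp add: length_filter_conv_card)
    also have "\<dots> < card {s \<in> {0..int n}. s \<le> int x}"
      by (rule restricted_few_small_letters) (use u in auto)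
    also have "{s \<in> {0..int n}. s \<le> int x} = {0..int x}" using True by auto
    finally show ?thesis by simp
  next
    case False
    have "card {m \<in> {1..n}. nat (u ! (m - 1)) \<le> x} \<le> card {1..n}" by (rule card_mono) auto
    then show ?thesis using False by simp
  qed
  moreover have "nat (u ! (m - 1)) \<in> {1..n}" if "m \<in> {1..n}" for m
  proof -
    have "m - 1 < n" using that by auto
    from pos[OF this] show ?thesis by (simp add: le_nat_iff nat_le_iff)
  qed
  ultimately show ?thesis unfolding park_def u(2) by (intro labeling_of_in_PF) auto
qed

lemma PF_column:
  assumes P: "P \<in> PF n" and m: "m \<in> {1..n}"
  shows "in_column P m j \<longleftrightarrow> column_of P m = j"
proof -
  have "m \<in> ran P" and inj: "inj_on P (dom P)" using P m by (auto simp: PF_def)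
  then obtain x y where z: "P (x, y) = Some m" by (auto simp: ran_def)
  have "in_column P m j \<longleftrightarrow> j = x" for j
  proof
    assume "in_column P m j"
    then obtain y' where y': "P (j, y') = Some m" by (auto simp: in_column_def)
    have "(j, y') = (x, y)" by (rule inj_onD[OF inj]) (use z y' in auto)
    then show "j = x" by simp
  qed (use z in \<open>auto simp: in_column_def\<close>)
  then show ?thesis by (auto simp: column_of_def)
qed

lemma CPF_eq_park: "CPF k = park ` words k"
proof
  let ?n = "length k"
  show "park ` words k \<subseteq> CPF k"
  proof
    fix P assume "P \<in> park ` words k"
    then obtain u where u: "P = park u" "length u = ?n" "restricted {0..int ?n} u"
      "\<forall>l \<in> {1..?n}. count_list u (int l) = k ! (l - 1)" by (auto simp: words_def)
    note sub = restricted_positive[OF u(3,2)]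
    show "P \<in> CPF k"
      unfolding CPF_def u(1)
      using park_in_PF[OF u(3,2)] column_restricted_park[OF sub u(2)] content_park[OF sub u(2)] u by simp
  qed
  show "CPF k \<subseteq> park ` words k"
  proof
    fix P assume P: "P \<in> CPF k"
    then have PF: "P \<in> PF ?n" by (simp add: CPF_def)
    have "\<forall>j \<in> {1..?n}. \<forall>m \<in> {1..?n}. in_column P m j \<longleftrightarrow> column_of P m = j"
      using PF_column[OF PF] by blast
    note L = PF_eq_labeling_of[OF PF this]
    define u where "u = map (\<lambda>x. int (column_of P (Suc x))) [0..<?n]"
    have len: "length u = ?n" by (simp add: u_def)
    have "P = park u"
      unfolding park_def len by (subst L(1), rule labeling_of_cong) (auto simp: u_def)
    moreover have sub: "set u \<subseteq> {1..int ?n}" using L(2) by (auto simp: u_def)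
    moreover have "restricted {0..int ?n} u"
      using P column_restricted_park[OF sub len] \<open>P = park u\<close> by (simp add: CPF_def)
    moreover have "\<forall>l \<in> {1..?n}. count_list u (int l) = k ! (l - 1)"
      using P content_park[OF sub len] \<open>P = park u\<close> by (simp add: CPF_def)
    ultimately show "P \<in> park ` words k" using len by (auto simp: words_def)
  qed
qed

lemma park_inj: "inj_on park (words k)"
proof (rule inj_onI)
  let ?n = "length k"
  fix u u' assume "u \<in> words k" "u' \<in> words k" and eq: "park u = park u'"
  then have u: "length u = ?n" "restricted {0..int ?n} u" and u': "length u' = ?n" "restricted {0..int ?n} u'"
    by (auto simp: words_def)
  show "u = u'"
  proof (rule nth_equalityI)
    fix x assume "x < length u"
    then have x: "x < ?n" using u by simp
    have "in_column (park u) (Suc x) (nat (u ! x))" "in_column (park u') (Suc x) (nat (u' ! x))"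
      unfolding park_def in_column_labeling_of using x u u' by auto
    then have "nat (u ! x) = nat (u' ! x)" unfolding eq unfolding park_def in_column_labeling_of by simp
    moreover have "u ! x \<in> {1..int ?n}" "u' ! x \<in> {1..int ?n}"
      using restricted_positive[OF u(2,1)] restricted_positive[OF u'(2,1)] nth_mem x u u' by (metis subsetD)+
    ultimately show "u ! x = u' ! x" by auto
  qed (use u u' in simp)
qed

section \<open>Removing the first letter of a word\<close>

definition renumber :: "int \<Rightarrow> int \<Rightarrow> int" where
  "renumber t l = (if t < l then l - 1 else l)"

lemma renumber_strict_mono: "t \<notin> A \<Longrightarrow> strict_mono_on A (renumber t)"
proof (rule strict_mono_onI)
  fix r s assume "t \<notin> A" "r \<in> A" "s \<in> A" "r < s"
  then have "r \<noteq> t" by auto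
  then show "renumber t r < renumber t s" using \<open>r < s\<close> by (auto simp: renumber_def)
qed

lemma renumber_image:
  assumes "0 \<le> t" "t \<le> int n" "1 \<le> n"
  shows "renumber t ` ({0..int n} - {t}) = {0..int (n - 1)}"
proof
  show "{0..int (n - 1)} \<subseteq> renumber t ` ({0..int n} - {t})"
  proof
    fix l assume l: "l \<in> {0..int (n - 1)}"
    show "l \<in> renumber t ` ({0..int n} - {t})"
      by (rule image_eqI[of _ _ "if l < t then l else l + 1"]) (use l assms in \<open>auto simp: renumber_def\<close>)
  qed
qed (use assms in \<open>auto simp: renumber_def\<close>)

lemma remove_rightmost_zero:
  fixes A B :: "nat list"
  assumes "0 \<notin> set B"
  shows "rev (remove1 0 (rev (A @ 0 # B))) = A @ B"
  using assms by (simp add: remove1_append)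

text \<open>The effect of r on words: the first letter \<open>j\<close> is removed, and with it the largest column
  \<open>t\<close> that does not occur in the rest.\<close>

locale first_letter =
  fixes k :: "nat list" and n :: nat and j :: int and u :: "int list" and t :: int
  assumes word: "j # u \<in> words k" and n: "n = length k"
    and t: "t = Max ({0..int n} - set u)"
begin

lemma len: "n = Suc (length u)"
  using word n by (simp add: words_def)

lemma n_pos: "1 \<le> n" by (simp add: len)

lemma restr: "restricted {0..int n} (j # u)"
  using word n by (simp add: words_def)

lemma count: "l \<in> {1..n} \<Longrightarrow> count_list (j # u) (int l) = k ! (l - 1)"
  using word n by (simp add: words_def)

lemma j: "j \<in> {1..int n}" and u_sub: "set u \<subseteq> {1..int n}"
  using restricted_positive[OF restr] len by simp_all

lemma step: "\<forall>s \<in> {0..int n}. j < s \<longrightarrow> s \<in> set u" "restricted ({0..int n} - {t}) u"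
  using restr restricted_Cons[of "{0..int n}" u j] len unfolding t by auto

lemma t_in: "t \<in> {0..int n}" "t \<notin> set u"
  using Max_in[of "{0..int n} - set u"] exists_nonletter[of "{0..int n}" u] len unfolding t by auto

lemma t_max: "s \<in> {0..int n} \<Longrightarrow> t < s \<Longrightarrow> s \<in> set u"
proof (rule ccontr)
  assume "s \<in> {0..int n}" "t < s" "s \<notin> set u"
  moreover from this have "s \<le> t" unfolding t by (intro Max_ge) auto
  ultimately show False by simp
qed

lemma t_pos: "1 \<le> t"
proof (rule ccontr)
  assume "\<not> 1 \<le> t"
  then have "{1..int n} \<subseteq> set u" using t_max by auto
  then have "card {1..int n} \<le> length u" by (meson List.finite_set card_length card_mono le_trans)
  then show False using len by simp
qed

lemma last_zero: "int (last_zero k) = Max ({0..int n} - set (j # u))"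
proof -
  have z: "k ! (l - 1) = 0 \<longleftrightarrow> int l \<notin> set (j # u)" if "l \<in> {1..n}" for l
    using count[OF that] count_list_0_iff by metis
  have 0: "0 \<notin> set (j # u)" using j u_sub by auto
  show ?thesis
  proof (cases "0 \<in> set k")
    case True
    define Z where "Z = {l \<in> {1..n}. k ! (l - 1) = 0}"
    obtain x where "x < n" "k ! x = 0" using True by (auto simp: in_set_conv_nth n)
    then have "Suc x \<in> Z" by (auto simp: Z_def)
    then have m: "Max Z \<in> Z" by (intro Max_in) (auto simp: Z_def)
    have "Max ({0..int n} - set (j # u)) = int (Max Z)"
    proof (rule Max_eqI)
      show "int (Max Z) \<in> {0..int n} - set (j # u)" using m z unfolding Z_def by auto
      fix s assume s: "s \<in> {0..int n} - set (j # u)"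
      show "s \<le> int (Max Z)"
      proof (cases "s = 0")
        case False
        then have l: "nat s \<in> {1..n}" "int (nat s) = s" using s by auto
        then have "nat s \<in> Z" using z[of "nat s"] s by (auto simp: Z_def)
        then have "nat s \<le> Max Z" by (intro Max_ge) (auto simp: Z_def)
        then show ?thesis using l by simp
      qed simp
    qed simp
    then show ?thesis using True unfolding last_zero_def Z_def n by simp
  next
    case False
    have "s \<le> 0" if s: "s \<in> {0..int n} - set (j # u)" for s
    proof (rule ccontr)
      assume "\<not> s \<le> 0"
      then have l: "nat s \<in> {1..n}" "int (nat s) = s" using s by auto
      then have "k ! (nat s - 1) = 0" using z s by auto
      moreover have "nat s - 1 < length k" using l n by auto
      ultimately show False using False nth_mem by metis
    qed
    then have "Max ({0..int n} - set (j # u)) = 0" using 0 by (intro Max_eqI) auto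
    then show ?thesis using False by (simp add: last_zero_def)
  qed
qed

lemma in_summands: "nat j \<in> summands k"
proof -
  have "int (last_zero k) \<in> {0..int n} - set (j # u)"
    unfolding last_zero using exists_nonletter[of "{0..int n}" "j # u"] len by (intro Max_in) auto
  then have "int (last_zero k) < j" using step(1) by force
  then show ?thesis using j unfolding summands_def n[symmetric] by auto
qed

text \<open>The entry k_j - 1 is the number of occurrences of j in \<open>u\<close>, so \<open>t\<close> is the position of
  the rightmost zero.\<close>

lemma tilde_eq: "tilde k (nat j) =
  map (\<lambda>x. count_list u (if int x + 1 < t then int x + 1 else int x + 2)) [0..<n - 1]"
proof -
  define k1 where "k1 = k[nat j - 1 := k ! (nat j - 1) - 1]"
  have len1: "length k1 = n" by (simp add: k1_def n)
  have k1: "k1 ! x = count_list u (int x + 1)" if "x < n" for x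
    using count[of "Suc x"] that j n unfolding k1_def
    by (auto simp: nth_list_update add.commute split: if_splits)
  define T where "T = nat t - 1"
  have T: "T < n" "int T + 1 = t" using t_in t_pos by (auto simp: T_def)
  have "k1 ! T = 0" using k1[OF T(1)] T t_in by simp
  then have dec: "k1 = take T k1 @ 0 # drop (Suc T) k1" using T len1 by (metis id_take_nth_drop)
  have "k1 ! x \<noteq> 0" if "Suc T \<le> x" "x < n" for x
  proof -
    have "int x + 1 \<in> set u" using t_max[of "int x + 1"] that T by auto
    then show ?thesis using k1[OF that(2)] by (simp add: count_list_0_iff)
  qed
  then have "0 \<notin> set (drop (Suc T) k1)"
    using len1 by (force simp: in_set_drop_iff)
  then have "tilde k (nat j) = take T k1 @ drop (Suc T) k1"
    unfolding tilde_def k1_def[symmetric] using remove_rightmost_zero dec by metis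
  also have "\<dots> = map (\<lambda>x. count_list u (if int x + 1 < t then int x + 1 else int x + 2)) [0..<n - 1]"
  proof (rule nth_equalityI)
    show "length (take T k1 @ drop (Suc T) k1)
      = length (map (\<lambda>x. count_list u (if int x + 1 < t then int x + 1 else int x + 2)) [0..<n - 1])"
      using len1 T by simp
    fix x assume "x < length (take T k1 @ drop (Suc T) k1)"
    then have x: "x < n - 1" using len1 T by simp
    then show "(take T k1 @ drop (Suc T) k1) ! x
      = map (\<lambda>x. count_list u (if int x + 1 < t then int x + 1 else int x + 2)) [0..<n - 1] ! x"
      using len1 T k1[of x] k1[of "Suc x"] by (auto simp: nth_append add.commute)
  qed
  finally show ?thesis .
qed

lemma renumbered_word: "map (renumber t) u \<in> words (tilde k (nat j))"
proof -
  have ltil: "length (tilde k (nat j)) = n - 1" unfolding tilde_eq by simp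
  have mono: "strict_mono_on ({0..int n} - {t}) (renumber t)" by (rule renumber_strict_mono) simp
  have "restricted {0..int (n - 1)} (map (renumber t) u)"
    using restricted_map[OF mono step(2)] renumber_image[of t n] t_in len by simp
  moreover have "count_list (map (renumber t) u) (int l) = tilde k (nat j) ! (l - 1)" if l: "l \<in> {1..n - 1}" for l
  proof -
    define l' where "l' = (if int l < t then int l else int l + 1)"
    have l': "renumber t l' = int l" "l' \<noteq> t" by (auto simp: l'_def renumber_def)
    have inj: "inj_on (renumber t) (- {t})"
      using renumber_strict_mono[of t "- {t}"] by (intro strict_mono_on_imp_inj_on) simp
    have "count_list (map (renumber t) u) (renumber t l') = count_list u l'"
    proof (cases "l' \<in> set u")
      case True
      then show ?thesis using t_in inj by (intro count_list_inj_map) (auto intro: inj_on_subset)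
    next
      case False
      then have "renumber t l' \<notin> renumber t ` set u"
        using inj l' t_in by (auto dest: inj_onD)
      then show ?thesis using False by simp
    qed
    then show ?thesis using l unfolding l' tilde_eq by (auto simp: l'_def algebra_simps)
  qed
  ultimately show ?thesis using len ltil by (simp add: words_def)
qed

lemma r_hat_park: "r_hat n (park (j # u)) = (nat j, park (map (renumber t) u))"
proof -
  define w where "w m = nat ((j # u) ! (m - 1))" for m
  have pk: "park (j # u) = labeling_of n w" unfolding park_def w_def using len by simp
  have col: "column_of (park (j # u)) 1 = nat j"
    unfolding pk using len by (subst column_of_labeling_of) (auto simp: w_def)
  have pos: "u ! x \<in> {1..int n}" if "x < length u" for x using that u_sub nth_mem by blast
  have free: "(\<forall>m \<in> {2..n}. w m \<noteq> l) \<longleftrightarrow> int l \<notin> set u" for l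
  proof
    assume *: "\<forall>m \<in> {2..n}. w m \<noteq> l"
    show "int l \<notin> set u"
    proof
      assume "int l \<in> set u"
      then obtain x where x: "x < length u" "u ! x = int l" by (auto simp: in_set_conv_nth)
      then have "w (Suc (Suc x)) = l" "Suc (Suc x) \<in> {2..n}" using len by (auto simp: w_def)
      then show False using * by blast
    qed
  next
    assume *: "int l \<notin> set u"
    show "\<forall>m \<in> {2..n}. w m \<noteq> l"
    proof
      fix m assume m: "m \<in> {2..n}"
      then obtain x where x: "m = Suc (Suc x)" "x < length u" using len
        by (metis Suc_le_D atLeastAtMost_iff numeral_2_eq_2 Suc_le_mono Suc_le_eq)
      then show "w m \<noteq> l" using * pos[of x] nth_mem[of x u] by (auto simp: w_def)
    qed
  qed
  have a: "nat t = Max {l \<in> {1..n}. \<forall>m \<in> {2..n}. w m \<noteq> l}"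
    unfolding free
  proof (rule Max_eqI[symmetric])
    show "nat t \<in> {l \<in> {1..n}. int l \<notin> set u}" using t_in t_pos by auto
    fix l assume "l \<in> {l \<in> {1..n}. int l \<notin> set u}"
    then show "l \<le> nat t" using t_max[of "int l"] by force
  qed simp
  have "labeling_of (n - 1) (\<lambda>m. skip (nat t) (w (Suc m))) = park (map (renumber t) u)"
  proof -
    have "skip (nat t) (w (Suc m)) = nat (map (renumber t) u ! (m - 1))" if m: "m \<in> {1..n - 1}" for m
    proof -
      have x: "m - 1 < length u" "Suc (m - 1) = m" using m len by auto
      then have "(j # u) ! m = u ! (m - 1)" by (metis nth_Cons_Suc)
      then show ?thesis using x pos[of "m - 1"] t_pos by (auto simp: w_def skip_def renumber_def)
    qed
    then show ?thesis unfolding park_def using len by (auto intro: labeling_of_cong)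
  qed
  then show ?thesis
    unfolding r_hat_def col unfolding pk r_map_labeling_of[OF n_pos a] by simp
qed

end

section \<open>Tours as trees with prescribed winners\<close>

lemma ab_tree_iff: "ab_tree {0..int n} T \<longleftrightarrow> leaf_labeled_tree n T \<and> ab_adjacent T"
proof -
  have labels: "{label_a, label_b} \<union> {0..int n} = leaf_labels n"
    by (auto simp: leaf_labels_def)
  have "(\<exists>p q r. cherry T p q r \<and> lab T p = label_a \<and> lab T q = label_b) \<longleftrightarrow> ab_adjacent T"
    if tri: "trivalent_tree T"
  proof
    assume "\<exists>p q r. cherry T p q r \<and> lab T p = label_a \<and> lab T q = label_b"
    then obtain p q r where c: "cherry T p q r" "lab T p = label_a" "lab T q = label_b" by blast
    then have pq: "p \<in> leaves T" "adj T p r" "q \<in> leaves T" "adj T q r" by (auto simp: cherry_def)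
    then show "ab_adjacent T"
      unfolding ab_adjacent_def
      by (intro bexI[of _ "{p, r}"] bexI[of _ "{q, r}"])
        (use c leaf_edge_labeling_leaf[OF tri] in \<open>auto simp: adj_def\<close>)
  next
    assume "ab_adjacent T"
    then obtain e f where ef: "leaf_edge_labeling T e = Some label_a" "leaf_edge_labeling T f = Some label_b"
      "e \<inter> f \<noteq> {}" unfolding ab_adjacent_def by blast
    obtain p r where p: "e = {p, r}" "p \<in> leaves T" "adj T p r" "lab T p = label_a" "r \<notin> leaves T"
      using leaf_edge_labeling_SomeE[OF tri ef(1)] .
    obtain q r' where q: "f = {q, r'}" "q \<in> leaves T" "adj T q r'" "lab T q = label_b" "r' \<notin> leaves T"
      using leaf_edge_labeling_SomeE[OF tri ef(2)] .
    have "p \<noteq> q" using p q by auto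
    moreover have "r = r'" using ef(3) p q calculation by auto
    ultimately have "cherry T p q r" using p q by (simp add: cherry_def)
    then show "\<exists>p q r. cherry T p q r \<and> lab T p = label_a \<and> lab T q = label_b" using p q by blast
  qed
  then show ?thesis unfolding ab_tree_def leaf_labeled_tree_def labels by auto
qed

lemma wins_round_iff:
  assumes "m \<in> {1..n}"
  shows "wins_round T l m \<longleftrightarrow> winners T n ! (m - 1) = int l"
proof -
  have "m - 1 < n" using assms by auto
  then show ?thesis by (simp add: wins_round_def round_contest_def winners_def)
qed

lemma Tour_trees_iff:
  assumes n: "length k = n"
  shows "T \<in> Tour_trees k \<longleftrightarrow> ab_tree {0..int n} T \<and> winners T n \<in> words k"
proof -
  have "card {m \<in> {1..n}. wins_round T l m} = count_list (winners T n) (int l)" for l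
  proof -
    have "card {m \<in> {1..n}. wins_round T l m} = card {x. x < n \<and> wins_round T l (Suc x)}"
      by (rule card_shift)
    also have "{x. x < n \<and> wins_round T l (Suc x)} = {x. x < length (winners T n) \<and> winners T n ! x = int l}"
      using wins_round_iff[of "Suc x" n T l for x] by auto
    finally show ?thesis by (simp add: count_list_card)
  qed
  moreover have "restricted {0..int n} (winners T n)" if "ab_tree {0..int n} T"
    using winners_restricted[OF that, of n] by simp
  ultimately show ?thesis
    unfolding Tour_trees_def words_def n mem_Collect_eq by (auto simp: ab_tree_iff)
qed

lemma tau_tree_eq:
  assumes T: "ab_tree {0..int n} T"
  shows "tau_tree n T = park (winners T n)"
  unfolding tau_tree_def
proof (rule the_equality)
  have r: "restricted {0..int n} (winners T n)" using winners_restricted[OF T, of n] by simp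
  have sub: "winners T n ! x \<in> {1..int n}" if "x < n" for x
  proof -
    have "winners T n ! x \<in> set (winners T n)" using that by simp
    then show ?thesis using restricted_positive[OF r] by auto
  qed
  have win: "wins_round T j m \<longleftrightarrow> nat (winners T n ! (m - 1)) = j" if m: "m \<in> {1..n}" for m j
  proof -
    have "m - 1 < n" using m by auto
    from sub[OF this] show ?thesis unfolding wins_round_iff[OF m] by (auto simp: nat_eq_iff)
  qed
  show "park (winners T n) \<in> PF n \<and>
    (\<forall>j \<in> {1..n}. \<forall>m \<in> {1..n}. in_column (park (winners T n)) m j \<longleftrightarrow> wins_round T j m)"
    using park_in_PF[OF r] win unfolding park_def in_column_labeling_of by simp
  fix P assume P: "P \<in> PF n \<and> (\<forall>j \<in> {1..n}. \<forall>m \<in> {1..n}. in_column P m j \<longleftrightarrow> wins_round T j m)"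
  have "P = labeling_of n (\<lambda>m. nat (winners T n ! (m - 1)))"
    by (rule PF_eq_labeling_of(1)) (use P win in auto)
  then show "P = park (winners T n)" by (simp add: park_def)
qed

text \<open>Since winners determine the tree, maps on isomorphism classes can be computed on words.\<close>

lemma tree_iso_class:
  assumes T: "T \<in> Tour_trees k" and n: "length k = n"
  shows "tree_iso n `` {T} = {U \<in> Tour_trees k. winners U n = winners T n}"
proof -
  have abT: "ab_tree {0..int n} T" and wT: "winners T n \<in> words k"
    using T Tour_trees_iff[OF n] by auto
  have c: "card {0..int n} = Suc n" by simp
  have triT: "trivalent_tree T" using abT by (simp add: ab_tree_def)
  have "U \<in> Tour_trees k \<and> winners U n = winners T n" if iso: "(T, U) \<in> tree_iso n" for U
  proof -
    have llU: "leaf_labeled_tree n U" using iso by (simp add: tree_iso_def)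
    obtain \<phi> where m: "tree_map id \<phi> T U"
      using iso unfolding tree_iso_def isomorphic_iff_tree_map by blast
    have triU: "trivalent_tree U" using llU by (simp add: leaf_labeled_tree_def)
    obtain p q r where pqr: "cherry T p q r" "lab T p = label_a" "lab T q = label_b"
      using abT by (auto simp: ab_tree_def)
    then have pq: "p \<in> leaves T" "q \<in> leaves T" "r \<in> verts T"
      using cherry_vertex(1)[OF triT pqr(1)] by (simp_all add: cherry_def)
    then have "p \<in> verts T" "q \<in> verts T" using leaves_subset[of T] by auto
    then have "cherry U (\<phi> p) (\<phi> q) (\<phi> r)"
      using tree_map_cherry[OF m trivalent_simple[OF triT] trivalent_simple[OF triU]] pq pqr by simp
    moreover have "lab U (\<phi> p) = label_a" "lab U (\<phi> q) = label_b"
      using m pq pqr by (simp_all add: tree_map_def)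
    moreover have "{label_a, label_b} \<union> {0..int n} = leaf_labels n" by (auto simp: leaf_labels_def)
    then have "bij_betw (lab U) (leaves U) ({label_a, label_b} \<union> {0..int n})"
      using llU by (simp only: leaf_labeled_tree_def)
    moreover have "{0..int n} \<subseteq> {0..}" by auto
    ultimately have abU: "ab_tree {0..int n} U"
      unfolding ab_tree_def using triU by (intro conjI) blast+
    have "winners U n = map id (winners T n)"
      by (rule winners_relabel[OF abT c abU m]) (simp add: strict_mono_on_def)
    then show ?thesis using abU wT Tour_trees_iff[OF n] by simp
  qed
  moreover have "(T, U) \<in> tree_iso n" if U: "U \<in> Tour_trees k" "winners U n = winners T n" for U
  proof -
    have abU: "ab_tree {0..int n} U" using U Tour_trees_iff[OF n] by simp
    have "\<exists>\<phi>. tree_map id \<phi> T U"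
      by (rule tree_determined_by_winners[OF abT abU c]) (simp add: U)
    then show ?thesis
      using abT abU unfolding tree_iso_def isomorphic_iff_tree_map ab_tree_iff by simp
  qed
  ultimately show ?thesis by blast
qed

lemma TourE:
  assumes "C \<in> Tour k" "length k = n"
  obtains T where "T \<in> Tour_trees k" "C = tree_iso n `` {T}"
    "C = {U \<in> Tour_trees k. winners U n = winners T n}"
proof -
  have "C \<in> Tour_trees k // tree_iso n" using assms by (simp add: Tour_def)
  then obtain T where T: "T \<in> Tour_trees k" "C = tree_iso n `` {T}" by (rule quotientE)
  show ?thesis by (rule that[OF T trans[OF T(2) tree_iso_class[OF T(1) assms(2)]]])
qed

lemma the_elem_image_const:
  assumes "x \<in> A" "\<And>y. y \<in> A \<Longrightarrow> f y = f x"
  shows "the_elem (f ` A) = f x"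
proof -
  have "f ` A = (\<lambda>_. f x) ` A" by (rule image_cong[OF refl]) (rule assms(2))
  also have "\<dots> = {f x}" using assms(1) by (rule image_constant)
  finally show ?thesis by simp
qed

lemma tau_class:
  assumes T: "T \<in> Tour_trees k" and n: "length k = n"
  shows "tau n (tree_iso n `` {T}) = park (winners T n)"
proof -
  have tt: "tau_tree n U = park (winners U n)" if "U \<in> Tour_trees k" for U
    using that Tour_trees_iff[OF n] by (intro tau_tree_eq) simp
  have "tau n (tree_iso n `` {T}) = tau_tree n T"
    unfolding tau_def tree_iso_class[OF T n] by (rule the_elem_image_const) (use T tt in auto)
  then show ?thesis using tt[OF T] by simp
qed

lemma tau_bij:
  assumes n: "length k = n"
  shows "bij_betw (tau n) (Tour k) (CPF k)"
  unfolding bij_betw_def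
proof
  show "inj_on (tau n) (Tour k)"
  proof (rule inj_onI)
    fix C D assume C: "C \<in> Tour k" and D: "D \<in> Tour k" and eq: "tau n C = tau n D"
    obtain T where T: "T \<in> Tour_trees k" "C = tree_iso n `` {T}"
      "C = {U \<in> Tour_trees k. winners U n = winners T n}" using TourE[OF C n] .
    obtain U where U: "U \<in> Tour_trees k" "D = tree_iso n `` {U}"
      "D = {V \<in> Tour_trees k. winners V n = winners U n}" using TourE[OF D n] .
    have "park (winners T n) = park (winners U n)"
      using eq tau_class[OF T(1) n] tau_class[OF U(1) n] T(2) U(2) by simp
    then have "winners T n = winners U n"
      using T(1) U(1) Tour_trees_iff[OF n] by (intro inj_onD[OF park_inj[of k]]) auto
    then show "C = D" using T(3) U(3) by simp
  qed
  show "tau n ` Tour k = CPF k"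
  proof
    show "tau n ` Tour k \<subseteq> CPF k"
    proof (rule image_subsetI)
      fix C assume "C \<in> Tour k"
      then obtain T where T: "T \<in> Tour_trees k" "C = tree_iso n `` {T}" using TourE[OF _ n] by metis
      then show "tau n C \<in> CPF k"
        using tau_class[OF T(1) n] Tour_trees_iff[OF n, of T] by (simp add: CPF_eq_park)
    qed
    show "CPF k \<subseteq> tau n ` Tour k"
    proof
      fix P assume "P \<in> CPF k"
      then obtain u where u: "u \<in> words k" "P = park u" by (auto simp: CPF_eq_park)
      then have len: "length u = n" and r: "restricted {0..int n} u" using n by (auto simp: words_def)
      have "card {0..int n} = Suc (length u)" using len by simp
      then obtain T :: "nat ltree" where T: "ab_tree {0..int n} T" "winners T n = u"
        using exists_tree_with_winners[OF _ _ r] len by auto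
      then have "T \<in> Tour_trees k" using Tour_trees_iff[OF n] u by simp
      moreover from this have "tree_iso n `` {T} \<in> Tour k"
        unfolding Tour_def n by (rule quotientI)
      ultimately show "P \<in> tau n ` Tour k" using tau_class[OF _ n, of T] T u by force
    qed
  qed
qed

section \<open>Pruning and the maps to the coproducts\<close>

lemma trivalent_tree_cong:
  assumes "verts U = verts T" "edges U = edges T"
  shows "trivalent_tree U \<longleftrightarrow> trivalent_tree T" "leaves U = leaves T"
proof -
  have [simp]: "adj U = adj T" "degree U = degree T" "cycle U = cycle T"
    using assms by (auto simp: fun_eq_iff adj_def degree_def cycle_def)
  show "trivalent_tree U \<longleftrightarrow> trivalent_tree T" "leaves U = leaves T"
    using assms by (auto simp: trivalent_tree_def finite_tree_def simple_graph_def
        connected_graph_def leaves_def)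
qed

lemma ab_tree_relabel:
  assumes T: "ab_tree S T" and U: "verts U = verts T" "edges U = edges T"
    and lab: "\<And>x. x \<in> leaves T \<Longrightarrow> lab U x = g (lab T x)"
    and g: "inj_on g ({label_a, label_b} \<union> S)" "g label_a = label_a" "g label_b = label_b" "g ` S \<subseteq> {0..}"
  shows "ab_tree (g ` S) U"
proof -
  note c = trivalent_tree_cong[OF U]
  have "bij_betw (g \<circ> lab T) (leaves T) (g ` ({label_a, label_b} \<union> S))"
    by (rule bij_betw_trans[of "lab T" _ "{label_a, label_b} \<union> S"])
      (use T g(1) in \<open>auto simp: ab_tree_def bij_betw_def\<close>)
  then have "bij_betw (lab U) (leaves T) (g ` ({label_a, label_b} \<union> S))"
    by (rule bij_betw_cong[THEN iffD1, rotated]) (use lab in auto)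
  moreover have "g ` ({label_a, label_b} \<union> S) = {label_a, label_b} \<union> g ` S" using g by auto
  ultimately have "bij_betw (lab U) (leaves U) ({label_a, label_b} \<union> g ` S)" by (simp add: c)
  moreover obtain p q r where r: "cherry T p q r" "lab T p = label_a" "lab T q = label_b"
    using T by (auto simp: ab_tree_def)
  moreover have "cherry U p q r" using r(1) U by (auto simp: cherry_def c adj_def)
  moreover have "lab U p = label_a" "lab U q = label_b" using r lab g by (auto simp: cherry_def)
  ultimately show ?thesis using T g(4) unfolding ab_tree_def c by blast
qed

text \<open>The test k_j > 1 asks whether j wins again, so by \<open>lazy_iff\<close> it selects the label that
  advances, and the tree is the pruned tree with its labels renumbered.  For n = 1 the selected
  label may be different, but no round follows.\<close>

lemma pi_tree_winners:
  assumes T: "T \<in> Tour_trees k" and n: "length k = n" "1 \<le> n"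
  obtains j u where "winners T n = j # u" "fst (snd (round_contest T 1)) = j"
    "pi_tree k T \<in> Tour_trees (tilde k (nat j))"
    "winners (pi_tree k T) (n - 1) = map (renumber (Max ({0..int n} - set u))) u"
proof -
  let ?S = "{0..int n}"
  have abT: "ab_tree ?S T" and wT: "winners T n \<in> words k" using T Tour_trees_iff[OF n(1)] by auto
  obtain n' where n': "n = Suc n'" using n(2) by (cases n) auto
  have c: "card ?S = Suc n" by simp
  have "2 \<le> card ?S" using n by simp
  then obtain x y v w where "first_match ?S T x y v w"
    using exists_first_match[OF abT] by blast
  then interpret first_match ?S T x y v w .
  have c': "card S' = Suc n'" using card_S c n' by simp
  define u where "u = winners T' n'"
  have W: "winners T n = j # u" unfolding u_def n' by (rule winners_first[OF c'])
  define t where "t = Max (?S - set u)"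
  interpret fl: first_letter k n j u t
    by unfold_locales (use wT W n t_def in auto)
  have i: "i = Max (?S - set (j # u))"
    using winners_restricted[OF abT c] first_match_axioms W by metis
  have tj: "t = (if j \<in> set u then i else j)"
  proof (cases "j \<in> set u")
    case True
    then have "set (j # u) = set u" by auto
    then show ?thesis using i True by (simp add: t_def)
  next
    case False
    then have "j \<le> t" using fl.t_max[of j] in_S by (meson not_le)
    then show ?thesis using fl.step(1) fl.t_in False by (metis order_le_less)
  qed
  define s where "s = (if j \<in> set u then j else i)"
  have st: "(s, t) = (i, j) \<or> (s, t) = (j, i)" by (simp add: s_def tj)
  have kj: "1 < k ! (nat j - 1) \<longleftrightarrow> j \<in> set u"
  proof -
    have "nat j \<in> {1..n}" "int (nat j) = j" using fl.j by auto
    then have eq: "k ! (nat j - 1) = Suc (count_list u j)" using fl.count[of "nat j"] by simp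
    show ?thesis unfolding eq using count_list_0_iff[of u j] by auto
  qed
  have contest: "round_contest T 1 = (i, j, v, {v, w})"
    by (simp add: round_contest_def face_off_first)
  have D: "{z \<in> leaves T. lab T z = i \<or> lab T z = j} = {x, y}"
    using xy lab_inj[OF tree] by blast
  let ?P = "prune T x y v s"
  have new: "(if 1 < k ! (nat j - 1) then (j, i) else (i, j)) = (s, t)"
    unfolding kj s_def tj by simp
  have pi: "verts (pi_tree k T) = verts ?P" "edges (pi_tree k T) = edges ?P"
    "lab (pi_tree k T) = (\<lambda>z. renumber t (lab ?P z))"
    unfolding pi_tree_def contest case_prod_conv D new Let_def
    by (simp_all add: prune_def renumber_def fun_eq_iff)
  have abP: "ab_tree (?S - {t}) ?P" by (rule ab_tree_prune[OF st])
  have "t \<notin> {label_a, label_b} \<union> (?S - {t})" using fl.t_pos by auto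
  then have mono: "strict_mono_on ({label_a, label_b} \<union> (?S - {t})) (renumber t)"
    by (rule renumber_strict_mono)
  have im: "renumber t ` (?S - {t}) = {0..int (n - 1)}"
    using renumber_image[of t n] fl.t_in n by simp
  have "ab_tree (renumber t ` (?S - {t})) (pi_tree k T)"
    by (rule ab_tree_relabel[OF abP pi(1,2)])
      (use pi(3) im fl.t_pos strict_mono_on_imp_inj_on[OF mono] in \<open>auto simp: renumber_def\<close>)
  then have ab: "ab_tree {0..int (n - 1)} (pi_tree k T)" by (simp only: im)
  have W': "winners (pi_tree k T) n' = map (renumber t) u"
  proof (cases n')
    case 0
    then show ?thesis by (simp add: winners_def u_def)
  next
    case (Suc n2)
    then have "lazy \<longleftrightarrow> j \<notin> set u" using lazy_iff[of n2] c' unfolding u_def by simp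
    then have adv: "adv = s" "out = t" unfolding s_def tj by simp_all
    have "tree_map (renumber t) id T' (pi_tree k T)"
      unfolding tree_map_def pi adv by simp
    then show ?thesis
      unfolding u_def
      by (intro winners_relabel[OF tree' c' ab]) (use mono adv in simp_all)
  qed
  have len: "length (tilde k (nat j)) = n - 1"
    using fl.renumbered_word fl.len by (simp add: words_def)
  have "pi_tree k T \<in> Tour_trees (tilde k (nat j))"
    unfolding Tour_trees_iff[OF len] using ab W' fl.renumbered_word n' by simp
  then show ?thesis using that W contest W' n' unfolding t_def by simp
qed

text \<open>The index j is right of the rightmost zero, so decreasing k_j lowers the sum below the length and
  some entry is 0.\<close>

lemma length_tilde:
  assumes k: "weak_composition n k" and j: "j \<in> summands k"
  shows "length (tilde k j) = n - 1"
proof -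
  have len: "length k = n" "sum_list k = n" using k by (auto simp: weak_composition_def)
  have j': "last_zero k < j" "j \<le> n" using j len by (auto simp: summands_def)
  have "k ! (j - 1) \<noteq> 0"
  proof
    assume z: "k ! (j - 1) = 0"
    then have "j \<in> {l \<in> {1..length k}. k ! (l - 1) = 0}" using j' len by auto
    then have "j \<le> Max {l \<in> {1..length k}. k ! (l - 1) = 0}" by (intro Max_ge) auto
    moreover have "0 \<in> set k" using z j' len nth_mem[of "j - 1" k] by auto
    ultimately show False using j' by (simp add: last_zero_def)
  qed
  define k1 where "k1 = k[j - 1 := k ! (j - 1) - 1]"
  have "0 \<in> set k1"
  proof (rule ccontr)
    assume "0 \<notin> set k1"
    then have "length k1 \<le> sum_list k1"
    proof (induction k1)
      case (Cons a l)
      then show ?case by (cases a) auto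
    qed simp
    moreover have "sum_list k1 = n - 1"
      using j' len \<open>k ! (j - 1) \<noteq> 0\<close> unfolding k1_def by (simp add: sum_list_update)
    ultimately show False using len j' by (simp add: k1_def)
  qed
  then show ?thesis unfolding tilde_def k1_def[symmetric] using len by (simp add: length_remove1 k1_def)
qed

theorem proposition4p11:
  fixes n :: nat and k :: "nat list"
  assumes "n \<ge> 1" and "weak_composition n k"
  shows "bij_betw (tau n) (Tour k) (CPF k) \<and>
    r_hat n \<in> CPF k \<rightarrow> coprod_CPF k \<and>
    pi_lazy k \<in> Tour k \<rightarrow> coprod_Tour k \<and>
    coprod_tau (n - 1) \<in> coprod_Tour k \<rightarrow> coprod_CPF k \<and>
    (\<forall>T \<in> Tour k. r_hat n (tau n T) = coprod_tau (n - 1) (pi_lazy k T))"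
proof (intro conjI)
  have n: "length k = n" using assms(2) by (simp add: weak_composition_def)
  show "bij_betw (tau n) (Tour k) (CPF k)" by (rule tau_bij[OF n])
  have word: "r_hat n (park (j # u)) = (nat j, park (map (renumber (Max ({0..int n} - set u))) u))"
    "nat j \<in> summands k" "map (renumber (Max ({0..int n} - set u))) u \<in> words (tilde k (nat j))"
    if "j # u \<in> words k" for j u
  proof -
    interpret first_letter k n j u "Max ({0..int n} - set u)"
      by unfold_locales (use that n in auto)
    show "r_hat n (park (j # u)) = (nat j, park (map (renumber (Max ({0..int n} - set u))) u))"
      "nat j \<in> summands k" "map (renumber (Max ({0..int n} - set u))) u \<in> words (tilde k (nat j))"
      using r_hat_park in_summands renumbered_word by auto
  qed
  show "r_hat n \<in> CPF k \<rightarrow> coprod_CPF k"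
  proof
    fix P assume "P \<in> CPF k"
    then obtain w where w: "w \<in> words k" "P = park w" by (auto simp: CPF_eq_park)
    then have "w \<noteq> []" using n assms(1) by (auto simp: words_def)
    then obtain j u where "w = j # u" by (cases w) auto
    then show "r_hat n P \<in> coprod_CPF k"
      using word w by (simp add: coprod_CPF_def CPF_eq_park)
  qed
  show "coprod_tau (n - 1) \<in> coprod_Tour k \<rightarrow> coprod_CPF k"
  proof
    fix z assume "z \<in> coprod_Tour k"
    then obtain j C where z: "z = (j, C)" "j \<in> summands k" "C \<in> Tour (tilde k j)"
      by (auto simp: coprod_Tour_def)
    then have "tau (n - 1) C \<in> CPF (tilde k j)"
      using bij_betwE[OF tau_bij[OF length_tilde[OF assms(2)]]] by blast
    then show "coprod_tau (n - 1) z \<in> coprod_CPF k"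
      using z by (simp add: coprod_tau_def coprod_CPF_def)
  qed
  have square: "pi_lazy k C \<in> coprod_Tour k \<and> r_hat n (tau n C) = coprod_tau (n - 1) (pi_lazy k C)"
    if C: "C \<in> Tour k" for C
  proof -
    obtain T where T: "T \<in> Tour_trees k" "C = tree_iso n `` {T}"
      "C = {U \<in> Tour_trees k. winners U n = winners T n}" using TourE[OF C n] .
    obtain j u where ju: "winners T n = j # u" "fst (snd (round_contest T 1)) = j"
      "pi_tree k T \<in> Tour_trees (tilde k (nat j))"
      "winners (pi_tree k T) (n - 1) = map (renumber (Max ({0..int n} - set u))) u"
      using pi_tree_winners[OF T(1) n assms(1)] .
    have W: "j # u \<in> words k" using T(1) Tour_trees_iff[OF n] ju(1) by simp
    note w = word[OF W]
    have len: "length (tilde k (nat j)) = n - 1" using length_tilde[OF assms(2) w(2)] .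
    have "pi_lazy k C = (nat j, tree_iso (n - 1) `` {pi_tree k T})"
    proof -
      have "(nat (fst (snd (round_contest U 1))), tree_iso (n - 1) `` {pi_tree k U}) =
          (nat j, tree_iso (n - 1) `` {pi_tree k T})" if U: "U \<in> C" for U
      proof -
        have U': "U \<in> Tour_trees k" "winners U n = j # u" using U T(3) ju(1) by auto
        obtain j' u' where j': "winners U n = j' # u'" "fst (snd (round_contest U 1)) = j'"
          "pi_tree k U \<in> Tour_trees (tilde k (nat j'))"
          "winners (pi_tree k U) (n - 1) = map (renumber (Max ({0..int n} - set u'))) u'"
          using pi_tree_winners[OF U'(1) n assms(1)] .
        have eq: "j' = j" "u' = u" using j'(1) U'(2) by auto
        show ?thesis
          using j' ju tree_iso_class[OF _ len] unfolding eq by simp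
      qed
      then have "the_elem ((\<lambda>T. (nat (fst (snd (round_contest T 1))), tree_iso (n - 1) `` {pi_tree k T})) ` C)
          = (nat (fst (snd (round_contest T 1))), tree_iso (n - 1) `` {pi_tree k T})"
        using T ju(2) by (intro the_elem_image_const) auto
      then show ?thesis unfolding pi_lazy_def n using ju(2) by simp
    qed
    moreover have "tree_iso (n - 1) `` {pi_tree k T} \<in> Tour (tilde k (nat j))"
      unfolding Tour_def len using ju(3) by (rule quotientI)
    moreover have "tau n C = park (j # u)" using tau_class[OF T(1) n] T(2) ju(1) by simp
    moreover have "tau (n - 1) (tree_iso (n - 1) `` {pi_tree k T}) = park (winners (pi_tree k T) (n - 1))"
      by (rule tau_class[OF ju(3) len])
    ultimately show ?thesis
      using w ju(4) by (simp add: coprod_Tour_def coprod_tau_def)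
  qed
  show "pi_lazy k \<in> Tour k \<rightarrow> coprod_Tour k" using square by blast
  show "\<forall>T \<in> Tour k. r_hat n (tau n T) = coprod_tau (n - 1) (pi_lazy k T)" using square by blast
qed

end
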